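(* Let $\underline\sigma=[\sigma_1,\ldots,\sigma_r]$ be a pure tuple of partitions, let $K=\mathrm{Frac}(\mathrm{Sym}(k^{\oplus\underline\sigma}))$, and let $T^{[n]}\subset K\otimes_k\mathbf V^{\otimes n}$ be the $K$-submodule with $\mathfrak S_n$-action defined as the intersection of the kernels of the maps $\phi_{i,x,S}$ (see context) over all $1\le i\le r$, $x\in S^{\sigma_i}$, and $S\subset\{1,\ldots,n\}$ with $\#S=|\sigma_i|$. Let $\lambda$ be a partition of $n$. Then the $S^\lambda$-isotypic piece (multiplicity space) $\mathrm{Hom}_{\mathfrak S_n}(S^\lambda,T^{[n]})$ of $T^{[n]}$ is isomorphic, as a $K$-module, to the simple $K$-module $L_\lambda$.
   Context: Let $k$ be a field of characteristic $0$, $\mathrm{GL}=\bigcup_{n\ge 1}\mathrm{GL}_n(k)$ (a discrete group), and $\mathbf V=\bigcup_{n\ge1}k^n$. A $k$-linear representation of $\mathrm{GL}$ is polynomial if it is a subquotient of a (possibly infinite) direct sum of tensor powers of $\mathbf V$; $W^{\mathrm{pol}}$ denotes the maximal polynomial subrepresentation of $W$. For a partition $\lambda$, $k^{\oplus\lambda}:=\mathbf S_\lambda(\mathbf V)$ ($\mathbf S_\lambda$ the Schur functor) and $K^{\oplus\lambda}:=K\otimes_kk^{\oplus\lambda}$. A tuple of partitions is pure if it does not contain the empty partition; $k^{\oplus\underline\sigma}:=\bigoplus_ik^{\oplus\sigma_i}$. $S^\lambda$ is the Specht module of $\mathfrak S_{|\lambda|}$ over $k$. A $K$-module is a $K$-vector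 space $M$ with an additive $\mathrm{GL}$-action satisfying $g(am)=(ga)(gm)$ such that every element of $M$ has the form $ax$ with $a\in K$, $x\in M^{\mathrm{pol}}$; morphisms are $K$-linear $\mathrm{GL}$-equivariant maps. $L_\lambda$ is the intersection of the kernels of all $K$-module maps $K^{\oplus\lambda}\to K^{\oplus\mu}$ with $|\mu|<|\lambda|$; it is a simple $K$-module. Let $\phi_i\colon K^{\oplus\sigma_i}\to K$ be the $K$-linear map extending the inclusion $k^{\oplus\sigma_i}\subset\mathrm{Sym}(k^{\oplus\underline\sigma})\subset K$. For $x\in S^{\sigma_i}$, let $\phi_{i,x}\colon K\otimes\mathbf V^{\otimes|\sigma_i|}\to K\otimes\mathbf S_{\sigma_i}(\mathbf V)\to K$ be the composition of the map induced by the $\mathrm{GL}$-map $\mathbf V^{\otimes|\sigma_i|}\to\mathbf S_{\sigma_i}(\mathbf V)$ corresponding to $x$ under the ($\mathfrak S_{|\sigma_i|}$-equivariant) identification $S^{\sigma_i}\cong\mathrm{Hom}_{\mathrm{GL}}(\mathbf V^{\otimes|\sigma_i|},\mathbf S_{\sigma_i}(\mathbf V))$ of Schur–Weyl duality, followed by $\phi_i$. Put $T^n=K\otimes_k\mathbf V^{\otimes n}$, and let $\phi_{i,x,S}\colon T^n\to T^{n-|\sigma_i|}$ be the map applying $\phi_{i,x}$ to the tensor factors indexed by $S$ (in increasing order). *)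

theory Defs
  imports
    "HOL-Algebra.Module"
    "HOL-Library.Poly_Mapping"
    "HOL-Library.List_Lexorder"
    "HOL-Library.Product_Lexorder"
    "HOL-Computational_Algebra.Fraction_Field"
    "HOL-Combinatorics.Permutations"
begin

text \<open>
  The space \<open>V = \<Union>\<^sub>n k\<^sup>n\<close> has basis \<open>e\<^sub>0, e\<^sub>1, \<dots>\<close>, so \<open>V\<^bsup>\<otimes>n\<^esup>\<close> has as basis the words
  \<open>e\<^sub>w = e\<^bsub>w ! 0\<^esub> \<otimes> \<dots> \<otimes> e\<^bsub>w ! (n - 1)\<^esub>\<close> with \<open>w\<close> a list of naturals of length \<open>n\<close>.  For a field \<open>F\<close>,
  an element of \<open>F \<otimes> V\<^bsup>\<otimes>n\<^esup>\<close> is a finitely supported function on lists, with all its keys of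
  length \<open>n\<close>.  The tensor factors are numbered \<open>0, \<dots>, n - 1\<close>, and the members of a tuple
  \<open>\<sigma>\<close> of partitions are numbered \<open>0, \<dots>, r - 1\<close>.

  Representations are carried by subsets of types.  A module over a ring is a
  \<^type>\<open>module\<close> record of HOL-Algebra, and the action of \<open>GL\<close> is a separate function.
\<close>

section \<open>Modules given by their additive structure and scalar multiplication\<close>

text \<open>The module record extends the ring record; the locale \<^locale>\<open>module\<close> does not look
  at its multiplicative fields, which are filled with a dummy.\<close>

definition mk_module ::
    "'m set \<Rightarrow> ('m \<Rightarrow> 'm \<Rightarrow> 'm) \<Rightarrow> 'm \<Rightarrow> ('a \<Rightarrow> 'm \<Rightarrow> 'm) \<Rightarrow> ('a, 'm) module" where
  "mk_module C pl z sm =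
     \<lparr>carrier = C, monoid.mult = (\<lambda>_ _. z), one = z, ring.zero = z, add = pl, smult = sm\<rparr>"

definition linear_map ::
    "('a, 'r) ring_scheme \<Rightarrow> ('a, 'm, 's) module_scheme \<Rightarrow> ('a, 'n, 't) module_scheme \<Rightarrow> ('m \<Rightarrow> 'n) \<Rightarrow> bool" where
  "linear_map R M N f \<longleftrightarrow>
     (\<forall>x\<in>carrier M. f x \<in> carrier N) \<and>
     (\<forall>x\<in>carrier M. \<forall>y\<in>carrier M. f (x \<oplus>\<^bsub>M\<^esub> y) = f x \<oplus>\<^bsub>N\<^esub> f y) \<and>
     (\<forall>a\<in>carrier R. \<forall>x\<in>carrier M. f (a \<odot>\<^bsub>M\<^esub> x) = a \<odot>\<^bsub>N\<^esub> f x)"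

text \<open>The base field \<open>k\<close> is a type; this is \<open>k\<close> as a ring record.\<close>

definition k_ring :: "'k::field ring" where
  "k_ring = \<lparr>carrier = UNIV, monoid.mult = (*), one = 1, ring.zero = 0, add = (+)\<rparr>"


section \<open>The group \<open>GL\<close> and its polynomial representations\<close>

type_synonym 'k mat = "nat \<Rightarrow> nat \<Rightarrow> 'k"

definition mat_one :: "'k::field mat" where
  "mat_one i j = (if i = j then 1 else 0)"

definition mat_mult :: "'k::field mat \<Rightarrow> 'k mat \<Rightarrow> 'k mat" where
  "mat_mult g h i j = Sum_any (\<lambda>l. g i l * h l j)"

definition block :: "nat \<Rightarrow> 'k::field mat \<Rightarrow> bool" where
  "block n g \<longleftrightarrow> (\<forall>i j. i \<ge> n \<or> j \<ge> n \<longrightarrow> g i j = mat_one i j)"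

text \<open>\<open>GL\<^sub>n(k)\<close>, embedded in \<open>GL\<close> by \<open>g \<mapsto> diag(g, 1, 1, \<dots>)\<close>\<close>

definition GL_n :: "nat \<Rightarrow> 'k::field mat set" where
  "GL_n n = {g. block n g \<and> (\<exists>h. block n h \<and> mat_mult g h = mat_one \<and> mat_mult h g = mat_one)}"

definition GL :: "'k::field mat set" where
  "GL = (\<Union>n\<in>{1..}. GL_n n)"

text \<open>\<open>g e\<^sub>w = \<Sum>\<^sub>v (\<Prod>\<^sub>l g\<^bsub>v ! l, w ! l\<^esub>) e\<^sub>v\<close>; see \<open>lookup_gl_word\<close> for finiteness.\<close>

definition gl_word :: "'k::field mat \<Rightarrow> nat list \<Rightarrow> (nat list \<Rightarrow>\<^sub>0 'k)" where
  "gl_word g w = Abs_poly_mapping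
     (\<lambda>v. if length v = length w then \<Prod>l<length w. g (v ! l) (w ! l) else 0)"

lemma lookup_gl_word:
  fixes g :: "'k::field mat"
  assumes "g \<in> GL"
  shows "Poly_Mapping.lookup (gl_word g w) v =
    (if length v = length w then \<Prod>l<length w. g (v ! l) (w ! l) else 0)"
proof -
  from assms obtain n where b: "block n g"
    by (auto simp: GL_def GL_n_def)
  let ?f = "\<lambda>v. if length v = length w then \<Prod>l<length w. g (v ! l) (w ! l) else 0"
  have "set v \<subseteq> {..<n} \<union> set w" if "length v = length w"
    and nz: "(\<Prod>l<length w. g (v ! l) (w ! l)) \<noteq> 0" for v
  proof
    fix x assume "x \<in> set v"
    with that obtain l where l: "l < length w" "v ! l = x"
      by (auto simp: in_set_conv_nth)
    from nz l have "g x (w ! l) \<noteq> 0" by auto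
    with b have "x < n \<or> x = w ! l"
      unfolding block_def mat_one_def by (metis not_le)
    with l show "x \<in> {..<n} \<union> set w" by auto
  qed
  then have "{v. ?f v \<noteq> 0} \<subseteq> {v. set v \<subseteq> {..<n} \<union> set w \<and> length v = length w}"
    by auto
  moreover have "finite {v. set v \<subseteq> {..<n} \<union> set w \<and> length v = length w}"
    by (rule finite_lists_length_eq) simp
  ultimately have "finite {v. ?f v \<noteq> 0}" by (rule finite_subset)
  then show ?thesis by (simp add: gl_word_def)
qed

definition GL_action :: "('a, 'm, 's) module_scheme \<Rightarrow> ('k::field mat \<Rightarrow> 'm \<Rightarrow> 'm) \<Rightarrow> bool" where
  "GL_action M \<rho> \<longleftrightarrow>
     (\<forall>g\<in>GL. \<forall>x\<in>carrier M. \<rho> g x \<in> carrier M) \<and>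
     (\<forall>g\<in>GL. \<forall>x\<in>carrier M. \<forall>y\<in>carrier M. \<rho> g (x \<oplus>\<^bsub>M\<^esub> y) = \<rho> g x \<oplus>\<^bsub>M\<^esub> \<rho> g y) \<and>
     (\<forall>x\<in>carrier M. \<rho> mat_one x = x) \<and>
     (\<forall>g\<in>GL. \<forall>h\<in>GL. \<forall>x\<in>carrier M. \<rho> (mat_mult g h) x = \<rho> g (\<rho> h x))"

definition equivariant ::
    "('a, 'm, 's) module_scheme \<Rightarrow> ('k::field mat \<Rightarrow> 'm \<Rightarrow> 'm) \<Rightarrow> ('k mat \<Rightarrow> 'n \<Rightarrow> 'n) \<Rightarrow> ('m \<Rightarrow> 'n) \<Rightarrow> bool" where
  "equivariant M \<rho> \<tau> f \<longleftrightarrow> (\<forall>g\<in>GL. \<forall>x\<in>carrier M. f (\<rho> g x) = \<tau> g (f x))"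

text \<open>A \<open>k\<close>-linear subrepresentation, given by its carrier\<close>

definition subrep :: "('k::field, 'm) module \<Rightarrow> ('k mat \<Rightarrow> 'm \<Rightarrow> 'm) \<Rightarrow> 'm set \<Rightarrow> bool" where
  "subrep M \<rho> P \<longleftrightarrow> submodule P k_ring M \<and> (\<forall>g\<in>GL. \<forall>x\<in>P. \<rho> g x \<in> P)"

text \<open>\<open>\<Oplus>\<^sub>j V\<^bsup>\<otimes>d j\<^esup>\<close>, with \<open>j\<close> ranging over a whole type\<close>

definition tensor_sum :: "('j \<Rightarrow> nat) \<Rightarrow> ('k::field, ('j \<times> nat list) \<Rightarrow>\<^sub>0 'k) module" where
  "tensor_sum d = mk_module {t. \<forall>(j, w)\<in>Poly_Mapping.keys t. length w = d j}
     (+) 0 (\<lambda>c. Poly_Mapping.map ((*) c))"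

definition tensor_sum_act ::
    "'k::field mat \<Rightarrow> (('j \<times> nat list) \<Rightarrow>\<^sub>0 'k) \<Rightarrow> (('j \<times> nat list) \<Rightarrow>\<^sub>0 'k)" where
  "tensor_sum_act g t = (\<Sum>(j, w)\<in>Poly_Mapping.keys t. \<Sum>v\<in>Poly_Mapping.keys (gl_word g w).
     Poly_Mapping.single (j, v) (Poly_Mapping.lookup t (j, w) * Poly_Mapping.lookup (gl_word g w) v))"

text \<open>Subquotients of direct sums of tensor powers: \<open>U\<close> is the image of a subrepresentation \<open>A\<close>.
  The index type \<open>'u \<times> nat\<close> imposes no restriction: if \<open>U\<close> is a quotient of some
  \<open>A \<subseteq> \<Oplus>\<^sub>j V\<^bsup>\<otimes>d j\<^esup>\<close>, choose a preimage of each \<open>u \<in> U\<close>; it generates a subrepresentation of a finite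
  subsum, and \<open>U\<close> is a quotient of the external direct sum of these.\<close>

definition polynomial_rep :: "('k::field, 'u) module \<Rightarrow> ('k mat \<Rightarrow> 'u \<Rightarrow> 'u) \<Rightarrow> bool" where
  "polynomial_rep U \<rho> \<longleftrightarrow>
     (\<exists>(d :: 'u \<times> nat \<Rightarrow> nat) A f.
        subrep (tensor_sum d) tensor_sum_act A \<and>
        linear_map k_ring ((tensor_sum d)\<lparr>carrier := A\<rparr>) U f \<and>
        equivariant ((tensor_sum d)\<lparr>carrier := A\<rparr>) tensor_sum_act \<rho> f \<and>
        f ` A = carrier U)"

text \<open>The maximal polynomial subrepresentation.  Polynomial representations are closed under direct
  sums and quotients, so the sum of all polynomial subrepresentations is their union.\<close>

definition pol_part :: "('k::field, 'u) module \<Rightarrow> ('k mat \<Rightarrow> 'u \<Rightarrow> 'u) \<Rightarrow> 'u set" where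
  "pol_part M \<rho> = \<Union> {P. subrep M \<rho> P \<and> polynomial_rep (M\<lparr>carrier := P\<rparr>) \<rho>}"


section \<open>Partitions, Specht modules and Schur functors\<close>

definition is_partition :: "nat list \<Rightarrow> bool" where
  "is_partition p \<longleftrightarrow> sorted_wrt (\<ge>) p \<and> 0 \<notin> set p"

definition pure_tuple :: "nat list list \<Rightarrow> bool" where
  "pure_tuple \<sigma> \<longleftrightarrow> (\<forall>p\<in>set \<sigma>. is_partition p \<and> p \<noteq> [])"

text \<open>The boxes \<open>(row, column)\<close> of the Young diagram, read along rows; the \<open>m\<close>-th box is the one
  containing \<open>m\<close> in the standard tableau filled row by row.\<close>

definition boxes :: "nat list \<Rightarrow> (nat \<times> nat) list" where
  "boxes p = concat (map (\<lambda>i. map (\<lambda>j. (i, j)) [0..<p ! i]) [0..<length p])"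

definition row_group :: "nat list \<Rightarrow> (nat \<Rightarrow> nat) set" where
  "row_group p = {s. s permutes {..<sum_list p} \<and>
     (\<forall>m<sum_list p. fst (boxes p ! s m) = fst (boxes p ! m))}"

definition column_group :: "nat list \<Rightarrow> (nat \<Rightarrow> nat) set" where
  "column_group p = {s. s permutes {..<sum_list p} \<and>
     (\<forall>m<sum_list p. snd (boxes p ! s m) = snd (boxes p ! m))}"

text \<open>Elements of the group algebra \<open>F[\<SS>\<^sub>n]\<close> are finitely supported functions whose keys are
  permutations of \<open>{..<n}\<close>; the product is induced by composition of permutations.\<close>

type_synonym 'f galg = "(nat \<Rightarrow> nat) \<Rightarrow>\<^sub>0 'f"

definition group_algebra :: "nat \<Rightarrow> 'f::field galg set" where
  "group_algebra n = {a. \<forall>s\<in>Poly_Mapping.keys a. s permutes {..<n}}"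

definition galg_mult :: "'f::field galg \<Rightarrow> 'f galg \<Rightarrow> 'f galg" where
  "galg_mult a b = (\<Sum>s\<in>Poly_Mapping.keys a. \<Sum>t\<in>Poly_Mapping.keys b.
     Poly_Mapping.single (s \<circ> t) (Poly_Mapping.lookup a s * Poly_Mapping.lookup b t))"

definition row_sum :: "nat list \<Rightarrow> 'f::field galg" where
  "row_sum p = (\<Sum>s\<in>row_group p. Poly_Mapping.single s 1)"

definition signed_column_sum :: "nat list \<Rightarrow> 'f::field galg" where
  "signed_column_sum p = (\<Sum>s\<in>column_group p. Poly_Mapping.single s (of_int (sign s)))"

definition young_symmetrizer :: "nat list \<Rightarrow> 'f::field galg" where
  "young_symmetrizer p = galg_mult (signed_column_sum p) (row_sum p)"

text \<open>The span of the polytabloids \<open>s \<kappa> {t}\<close>, where \<open>\<kappa>\<close> is the signed column sum and the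
  permutation module on tabloids is the left ideal \<open>k[\<SS>\<^sub>n] (row_sum)\<close>: the tabloid \<open>s {t}\<close> is
  \<open>s (row_sum)\<close>.\<close>

definition specht :: "nat list \<Rightarrow> 'k::field galg set" where
  "specht p = {galg_mult a (young_symmetrizer p) | a. a \<in> group_algebra (sum_list p)}"

definition specht_module :: "nat list \<Rightarrow> ('k::field, 'k galg) module" where
  "specht_module p = mk_module (specht p) (+) 0 (\<lambda>c. Poly_Mapping.map ((*) c))"

definition galg_act :: "(nat \<Rightarrow> nat) \<Rightarrow> 'k::field galg \<Rightarrow> 'k galg" where
  "galg_act s = galg_mult (Poly_Mapping.single s 1)"

text \<open>The right action of \<open>F[\<SS>\<^sub>n]\<close> on \<open>F \<otimes> V\<^bsup>\<otimes>n\<^esup>\<close> by place permutations,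
  \<open>(v\<^sub>0 \<otimes> \<dots> \<otimes> v\<^bsub>n-1\<^esub>) s = v\<^bsub>s 0\<^esub> \<otimes> \<dots> \<otimes> v\<^bsub>s (n-1)\<^esub>\<close>, and the left action \<open>s t = t s\<^bsup>-1\<^esup>\<close> of \<open>\<SS>\<^sub>n\<close>\<close>

definition place_right :: "(nat list \<Rightarrow>\<^sub>0 'f::field) \<Rightarrow> 'f galg \<Rightarrow> (nat list \<Rightarrow>\<^sub>0 'f)" where
  "place_right t a = (\<Sum>w\<in>Poly_Mapping.keys t. \<Sum>s\<in>Poly_Mapping.keys a.
     Poly_Mapping.single (permute_list s w) (Poly_Mapping.lookup t w * Poly_Mapping.lookup a s))"

definition place_act :: "(nat \<Rightarrow> nat) \<Rightarrow> (nat list \<Rightarrow>\<^sub>0 'f::field) \<Rightarrow> (nat list \<Rightarrow>\<^sub>0 'f)" where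
  "place_act s t = place_right t (Poly_Mapping.single (inv_into UNIV s) 1)"

text \<open>\<open>S\<^sub>p(V) = V\<^bsup>\<otimes>n\<^esup> c\<^sub>p \<cong> V\<^bsup>\<otimes>n\<^esup> \<otimes>\<^bsub>k[\<SS>\<^sub>n]\<^esub> S\<^sup>p\<close> for \<open>S\<^sup>p = k[\<SS>\<^sub>n] c\<^sub>p\<close>, a subspace of \<open>V\<^bsup>\<otimes>n\<^esup>\<close>\<close>

definition schur :: "nat list \<Rightarrow> (nat list \<Rightarrow>\<^sub>0 'k::field) set" where
  "schur p = {place_right t (young_symmetrizer p) | t.
     \<forall>w\<in>Poly_Mapping.keys t. length w = sum_list p}"


section \<open>The field \<open>K = Frac (Sym (k\<^bsup>\<oplus>\<sigma>\<^esup>))\<close>\<close>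

text \<open>The ambient field is the fraction field of the polynomial ring in variables \<open>X\<^bsub>(i, w)\<^esub>\<close>, indexed
  by positions \<open>i\<close> in the tuple \<open>\<sigma>\<close> and words \<open>w\<close>.  This polynomial ring contains
  \<open>Sym (\<Oplus>\<^sub>i V\<^bsup>\<otimes>|\<sigma>\<^sub>i|\<^esup>)\<close>, the word \<open>e\<^sub>w\<close> in the \<open>i\<close>-th summand being \<open>X\<^bsub>(i, w)\<^esub>\<close>.  Since \<open>k\<close> is a field,
  \<open>Sym (\<Oplus>\<^sub>i S\<^bsub>\<sigma>\<^sub>i\<^esub>(V))\<close> embeds in it, as the subalgebra generated by the \<open>S\<^bsub>\<sigma>\<^sub>i\<^esub>(V) \<subseteq> V\<^bsup>\<otimes>|\<sigma>\<^sub>i|\<^esup>\<close>.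
  The orders on lists and products serve only to obtain the integral domain instance.\<close>

type_synonym 'k mpoly = "((nat \<times> nat list) \<Rightarrow>\<^sub>0 nat) \<Rightarrow>\<^sub>0 'k"
type_synonym 'k ratfun = "'k mpoly fract"

definition Const :: "'k::field \<Rightarrow> 'k mpoly" where
  "Const c = Poly_Mapping.single 0 c"

definition Var :: "nat \<Rightarrow> nat list \<Rightarrow> 'k::field mpoly" where
  "Var i w = Poly_Mapping.single (Poly_Mapping.single (i, w) 1) 1"

definition of_k :: "'k::field \<Rightarrow> 'k ratfun" where
  "of_k c = Fract (Const c) 1"

definition linear_form :: "nat \<Rightarrow> (nat list \<Rightarrow>\<^sub>0 'k::field) \<Rightarrow> 'k mpoly" where
  "linear_form i t = (\<Sum>w\<in>Poly_Mapping.keys t. Const (Poly_Mapping.lookup t w) * Var i w)"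

inductive_set Sym :: "nat list list \<Rightarrow> 'k::field mpoly set" for \<sigma> :: "nat list list" where
  const: "Const c \<in> Sym \<sigma>"
| gen: "i < length \<sigma> \<Longrightarrow> s \<in> schur (\<sigma> ! i) \<Longrightarrow> linear_form i s \<in> Sym \<sigma>"
| add: "a \<in> Sym \<sigma> \<Longrightarrow> b \<in> Sym \<sigma> \<Longrightarrow> a + b \<in> Sym \<sigma>"
| mult: "a \<in> Sym \<sigma> \<Longrightarrow> b \<in> Sym \<sigma> \<Longrightarrow> a * b \<in> Sym \<sigma>"

definition K_field :: "nat list list \<Rightarrow> 'k::field ratfun set" where
  "K_field \<sigma> = {Fract a b | a b. a \<in> Sym \<sigma> \<and> b \<in> Sym \<sigma> \<and> b \<noteq> 0}"

definition K_ring :: "nat list list \<Rightarrow> 'k::field ratfun ring" where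
  "K_ring \<sigma> = \<lparr>carrier = K_field \<sigma>, monoid.mult = (*), one = 1, ring.zero = 0, add = (+)\<rparr>"

text \<open>The action of \<open>GL\<close> on polynomials by algebra automorphisms, \<open>X\<^bsub>(i, w)\<^esub> \<mapsto> g X\<^bsub>(i, w)\<^esub>\<close>\<close>

definition poly_act :: "'k::field mat \<Rightarrow> 'k mpoly \<Rightarrow> 'k mpoly" where
  "poly_act g p = (\<Sum>m\<in>Poly_Mapping.keys p. Const (Poly_Mapping.lookup p m) *
     (\<Prod>(i, w)\<in>Poly_Mapping.keys m. linear_form i (gl_word g w) ^ Poly_Mapping.lookup m (i, w)))"

text \<open>\<open>a/b \<mapsto> (g a)/(g b)\<close>, which is well-defined since \<open>g \<in> GL\<close> acts by an automorphism\<close>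

definition K_act :: "'k::field mat \<Rightarrow> 'k ratfun \<Rightarrow> 'k ratfun" where
  "K_act g z = (THE y. \<exists>a b. b \<noteq> 0 \<and> z = Fract a b \<and> y = Fract (poly_act g a) (poly_act g b))"


section \<open>\<open>K\<close>-modules\<close>

definition restrict_scalars :: "('k::field ratfun, 'm) module \<Rightarrow> ('k, 'm) module" where
  "restrict_scalars M = mk_module (carrier M) (add M) (zero M) (\<lambda>c. smult M (of_k c))"

definition K_module ::
    "nat list list \<Rightarrow> ('k::field ratfun, 'm) module \<Rightarrow> ('k mat \<Rightarrow> 'm \<Rightarrow> 'm) \<Rightarrow> bool" where
  "K_module \<sigma> M \<rho> \<longleftrightarrow>
     module (K_ring \<sigma>) M \<and> GL_action M \<rho> \<and>
     (\<forall>g\<in>GL. \<forall>a\<in>K_field \<sigma>. \<forall>x\<in>carrier M. \<rho> g (a \<odot>\<^bsub>M\<^esub> x) = K_act g a \<odot>\<^bsub>M\<^esub> \<rho> g x) \<and>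
     (\<forall>y\<in>carrier M. \<exists>a\<in>K_field \<sigma>. \<exists>x\<in>pol_part (restrict_scalars M) \<rho>. y = a \<odot>\<^bsub>M\<^esub> x)"

definition K_module_hom ::
    "nat list list \<Rightarrow> ('k::field ratfun, 'm) module \<Rightarrow> ('k mat \<Rightarrow> 'm \<Rightarrow> 'm) \<Rightarrow>
     ('k ratfun, 'n) module \<Rightarrow> ('k mat \<Rightarrow> 'n \<Rightarrow> 'n) \<Rightarrow> ('m \<Rightarrow> 'n) \<Rightarrow> bool" where
  "K_module_hom \<sigma> M \<rho> N \<tau> f \<longleftrightarrow> linear_map (K_ring \<sigma>) M N f \<and> equivariant M \<rho> \<tau> f"

definition K_module_isomorphic ::
    "nat list list \<Rightarrow> ('k::field ratfun, 'm) module \<Rightarrow> ('k mat \<Rightarrow> 'm \<Rightarrow> 'm) \<Rightarrow>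
     ('k ratfun, 'n) module \<Rightarrow> ('k mat \<Rightarrow> 'n \<Rightarrow> 'n) \<Rightarrow> bool" where
  "K_module_isomorphic \<sigma> M \<rho> N \<tau> \<longleftrightarrow>
     K_module \<sigma> M \<rho> \<and> K_module \<sigma> N \<tau> \<and>
     (\<exists>f. K_module_hom \<sigma> M \<rho> N \<tau> f \<and> bij_betw f (carrier M) (carrier N))"

text \<open>\<open>T\<^sup>n = K \<otimes> V\<^bsup>\<otimes>n\<^esup>\<close> with the diagonal action of \<open>GL\<close>\<close>

type_synonym 'k Ktensor = "nat list \<Rightarrow>\<^sub>0 'k ratfun"

definition Ktensor_module :: "'k::field Ktensor set \<Rightarrow> ('k ratfun, 'k Ktensor) module" where
  "Ktensor_module C = mk_module C (+) 0 (\<lambda>a. Poly_Mapping.map ((*) a))"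

definition Ktensor_act :: "'k::field mat \<Rightarrow> 'k Ktensor \<Rightarrow> 'k Ktensor" where
  "Ktensor_act g t = (\<Sum>w\<in>Poly_Mapping.keys t. \<Sum>v\<in>Poly_Mapping.keys (gl_word g w).
     Poly_Mapping.single v
       (K_act g (Poly_Mapping.lookup t w) * of_k (Poly_Mapping.lookup (gl_word g w) v)))"

definition T_power :: "nat list list \<Rightarrow> nat \<Rightarrow> 'k::field Ktensor set" where
  "T_power \<sigma> n = {t. \<forall>w\<in>Poly_Mapping.keys t. length w = n \<and> Poly_Mapping.lookup t w \<in> K_field \<sigma>}"

text \<open>\<open>K\<^bsup>\<oplus>p\<^esup> = K \<otimes> S\<^sub>p(V)\<close>, as the \<open>K\<close>-span of \<open>S\<^sub>p(V)\<close> in \<open>T\<^bsup>|p|\<^esup>\<close>\<close>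

definition K_schur :: "nat list list \<Rightarrow> nat list \<Rightarrow> 'k::field Ktensor set" where
  "K_schur \<sigma> p = {\<Sum>s\<in>B. Poly_Mapping.map ((*) (a s)) (Poly_Mapping.map of_k s) | a B.
     finite B \<and> B \<subseteq> schur p \<and> a ` B \<subseteq> K_field \<sigma>}"

definition L_simple :: "nat list list \<Rightarrow> nat list \<Rightarrow> 'k::field Ktensor set" where
  "L_simple \<sigma> p = {t \<in> K_schur \<sigma> p. \<forall>q f.
     is_partition q \<and> sum_list q < sum_list p \<and>
     K_module_hom \<sigma> (Ktensor_module (K_schur \<sigma> p)) Ktensor_act
       (Ktensor_module (K_schur \<sigma> q)) Ktensor_act f \<longrightarrow> f t = 0}"


section \<open>The module \<open>T\<^bsup>[n]\<^esup>\<close> and its isotypic pieces\<close>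

text \<open>The \<open>K\<close>-linear map \<open>\<phi>\<^sub>i\<close> on \<open>K\<^bsup>\<oplus>\<sigma>\<^sub>i\<^esup>\<close>; the formula is also meaningful on all of \<open>T\<^bsup>|\<sigma>\<^sub>i|\<^esup>\<close>,
  where it takes values in the ambient field.\<close>

definition phi :: "nat \<Rightarrow> 'k::field Ktensor \<Rightarrow> 'k ratfun" where
  "phi i t = (\<Sum>w\<in>Poly_Mapping.keys t. Poly_Mapping.lookup t w * Fract (Var i w) 1)"

text \<open>The identification \<open>S\<^sup>p \<cong> Hom\<^bsub>GL\<^esub>(V\<^bsup>\<otimes>n\<^esup>, S\<^sub>p(V))\<close> sends \<open>x\<close> to \<open>t \<mapsto> t x\<close>; as \<open>x \<in> k[\<SS>\<^sub>n] c\<^sub>p\<close>,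
  the value lies in \<open>V\<^bsup>\<otimes>n\<^esup> c\<^sub>p = S\<^sub>p(V)\<close>.  Since \<open>S\<^sup>p\<close> is absolutely irreducible, the identification is
  unique up to a nonzero scalar.\<close>

definition phi_x :: "nat \<Rightarrow> 'k::field galg \<Rightarrow> 'k Ktensor \<Rightarrow> 'k ratfun" where
  "phi_x i x t = phi i (place_right t (Poly_Mapping.map of_k x))"

text \<open>\<open>e\<^sub>w \<mapsto> \<phi>\<^bsub>i,x\<^esub>(e\<^bsub>w|S\<^esub>) e\<^bsub>w|-S\<^esub>\<close>, where \<open>nths w S\<close> is the subword at the positions in \<open>S\<close>\<close>

definition phi_xS :: "nat \<Rightarrow> 'k::field galg \<Rightarrow> nat set \<Rightarrow> 'k Ktensor \<Rightarrow> 'k Ktensor" where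
  "phi_xS i x S t = (\<Sum>w\<in>Poly_Mapping.keys t.
     Poly_Mapping.single (nths w (- S))
       (Poly_Mapping.lookup t w * phi_x i x (Poly_Mapping.single (nths w S) 1)))"

definition T_bracket :: "nat list list \<Rightarrow> nat \<Rightarrow> 'k::field Ktensor set" where
  "T_bracket \<sigma> n = {t \<in> T_power \<sigma> n. \<forall>i < length \<sigma>. \<forall>x\<in>specht (\<sigma> ! i). \<forall>S.
     S \<subseteq> {..<n} \<and> card S = sum_list (\<sigma> ! i) \<longrightarrow> phi_xS i x S t = 0}"

text \<open>\<open>Hom\<^bsub>\<SS>\<^sub>n\<^esub>(S\<^sup>p, T\<^bsup>[n]\<^esup>)\<close>, with \<open>K\<close> and \<open>GL\<close> acting on values.  Homomorphisms are made to vanish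
  outside \<open>S\<^sup>p\<close>, so that distinct functions are distinct homomorphisms.\<close>

definition isotypic_hom :: "nat list list \<Rightarrow> nat \<Rightarrow> nat list \<Rightarrow> ('k::field galg \<Rightarrow> 'k Ktensor) set" where
  "isotypic_hom \<sigma> n p = {f.
     linear_map k_ring (specht_module p) (restrict_scalars (Ktensor_module (T_bracket \<sigma> n))) f \<and>
     (\<forall>s x. s permutes {..<n} \<and> x \<in> specht p \<longrightarrow> f (galg_act s x) = place_act s (f x)) \<and>
     (\<forall>x. x \<notin> specht p \<longrightarrow> f x = 0)}"

definition isotypic_module ::
    "nat list list \<Rightarrow> nat \<Rightarrow> nat list \<Rightarrow> ('k::field ratfun, 'k galg \<Rightarrow> 'k Ktensor) module" where
  "isotypic_module \<sigma> n p = mk_module (isotypic_hom \<sigma> n p)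
     (\<lambda>f f' x. f x + f' x) (\<lambda>_. 0) (\<lambda>a f x. Poly_Mapping.map ((*) a) (f x))"

definition isotypic_act :: "'k::field mat \<Rightarrow> ('k galg \<Rightarrow> 'k Ktensor) \<Rightarrow> ('k galg \<Rightarrow> 'k Ktensor)" where
  "isotypic_act g f = (\<lambda>x. Ktensor_act g (f x))"

end

theory Submission
  imports "HOL-Computational_Algebra.Polynomial" "HOL-Combinatorics.Orbits" "HOL-Library.Countable" Defs
begin

text \<open>
  Write \<open>c = C R\<close> for the Young symmetrizer of \<open>p\<close>, and \<open>c\<^sup>* = R C\<close> for its image under the antipode.  An
  equivariant map out of the left ideal generated by \<open>c\<close> is determined by its value at \<open>c\<close>; so the multiplicity
  space of \<open>T\<^bsup>[n]\<^esup>\<close> is \<open>T\<^bsup>[n]\<^esup> c\<^sup>*\<close>, and right multiplication by \<open>R\<close> identifies it with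
  \<open>T\<^bsup>[n]\<^esup> c = T\<^bsup>[n]\<^esup> \<inter> K\<^bsup>\<oplus>p\<^esup>\<close>.  It remains to see that this intersection is the simple module.

  If \<open>t\<close> is killed by all maps to smaller \<open>K\<^bsup>\<oplus>q\<^esup>\<close>, then it is killed by the contraction \<open>\<phi>\<^bsub>i,x,S\<^esub>\<close> followed by
  right multiplication by any \<open>s c\<^sub>q\<close>.  The Young symmetrizers \<open>c\<^sub>q\<close> generate the group algebra as a two-sided
  ideal, so already \<open>\<phi>\<^bsub>i,x,S\<^esub> t = 0\<close>.

  Conversely, a map from \<open>K\<^bsup>\<oplus>p\<^esup>\<close> to \<open>K\<^bsup>\<oplus>q\<^esup>\<close> with \<open>|q| < |p|\<close> amounts to an equivariant function \<open>F\<close> on words.  The value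
  \<open>F (w[k := y])\<close> is the coefficient of \<open>\<tau>\<close> in the image of \<open>F w\<close> under \<open>e\<^sub>x \<mapsto> e\<^sub>x + \<tau> e\<^sub>y\<close>, where \<open>x\<close> is the letter at
  position \<open>k\<close>.  Comparing denominators shows that \<open>F\<close> has polynomial coefficients, and the torus shows that
  they are multilinear in the letters of \<open>w\<close>.  Since \<open>|q| < |p|\<close>, every monomial contains a factor
  \<open>\<phi>\<^bsub>i,x\<^esub>\<close> applied to the subword at some \<open>S\<close>, so \<open>F\<close> vanishes on \<open>T\<^bsup>[n]\<^esup>\<close>.
\<close>

text \<open>The field \<open>k\<close> carries no order, so the usual positivity argument for
  \<open>c \<star> c \<noteq> 0\<close> is run on integer coefficients: the elements concerned are
  built from units and signs, and the coefficient of \<open>a \<star> star a\<close> at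
  \<open>id\<close> is a sum of squares of integers. The other obstacle is the field
  \<open>K\<close>. Shears move denominators, and a letter can be replaced by a shear only where it
  occurs once in the word, so replacements go through words of fresh letters. Moreover polynomiality
  is proved in the ring of all word variables, which is larger than the symmetric algebra. To
  return, each variable is replaced by its image under the normalized Young symmetrizer. This
  substitution is a ring homomorphism that fixes \<open>Sym\<close>, hence every polynomial lying in
  \<open>K\<close>. Reading the coefficients of \<open>F\<close> through it turns each variable into
  a contraction, which is where the factor at \<open>S\<close> comes from; multilinearity makes the
  remaining factors independent of the letters at \<open>S\<close>.\<close>

abbreviation galg_times :: "'f::field galg \<Rightarrow> 'f galg \<Rightarrow> 'f galg" (infixl "\<star>" 70) where
  "a \<star> b \<equiv> galg_mult a b"

abbreviation (input) lookup where "lookup \<equiv> Poly_Mapping.lookup"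
abbreviation (input) keys where "keys \<equiv> Poly_Mapping.keys"
abbreviation (input) single where "single \<equiv> Poly_Mapping.single"

section \<open>Linear extension\<close>

abbreviation pscale :: "'f::field \<Rightarrow> ('a \<Rightarrow>\<^sub>0 'f) \<Rightarrow> ('a \<Rightarrow>\<^sub>0 'f)" where
  "pscale a \<equiv> Poly_Mapping.map ((*) a)"

lemma lookup_map_hom: "h 0 = 0 \<Longrightarrow> lookup (Poly_Mapping.map h t) w = h (lookup t w)"
  by (transfer fixing: h) (auto simp: when_def)

lemma lookup_pscale [simp]: "lookup (pscale a t) w = a * lookup t w"
  by (simp add: lookup_map_hom)

lemma map_hom_add: "h 0 = 0 \<Longrightarrow> (\<And>a b. h (a + b) = h a + h b) \<Longrightarrow>
    Poly_Mapping.map h (s + t) = Poly_Mapping.map h s + Poly_Mapping.map h t"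
  by (rule poly_mapping_eqI) (simp add: lookup_map_hom lookup_add)

lemma map_zero [simp]: "Poly_Mapping.map h 0 = 0"
  by (simp add: map_eq_zero_iff)

lemma map_hom_sum: "h 0 = 0 \<Longrightarrow> (\<And>a b. h (a + b) = h a + h b) \<Longrightarrow>
    Poly_Mapping.map h (sum F I) = (\<Sum>i\<in>I. Poly_Mapping.map h (F i))"
  by (induction I rule: infinite_finite_induct) (simp_all add: map_hom_add)

lemma pscale_add: "pscale a (s + t) = pscale a s + pscale a t"
  by (rule map_hom_add) (simp_all add: algebra_simps)

lemma pscale_sum: "pscale a (sum F I) = (\<Sum>i\<in>I. pscale a (F i))"
  by (rule map_hom_sum) (simp_all add: algebra_simps)

lemma pscale_add_left: "pscale (a + b) t = pscale a t + pscale b t"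
  by (rule poly_mapping_eqI) (simp add: lookup_add algebra_simps)

lemma pscale_pscale [simp]: "pscale a (pscale b t) = pscale (a * b) t"
  by (rule poly_mapping_eqI) (simp add: mult.assoc)

lemma pscale_one [simp]: "pscale 1 t = t"
  by (rule poly_mapping_eqI) simp

lemma pscale_zero_left [simp]: "pscale 0 t = 0"
  by (rule poly_mapping_eqI) simp

lemma pscale_minus_one [simp]: "pscale (- 1) t = - t"
  by (rule poly_mapping_eqI) simp

lemma pscale_single [simp]: "pscale a (single w b) = single w (a * b)"
  by simp

lemma pscale_eq_0_iff [simp]: "pscale a t = 0 \<longleftrightarrow> a = 0 \<or> t = 0"
  by (auto simp: poly_mapping_eq_iff fun_eq_iff)

lemma keys_pscale: "keys (pscale a t) \<subseteq> keys t"
  by (auto simp: in_keys_iff)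

lemma poly_mapping_sum_singles:
  "(\<Sum>w\<in>keys t. single w (lookup t w)) = t"
  by (rule poly_mapping_eqI)
     (auto simp: lookup_sum lookup_single when_def sum.delta' in_keys_iff)

lemma poly_mapping_induct_on [consumes 1, case_names zero single add]:
  fixes t :: "'a \<Rightarrow>\<^sub>0 'f::comm_monoid_add"
  assumes "keys t \<subseteq> A" and "P 0"
    and "\<And>w a. w \<in> A \<Longrightarrow> P (single w a)"
    and "\<And>s t. keys s \<subseteq> A \<Longrightarrow> keys t \<subseteq> A \<Longrightarrow> P s \<Longrightarrow> P t \<Longrightarrow> P (s + t)"
  shows "P t"
proof -
  \<comment> \<open>The support bound travels with \<open>P\<close>, because the hypothesis for sums
    asks for it of both summands.\<close>
  have "finite I \<Longrightarrow> I \<subseteq> A \<Longrightarrow> P (\<Sum>w\<in>I. single w (lookup t w)) \<and>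
     keys (\<Sum>w\<in>I. single w (lookup t w)) \<subseteq> A" for I
  proof (induction I rule: finite_induct)
    case empty
    then show ?case using assms by simp
  next
    case (insert x F)
    let ?s = "single x (lookup t x)" and ?r = "\<Sum>w\<in>F. single w (lookup t w)"
    have k: "keys ?s \<subseteq> A" and r: "P ?r" "keys ?r \<subseteq> A" using insert by auto
    have "P (?s + ?r)" using k r assms(3,4) insert.prems by auto
    moreover have "keys (?s + ?r) \<subseteq> A" using keys_add[of ?s ?r] k r by auto
    ultimately show ?case using insert by simp
  qed
  from this[of "keys t"] assms(1) show ?thesis
    by (simp add: poly_mapping_sum_singles)
qed

text \<open>Products, actions and contractions below are all written through this linear extension,
  so that their compatibilities reduce to \<open>lext_lext\<close> and \<open>lext_swap\<close> and
  a check on basis elements.\<close>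

definition lext :: "('a \<Rightarrow> ('b \<Rightarrow>\<^sub>0 'f)) \<Rightarrow> ('a \<Rightarrow>\<^sub>0 'f) \<Rightarrow> ('b \<Rightarrow>\<^sub>0 'f::field)" where
  "lext \<phi> t = (\<Sum>w\<in>keys t. pscale (lookup t w) (\<phi> w))"

lemma lext_zero [simp]: "lext \<phi> 0 = 0"
  by (simp add: lext_def)

lemma lext_add: "lext \<phi> (s + t) = lext \<phi> s + lext \<phi> t"
  unfolding lext_def
  by (rule setsum_keys_plus_distrib[where f = "\<lambda>w a. pscale a (\<phi> w)"]) (simp_all add: pscale_add_left)

lemma lext_sum: "lext \<phi> (sum F I) = (\<Sum>i\<in>I. lext \<phi> (F i))"
  by (induction I rule: infinite_finite_induct) (simp_all add: lext_add)

lemma lext_single [simp]: "lext \<phi> (single w a) = pscale a (\<phi> w)"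
  by (simp add: lext_def)

lemma lext_superset: "finite I \<Longrightarrow> keys t \<subseteq> I \<Longrightarrow>
    lext \<phi> t = (\<Sum>w\<in>I. pscale (lookup t w) (\<phi> w))"
  unfolding lext_def by (rule sum.mono_neutral_left) (auto simp: in_keys_iff)

lemma lext_pscale: "lext \<phi> (pscale a t) = pscale a (lext \<phi> t)"
  by (simp add: lext_superset[OF finite_keys keys_pscale] lext_def[of _ t] pscale_sum mult.assoc)

lemma lookup_lext: "lookup (lext \<phi> t) v =
    (\<Sum>w\<in>keys t. lookup t w * lookup (\<phi> w) v)"
  by (simp add: lext_def lookup_sum)

lemma lext_cong: "(\<And>w. w \<in> keys t \<Longrightarrow> \<phi> w = \<psi> w) \<Longrightarrow> lext \<phi> t = lext \<psi> t"
  by (simp add: lext_def)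

lemma lext_lext: "lext \<psi> (lext \<phi> t) = lext (\<lambda>w. lext \<psi> (\<phi> w)) t"
  by (simp add: lext_def[of \<phi>] lext_def[of "\<lambda>w. lext \<psi> (\<phi> w)"] lext_sum lext_pscale)

lemma lext_single_id [simp]: "lext (\<lambda>w. single w 1) t = t"
  by (simp add: lext_def poly_mapping_sum_singles)

lemma keys_lext: "keys (lext \<phi> t) \<subseteq> (\<Union>w\<in>keys t. keys (\<phi> w))"
proof
  fix v assume "v \<in> keys (lext \<phi> t)"
  then have "(\<Sum>w\<in>keys t. lookup t w * lookup (\<phi> w) v) \<noteq> 0"
    by (simp add: in_keys_iff lookup_lext)
  then obtain w where "w \<in> keys t" "lookup t w * lookup (\<phi> w) v \<noteq> 0"
    by (metis (no_types, lifting) sum.neutral)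
  then show "v \<in> (\<Union>w\<in>keys t. keys (\<phi> w))"
    by (auto simp: in_keys_iff)
qed

lemma lext_add_fun: "lext (\<lambda>w. \<phi> w + \<psi> w) t = lext \<phi> t + lext \<psi> t"
  by (simp add: lext_def pscale_add sum.distrib)

lemma lext_zero_fun [simp]: "lext (\<lambda>w. 0) t = 0"
  by (simp add: lext_def)

lemma lext_pscale_fun: "lext (\<lambda>w. pscale a (\<phi> w)) t = pscale a (lext \<phi> t)"
  by (simp add: lext_def pscale_sum mult.commute)

lemma lext_swap: "lext (\<lambda>v. lext (\<lambda>w. \<phi> v w) t) s = lext (\<lambda>w. lext (\<lambda>v. \<phi> v w) s) t"
  unfolding lext_def by (simp add: pscale_sum mult.commute sum.swap[of _ "keys t"])

lemma map_hom_lext: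
  fixes \<phi> :: "'a \<Rightarrow> ('b \<Rightarrow>\<^sub>0 'f::field)" and h :: "'f \<Rightarrow> 'g::field"
  assumes "h 0 = 0" "\<And>a b. h (a + b) = h a + h b" "\<And>a b. h (a * b) = h a * h b"
  shows "Poly_Mapping.map h (lext \<phi> t) = lext (\<lambda>w. Poly_Mapping.map h (\<phi> w)) (Poly_Mapping.map h t)"
proof -
  \<comment> \<open>Since \<open>h\<close> may kill coefficients, both sums are taken over the
    larger support \<open>keys t\<close>.\<close>
  have k: "keys (Poly_Mapping.map h t) \<subseteq> keys t"
    using assms(1) by (auto simp: in_keys_iff lookup_map_hom)
  have "Poly_Mapping.map h (pscale a s) = pscale (h a) (Poly_Mapping.map h s)" for a and s :: "'b \<Rightarrow>\<^sub>0 'f"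
    by (rule poly_mapping_eqI) (simp add: lookup_map_hom assms)
  then show ?thesis
    by (simp add: lext_superset[OF finite_keys k] lext_def[of _ t] map_hom_sum assms lookup_map_hom)
qed

section \<open>The group algebra of the symmetric group\<close>

lemma galg_mult_lext: "a \<star> b = lext (\<lambda>s. lext (\<lambda>t. single (s \<circ> t) 1) b) a"
  unfolding galg_mult_def lext_def by (simp add: pscale_sum)

lemma galg_mult_single [simp]:
  "single s a \<star> single t b = single (s \<circ> t) (a * b)"
  by (simp add: galg_mult_lext)

lemma galg_mult_zero [simp]: "0 \<star> a = 0" "a \<star> 0 = 0"
  by (simp_all add: galg_mult_lext)

lemma galg_mult_add_left: "(a + b) \<star> c = a \<star> c + b \<star> c"
  by (simp add: galg_mult_lext lext_add)

lemma galg_mult_add_right: "c \<star> (a + b) = c \<star> a + c \<star> b"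
  by (simp add: galg_mult_lext lext_add lext_add_fun)

lemma galg_mult_pscale_left: "pscale x a \<star> b = pscale x (a \<star> b)"
  by (simp add: galg_mult_lext lext_pscale)

lemma galg_mult_pscale_right: "a \<star> pscale x b = pscale x (a \<star> b)"
  by (simp add: galg_mult_lext lext_pscale lext_pscale_fun)

lemma galg_mult_minus_left: "(- a) \<star> b = - (a \<star> b)"
  using galg_mult_pscale_left[of "-1" a b] by simp

lemma galg_mult_sum_left: "sum F I \<star> c = (\<Sum>i\<in>I. F i \<star> c)"
  by (induction I rule: infinite_finite_induct) (simp_all add: galg_mult_add_left)

lemma galg_mult_sum_right: "c \<star> sum F I = (\<Sum>i\<in>I. c \<star> F i)"
  by (induction I rule: infinite_finite_induct) (simp_all add: galg_mult_add_right)

lemma galg_mult_assoc: "a \<star> b \<star> c = a \<star> (b \<star> c)"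
  by (simp add: galg_mult_lext lext_lext o_assoc)

lemma galg_mult_id_left [simp]: "single id 1 \<star> a = a"
  by (simp add: galg_mult_lext)

lemma galg_mult_id_right [simp]: "a \<star> single id 1 = a"
  by (simp add: galg_mult_lext)

lemma group_algebraD: "a \<in> group_algebra n \<Longrightarrow> keys a \<subseteq> {s. s permutes {..<n}}"
  by (auto simp: group_algebra_def)

lemma group_algebraI: "keys a \<subseteq> {s. s permutes {..<n}} \<Longrightarrow> a \<in> group_algebra n"
  by (auto simp: group_algebra_def)

lemma group_algebra_zero [simp]: "0 \<in> group_algebra n"
  by (simp add: group_algebra_def)

lemma group_algebra_single: "s permutes {..<n} \<Longrightarrow> single s a \<in> group_algebra n"
  by (simp add: group_algebra_def)

lemma group_algebra_add: "a \<in> group_algebra n \<Longrightarrow> b \<in> group_algebra n \<Longrightarrow> a + b \<in> group_algebra n"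
  using keys_add[of a b] by (auto simp: group_algebra_def)

lemma group_algebra_sum: "(\<And>i. i \<in> I \<Longrightarrow> F i \<in> group_algebra n) \<Longrightarrow> sum F I \<in> group_algebra n"
  by (induction I rule: infinite_finite_induct) (simp_all add: group_algebra_add)

lemma group_algebra_pscale: "a \<in> group_algebra n \<Longrightarrow> pscale x a \<in> group_algebra n"
  using keys_pscale[of x a] by (auto simp: group_algebra_def)

lemma group_algebra_induct [consumes 1, case_names zero single add]:
  assumes "a \<in> group_algebra n" and "P 0"
    and "\<And>s x. s permutes {..<n} \<Longrightarrow> P (single s x)"
    and "\<And>a b. a \<in> group_algebra n \<Longrightarrow> b \<in> group_algebra n \<Longrightarrow> P a \<Longrightarrow> P b \<Longrightarrow> P (a + b)"
  shows "P a"
  using group_algebraD[OF assms(1)]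
  by (induction a rule: poly_mapping_induct_on) (auto intro: assms group_algebraI)

lemma group_algebra_mult:
  assumes "a \<in> group_algebra n" "b \<in> group_algebra n" shows "a \<star> b \<in> group_algebra n"
  using assms(1)
proof (induction a rule: group_algebra_induct)
  case (single s x)
  from assms(2) show ?case
    by (induction b rule: group_algebra_induct)
       (auto simp: galg_mult_add_right intro: group_algebra_add group_algebra_single permutes_compose single)
qed (auto simp: galg_mult_add_left intro: group_algebra_add)

text \<open>The antipode of the group algebra, anti-multiplicative by \<open>star_mult\<close>. It
  relates left and right actions and provides the adjoint in the positivity argument.\<close>

definition star :: "'f::field galg \<Rightarrow> 'f galg" where
  "star a = lext (\<lambda>s. single (inv_into UNIV s) 1) a"

lemma star_zero [simp]: "star 0 = 0" and star_add: "star (a + b) = star a + star b"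
  and star_sum: "star (sum F I) = (\<Sum>i\<in>I. star (F i))"
  and star_pscale: "star (pscale x a) = pscale x (star a)"
  and star_single [simp]: "star (single s x) = single (inv_into UNIV s) x"
  by (simp_all add: star_def lext_add lext_sum lext_pscale)

lemma star_closed: "a \<in> group_algebra n \<Longrightarrow> star a \<in> group_algebra n"
  by (induction a rule: group_algebra_induct)
     (auto simp: star_add intro: group_algebra_add group_algebra_single permutes_inv)

lemma star_mult:
  assumes "a \<in> group_algebra n" "b \<in> group_algebra n"
  shows "star (a \<star> b) = star b \<star> star a"
  using assms(1)
proof (induction a rule: group_algebra_induct)
  case (single s x)
  from assms(2) show ?case
  proof (induction b rule: group_algebra_induct)
    case (single t y)
    then show ?case using \<open>s permutes {..<n}\<close>
      by (simp add: o_inv_distrib permutes_bij mult.commute)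
  qed (auto simp: galg_mult_add_left galg_mult_add_right star_add)
qed (auto simp: galg_mult_add_left galg_mult_add_right star_add)

lemma lookup_star:
  assumes "a \<in> group_algebra n" "s permutes {..<n}"
  shows "lookup (star a) s = lookup a (inv_into UNIV s)"
  using assms(1)
proof (induction a rule: group_algebra_induct)
  case (single t x)
  have "inv_into UNIV t = s \<longleftrightarrow> t = inv_into UNIV s"
    using single assms(2) permutes_inv_inv by metis
  then show ?case by (simp add: lookup_single when_def)
qed (simp_all add: star_add lookup_add)

text \<open>With \<open>b = star a\<close> the right side becomes the sum of the squares of the
  coefficients of \<open>a\<close>, which is how positivity enters.\<close>

lemma lookup_mult_id:
  assumes "a \<in> group_algebra n" "b \<in> group_algebra n"
  shows "lookup (a \<star> b) id =
    (\<Sum>s | s permutes {..<n}. lookup a s * lookup b (inv_into UNIV s))"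
  using assms(1)
proof (induction a rule: group_algebra_induct)
  case (single s x)
  have fin: "finite {s. s permutes {..<n}}" by (simp add: finite_permutations)
  have "(\<Sum>t | t permutes {..<n}. lookup (single s x) t * lookup b (inv_into UNIV t))
     = (\<Sum>t | t permutes {..<n}. if t = s then x * lookup b (inv_into UNIV s) else 0)"
    by (rule sum.cong) (auto simp: lookup_single when_def)
  also have "\<dots> = x * lookup b (inv_into UNIV s)"
    using single fin by simp
  also have "x * lookup b (inv_into UNIV s) = lookup (single s x \<star> b) id"
    using assms(2)
  proof (induction b rule: group_algebra_induct)
    case (single t y)
    have "s \<circ> t = id \<longleftrightarrow> t = inv_into UNIV s"
      using \<open>s permutes {..<n}\<close> single
      by (metis inv_unique_comp permutes_inv_o(1) permutes_inv_o(2) o_id id_o o_assoc)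
    then show ?case unfolding galg_mult_single by (simp only: lookup_single when_def) auto
  qed (simp_all add: galg_mult_add_right lookup_add algebra_simps)
  finally show ?case ..
qed (simp_all add: galg_mult_add_left lookup_add algebra_simps sum.distrib)

section \<open>Young diagrams\<close>

lemma set_boxes: "set (boxes p) = {(i, j). i < length p \<and> j < p ! i}"
  by (auto simp: boxes_def)

lemma length_boxes: "length (boxes p) = sum_list p"
  by (simp add: boxes_def length_concat o_def map_nth)

lemma distinct_boxes: "distinct (boxes p)"
proof -
  have "distinct (concat (map (\<lambda>i. map (\<lambda>j. (i, j)) [0..<p ! i]) [0..<m]))" for m
    by (induction m) (auto simp: distinct_map inj_on_def)
  then show ?thesis by (simp add: boxes_def)
qed

definition box_row :: "nat list \<Rightarrow> nat \<Rightarrow> nat" where "box_row p m = fst (boxes p ! m)"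
definition box_col :: "nat list \<Rightarrow> nat \<Rightarrow> nat" where "box_col p m = snd (boxes p ! m)"

lemma box_eqI:
  "m < sum_list p \<Longrightarrow> m' < sum_list p \<Longrightarrow> box_row p m = box_row p m' \<Longrightarrow> box_col p m = box_col p m' \<Longrightarrow> m = m'"
  using nth_eq_iff_index_eq[OF distinct_boxes, of m p m'] by (simp add: box_row_def box_col_def prod_eq_iff length_boxes)

lemma box_bound: assumes "m < sum_list p" shows "box_row p m < length p" "box_col p m < p ! box_row p m"
proof -
  have "boxes p ! m \<in> set (boxes p)" using assms by (simp add: length_boxes)
  then show "box_row p m < length p" "box_col p m < p ! box_row p m"
    unfolding set_boxes box_row_def box_col_def by auto
qed

lemma box_ex:
  assumes "i < length p" "j < p ! i" obtains m where "m < sum_list p" "box_row p m = i" "box_col p m = j"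
proof -
  have "(i, j) \<in> set (boxes p)" using assms by (simp add: set_boxes)
  then obtain m where "m < sum_list p" "boxes p ! m = (i, j)"
    by (metis in_set_conv_nth length_boxes)
  then show ?thesis using that by (simp add: box_row_def box_col_def)
qed

text \<open>Row lengths decrease weakly, so a column that meets some row meets every row above
  it.\<close>

lemma box_down:
  assumes "is_partition p" "m < sum_list p" "r \<le> box_row p m"
  obtains m' where "m' < sum_list p" "box_row p m' = r" "box_col p m' = box_col p m"
proof -
  have "r < length p" using box_bound[OF assms(2)] assms(3) by simp
  moreover have "p ! box_row p m \<le> p ! r"
    using assms box_bound[OF assms(2)] unfolding is_partition_def sorted_wrt_iff_nth_less
    by (cases "r = box_row p m") auto
  ultimately show ?thesis using box_ex[of r p "box_col p m"] box_bound[OF assms(2)] that by auto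
qed

section \<open>Box counts and the dominance order\<close>

lemma card_rows_below:
  "card {m. m < sum_list p \<and> box_row p m < k} = sum_list (take k p)"
proof -
  have "bij_betw (\<lambda>m. boxes p ! m) {m. m < sum_list p \<and> box_row p m < k} (SIGMA i:{..<min k (length p)}. {..<p ! i})"
  proof (rule bij_betw_imageI)
    show "inj_on (\<lambda>m. boxes p ! m) {m. m < sum_list p \<and> box_row p m < k}"
      by (auto simp: inj_on_def nth_eq_iff_index_eq[OF distinct_boxes] length_boxes)
    show "(\<lambda>m. boxes p ! m) ` {m. m < sum_list p \<and> box_row p m < k} = (SIGMA i:{..<min k (length p)}. {..<p ! i})"
    proof (intro equalityI subsetI)
      fix x assume "x \<in> (\<lambda>m. boxes p ! m) ` {m. m < sum_list p \<and> box_row p m < k}"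
      then obtain m where m: "x = boxes p ! m" "m < sum_list p" "box_row p m < k" by auto
      then have "x = (box_row p m, box_col p m)" by (simp add: box_row_def box_col_def)
      then show "x \<in> (SIGMA i:{..<min k (length p)}. {..<p ! i})"
        using box_bound[OF m(2)] m(3) by simp
    next
      fix x assume "x \<in> (SIGMA i:{..<min k (length p)}. {..<p ! i})"
      then obtain i j where x: "x = (i, j)" "i < k" "i < length p" "j < p ! i" by auto
      from box_ex[OF x(3,4)] obtain m where "m < sum_list p" "box_row p m = i" "box_col p m = j" .
      then show "x \<in> (\<lambda>m. boxes p ! m) ` {m. m < sum_list p \<and> box_row p m < k}"
        using x unfolding box_row_def box_col_def by (intro image_eqI[of _ _ m]) auto
    qed
  qed
  from bij_betw_same_card[OF this]
  have "card {m. m < sum_list p \<and> box_row p m < k} = (\<Sum>i<min k (length p). p ! i)" by simp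
  also have "\<dots> = sum_list (take k p)"
    by (simp add: sum_list_sum_nth atLeast0LessThan min.commute)
  finally show ?thesis .
qed

text \<open>The condition under which the product of the column sum of \<open>q\<close>, \<open>s\<close> and the row sum of \<open>p\<close> need
  not vanish.\<close>

definition no_pair :: "nat list \<Rightarrow> nat list \<Rightarrow> (nat \<Rightarrow> nat) \<Rightarrow> bool" where
  "no_pair p q s \<longleftrightarrow> (\<forall>i<sum_list p. \<forall>j<sum_list p. i \<noteq> j \<and> box_row p i = box_row p j \<longrightarrow> box_col q (s i) \<noteq> box_col q (s j))"

text \<open>If column \<open>c\<close> of \<open>q\<close> stays within the first \<open>k\<close>
  rows, \<open>s\<close> injects the left set into the right one. Otherwise the column meets each of
  the first \<open>k\<close> rows, so the right side is at least \<open>k\<close>, while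
  \<open>no_pair\<close> allows at most one position on the left for each row of
  \<open>p\<close>.\<close>

lemma column_count_le:
  assumes q: "is_partition q" and n: "sum_list p = n" "sum_list q = n"
    and s: "s permutes {..<n}" and np: "no_pair p q s"
  shows "card {m. m < n \<and> box_row p m < k \<and> box_col q (s m) = c} \<le> card {m. m < n \<and> box_row q m < k \<and> box_col q m = c}"
    (is "card ?A \<le> card ?B")
proof (cases "\<forall>m<n. box_col q m = c \<longrightarrow> box_row q m < k")
  case True
  have "inj_on s ?A" using permutes_inj_on[OF s] .
  moreover have "s ` ?A \<subseteq> ?B" using True permutes_in_image[OF s] by auto
  ultimately show ?thesis by (intro card_inj_on_le) auto
next
  case False
  then obtain m where m: "m < n" "box_col q m = c" "k \<le> box_row q m" by auto
  have "inj_on (box_row p) ?A"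
  proof (rule inj_onI)
    fix i j assume "i \<in> ?A" "j \<in> ?A" "box_row p i = box_row p j"
    then show "i = j" using np n(1) unfolding no_pair_def by (metis (mono_tags, lifting) mem_Collect_eq)
  qed
  then have "card ?A \<le> card {..<k}" by (intro card_inj_on_le) auto
  also have "{..<k} \<subseteq> box_row q ` ?B"
  proof
    fix r assume "r \<in> {..<k}"
    then have "r \<le> box_row q m" using m by simp
    from box_down[OF q _ this] m n obtain m' where "m' < n" "box_row q m' = r" "box_col q m' = c" by metis
    then show "r \<in> box_row q ` ?B" using \<open>r \<in> {..<k}\<close> by auto
  qed
  then have "card {..<k} \<le> card ?B" 
    using card_mono[of "box_row q ` ?B" "{..<k}"] card_image_le[of ?B "box_row q"] by simp
  finally show ?thesis .
qed

lemma sum_column_counts: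
  fixes f :: "nat \<Rightarrow> nat"
  shows
  "(\<Sum>c\<in>f ` {..<n}. card {m. m < n \<and> P m \<and> f m = c}) = card {m. m < (n::nat) \<and> P m}"
proof -
  have "card {m. m < n \<and> P m} = card (\<Union>c\<in>f ` {..<n}. {m. m < n \<and> P m \<and> f m = c})"
    by (rule arg_cong[where f = card]) auto
  also have "\<dots> = (\<Sum>c\<in>f ` {..<n}. card {m. m < n \<and> P m \<and> f m = c})"
    by (rule card_UN_disjoint) auto
  finally show ?thesis ..
qed

lemma no_pair_images:
  assumes "s permutes {..<n}"
  shows "(\<lambda>m. box_col q (s m)) ` {..<n} = box_col q ` {..<n}"
  using permutes_image[OF assms] by (metis image_image)

text \<open>Summing the bound of \<open>column_count_le\<close> over all columns gives the dominance
  inequality.\<close>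

lemma no_pair_dominance:
  assumes "is_partition q" "sum_list p = n" "sum_list q = n" "s permutes {..<n}" "no_pair p q s"
  shows "sum_list (take k p) \<le> sum_list (take k q)"
proof -
  have "sum_list (take k p) = (\<Sum>c\<in>box_col q ` {..<n}. card {m. m < n \<and> box_row p m < k \<and> box_col q (s m) = c})"
    using sum_column_counts[where f = "\<lambda>m. box_col q (s m)" and n = n and P = "\<lambda>m. box_row p m < k"] card_rows_below[of p k] assms
    by (simp add: no_pair_images)
  also have "\<dots> \<le> (\<Sum>c\<in>box_col q ` {..<n}. card {m. m < n \<and> box_row q m < k \<and> box_col q m = c})"
    by (intro sum_mono column_count_le assms)
  also have "\<dots> = sum_list (take k q)"
    using sum_column_counts[where f = "box_col q" and n = n and P = "\<lambda>m. box_row q m < k"] card_rows_below[of q k] assms by simp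
  finally show ?thesis .
qed

text \<open>For \<open>p = q\<close> the columnwise bounds have equal totals on both sides, so each
  of them is an equality. Comparing the counts for \<open>k = box_row p m\<close> and its successor
  shows that the column of \<open>s m\<close> has a box in the row of \<open>m\<close>.\<close>

lemma no_pair_box:
  assumes p: "is_partition p" "sum_list p = n" and s: "s permutes {..<n}" and np: "no_pair p p s"
    and m: "m < n"
  obtains m' where "m' < n" "box_row p m' = box_row p m" "box_col p m' = box_col p (s m)"
proof -
  let ?a = "\<lambda>k c. card {m. m < n \<and> box_row p m < k \<and> box_col p (s m) = c}"
  let ?b = "\<lambda>k c. card {m. m < n \<and> box_row p m < k \<and> box_col p m = c}"
  have eq: "?a k c = ?b k c" if "c \<in> box_col p ` {..<n}" for k c
  proof (rule ccontr)
    assume "?a k c \<noteq> ?b k c"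
    then have "?a k c < ?b k c" using column_count_le[OF p(1,2,2) s np, of k c] by linarith
    then have "(\<Sum>c\<in>box_col p ` {..<n}. ?a k c) < (\<Sum>c\<in>box_col p ` {..<n}. ?b k c)"
      using that column_count_le[OF p(1,2,2) s np, of k] by (intro sum_strict_mono_ex1) auto
    then show False
      using sum_column_counts[where f = "\<lambda>m. box_col p (s m)" and n = n and P = "\<lambda>m. box_row p m < k"]
        sum_column_counts[where f = "box_col p" and n = n and P = "\<lambda>m. box_row p m < k"] card_rows_below[of p k] p s
      by (simp add: no_pair_images)
  qed
  let ?c = "box_col p (s m)" and ?r = "box_row p m"
  have sm: "s m < n" using permutes_in_image[OF s] m by auto
  have c: "?c \<in> box_col p ` {..<n}" using sm by auto
  show ?thesis
  proof (rule ccontr)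
    assume "\<not> thesis"
    then have none: "\<not> (m' < n \<and> box_row p m' = ?r \<and> box_col p m' = ?c)" for m' using that by blast
    have "{m'. m' < n \<and> box_row p m' < Suc ?r \<and> box_col p m' = ?c} = {m'. m' < n \<and> box_row p m' < ?r \<and> box_col p m' = ?c}"
      using none by (auto simp: less_Suc_eq)
    then have "?a (Suc ?r) ?c = ?a ?r ?c" using eq[OF c] by simp
    moreover have "?a ?r ?c < ?a (Suc ?r) ?c"
      by (rule psubset_card_mono) (use m in auto)
    ultimately show False by simp
  qed
qed

lemma partition_eqI:
  assumes p: "is_partition p" "is_partition q" and n: "sum_list p = sum_list q"
    and k: "\<And>k. sum_list (take k p) = sum_list (take k q)"
  shows "p = q"
proof -
  \<comment> \<open>A strictly longer list would end in entries with sum 0, against the positivity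
    of parts. The other inequality follows by symmetry.\<close>
  have len: "length q \<le> length p" if "is_partition q" "sum_list p = sum_list q"
    "\<And>k. sum_list (take k p) = sum_list (take k q)" for p q :: "nat list"
  proof (rule ccontr)
    assume "\<not> ?thesis"
    then have l: "length p < length q" by simp
    have "sum_list q = sum_list (take (length p) q) + sum_list (drop (length p) q)"
      by (metis append_take_drop_id sum_list_append)
    moreover have "sum_list (take (length p) q) = sum_list q" using that(2) that(3)[of "length p"] by simp
    ultimately have "sum_list (drop (length p) q) = 0" by simp
    then have "q ! length p = 0" using l by (simp add: sum_list_eq_0_iff Cons_nth_drop_Suc[symmetric])
    then show False using that(1) l nth_mem unfolding is_partition_def by metis
  qed
  have le: "length p = length q" using len[of q p] len[of p q] assms by force
  show ?thesis
  proof (rule nth_equalityI)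
    fix i assume i: "i < length p"
    then show "p ! i = q ! i" using k[of i] k[of "Suc i"] le by (simp add: take_Suc_conv_app_nth)
  qed (rule le)
qed

section \<open>Young symmetrizers\<close>

definition perm_group :: "nat \<Rightarrow> (nat \<Rightarrow> nat) set \<Rightarrow> bool" where
  "perm_group n H \<longleftrightarrow> H \<subseteq> {s. s permutes {..<n}} \<and> id \<in> H \<and> (\<forall>s\<in>H. \<forall>t\<in>H. s \<circ> t \<in> H) \<and> (\<forall>s\<in>H. inv_into UNIV s \<in> H)"

lemma perm_group_level:
  "perm_group n {s. s permutes {..<n} \<and> (\<forall>m<n. f (s m) = f m)}"
proof -
  have 1: "s m < n" if "s permutes {..<n}" "m < n" for s and m :: nat using permutes_in_image[OF that(1)] that(2) by auto
  have "f (inv_into UNIV s m) = f m" if "s permutes {..<n}" "\<forall>m<n. f (s m) = f m" "m < n" for s m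
    using that(2)[rule_format, of "inv_into UNIV s m"] 1[OF permutes_inv[OF that(1)] that(3)]
    by (simp add: permutes_inverses(1)[OF that(1)])
  then show ?thesis unfolding perm_group_def
    by (auto simp: permutes_id permutes_compose permutes_inv 1)
qed

lemma perm_group_all: "perm_group n {s. s permutes {..<n}}"
  using perm_group_level[of n "\<lambda>_. ()"] by simp

lemma perm_group_finite: "perm_group n H \<Longrightarrow> finite H"
  unfolding perm_group_def using finite_permutations[of "{..<n}"] by (auto intro: finite_subset)

lemma perm_groupD:
  assumes "perm_group n H"
  shows "s \<in> H \<Longrightarrow> s permutes {..<n}" "id \<in> H" "s \<in> H \<Longrightarrow> t \<in> H \<Longrightarrow> s \<circ> t \<in> H"
    "s \<in> H \<Longrightarrow> inv_into UNIV s \<in> H"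
  using assms unfolding perm_group_def by auto

lemma perm_group_bij_left:
  assumes "perm_group n H" "t \<in> H" shows "bij_betw ((\<circ>) t) H H"
proof (rule bij_betwI[where g = "(\<circ>) (inv_into UNIV t)"])
  show "inv_into UNIV t \<circ> (t \<circ> x) = x" "t \<circ> (inv_into UNIV t \<circ> x) = x" for x
    using permutes_inv_o[OF perm_groupD(1)[OF assms]] by (simp_all add: o_assoc)
qed (use perm_groupD[OF assms(1)] assms(2) in auto)

lemma perm_group_bij_right:
  assumes "perm_group n H" "t \<in> H" shows "bij_betw (\<lambda>s. s \<circ> t) H H"
proof (rule bij_betwI[where g = "\<lambda>s. s \<circ> inv_into UNIV t"])
  show "x \<circ> inv_into UNIV t \<circ> t = x" "x \<circ> t \<circ> inv_into UNIV t = x" for x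
    using permutes_inv_o[OF perm_groupD(1)[OF assms]] by (simp_all add: o_assoc[symmetric])
qed (use perm_groupD[OF assms(1)] assms(2) in auto)

lemma perm_group_bij_inv:
  assumes "perm_group n H" shows "bij_betw (inv_into UNIV) H H"
  by (rule bij_betwI[where g = "inv_into UNIV"])
     (use perm_groupD[OF assms] in \<open>auto intro: permutes_inv_inv\<close>)

lemma row_group_perm_group: "perm_group (sum_list p) (row_group p)"
  and column_group_perm_group: "perm_group (sum_list p) (column_group p)"
  unfolding row_group_def column_group_def by (rule perm_group_level)+

lemma permutes_permutation: "s permutes {..<n::nat} \<Longrightarrow> permutation s"
  using permutation_permutes by blast

text \<open>Row sums and signed column sums are the cases of the trivial and the sign character.
  Values of square 1 are their own inverses, so left and right translation rescale the sum by the
  same value.\<close>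

context
  fixes n :: nat and H :: "(nat \<Rightarrow> nat) set" and \<chi> :: "(nat \<Rightarrow> nat) \<Rightarrow> 'f::field"
  assumes H: "perm_group n H"
    and chi_mult: "\<And>s t. s \<in> H \<Longrightarrow> t \<in> H \<Longrightarrow> \<chi> (s \<circ> t) = \<chi> s * \<chi> t"
    and chi_sq: "\<And>s. s \<in> H \<Longrightarrow> \<chi> s * \<chi> s = 1"
    and chi_inv: "\<And>s. s \<in> H \<Longrightarrow> \<chi> (inv_into UNIV s) = \<chi> s"
begin

lemma character_sum_left:
  assumes "t \<in> H"
  shows "single t 1 \<star> (\<Sum>s\<in>H. single s (\<chi> s)) = pscale (\<chi> t) (\<Sum>s\<in>H. single s (\<chi> s))"
proof -
  have "pscale (\<chi> t) (\<Sum>s\<in>H. single s (\<chi> s)) = (\<Sum>s\<in>H. single s (\<chi> t * \<chi> s))"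
    by (simp add: pscale_sum)
  also have "\<dots> = (\<Sum>s\<in>H. single (t \<circ> s) (\<chi> t * \<chi> (t \<circ> s)))"
    by (rule sum.reindex_bij_betw[OF perm_group_bij_left[OF H assms], symmetric])
  also have "\<dots> = (\<Sum>s\<in>H. single (t \<circ> s) (\<chi> s))"
    by (rule sum.cong) (simp_all add: chi_mult assms mult.assoc[symmetric] chi_sq)
  finally show ?thesis by (simp add: galg_mult_sum_right)
qed

lemma character_sum_right:
  assumes "t \<in> H"
  shows "(\<Sum>s\<in>H. single s (\<chi> s)) \<star> single t 1 = pscale (\<chi> t) (\<Sum>s\<in>H. single s (\<chi> s))"
proof -
  have "pscale (\<chi> t) (\<Sum>s\<in>H. single s (\<chi> s)) = (\<Sum>s\<in>H. single s (\<chi> t * \<chi> s))"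
    by (simp add: pscale_sum)
  also have "\<dots> = (\<Sum>s\<in>H. single (s \<circ> t) (\<chi> t * \<chi> (s \<circ> t)))"
    by (rule sum.reindex_bij_betw[OF perm_group_bij_right[OF H assms], symmetric])
  also have "\<dots> = (\<Sum>s\<in>H. single (s \<circ> t) (\<chi> s))"
  proof (rule sum.cong)
    fix s assume "s \<in> H"
    then have "\<chi> t * \<chi> (s \<circ> t) = \<chi> s * (\<chi> t * \<chi> t)" by (simp add: chi_mult assms mult_ac)
    then show "single (s \<circ> t) (\<chi> t * \<chi> (s \<circ> t)) = single (s \<circ> t) (\<chi> s)" by (simp add: chi_sq assms)
  qed simp
  finally show ?thesis by (simp add: galg_mult_sum_left)
qed

lemma character_sum_square:
  "(\<Sum>s\<in>H. single s (\<chi> s)) \<star> (\<Sum>s\<in>H. single s (\<chi> s)) = pscale (of_nat (card H)) (\<Sum>s\<in>H. single s (\<chi> s))"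
proof -
  let ?X = "\<Sum>s\<in>H. single s (\<chi> s)"
  have "?X \<star> ?X = (\<Sum>t\<in>H. pscale (\<chi> t) (single t 1 \<star> ?X))"
    by (subst (1) galg_mult_sum_left) (simp add: galg_mult_pscale_left[symmetric])
  also have "\<dots> = (\<Sum>t\<in>H. ?X)"
    by (rule sum.cong) (simp_all add: character_sum_left chi_sq)
  also have "\<dots> = pscale (of_nat (card H)) ?X"
    by (rule poly_mapping_eqI) (simp add: lookup_sum)
  finally show ?thesis .
qed

lemma star_character_sum: "star (\<Sum>s\<in>H. single s (\<chi> s)) = (\<Sum>s\<in>H. single s (\<chi> s))"
proof -
  have "(\<Sum>s\<in>H. single s (\<chi> s)) = (\<Sum>s\<in>H. single (inv_into UNIV s) (\<chi> (inv_into UNIV s)))"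
    by (rule sum.reindex_bij_betw[OF perm_group_bij_inv[OF H], symmetric])
  also have "\<dots> = (\<Sum>s\<in>H. single (inv_into UNIV s) (\<chi> s))"
    by (rule sum.cong) (simp_all add: chi_inv)
  finally show ?thesis unfolding star_sum star_single by (rule sym)
qed

lemma lookup_character_sum: "lookup (\<Sum>s\<in>H. single s (\<chi> s)) t = (if t \<in> H then \<chi> t else 0)"
  using perm_group_finite[OF H] by (auto simp: lookup_sum lookup_single when_def sum.delta)

lemma character_sum_closed: "(\<Sum>s\<in>H. single s (\<chi> s)) \<in> group_algebra n"
  by (intro group_algebra_sum group_algebra_single perm_groupD(1)[OF H])

end

lemma sign_character:
  assumes "perm_group n H"
  shows "s \<in> H \<Longrightarrow> t \<in> H \<Longrightarrow> (of_int (sign (s \<circ> t)) :: 'f::field) = of_int (sign s) * of_int (sign t)"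
    "s \<in> H \<Longrightarrow> (of_int (sign s) * of_int (sign s) :: 'f) = 1"
    "s \<in> H \<Longrightarrow> (of_int (sign (inv_into UNIV s)) :: 'f) = of_int (sign s)"
proof -
  have p: "permutation s" if "s \<in> H" for s
    using perm_groupD(1)[OF assms that] by (rule permutes_permutation)
  show "s \<in> H \<Longrightarrow> t \<in> H \<Longrightarrow> (of_int (sign (s \<circ> t)) :: 'f::field) = of_int (sign s) * of_int (sign t)"
    "s \<in> H \<Longrightarrow> (of_int (sign s) * of_int (sign s) :: 'f) = 1"
    "s \<in> H \<Longrightarrow> (of_int (sign (inv_into UNIV s)) :: 'f) = of_int (sign s)"
    by (simp_all add: p sign_compose sign_inverse of_int_mult[symmetric] del: of_int_mult)
qed

lemmas column_character = column_group_perm_group sign_character[OF column_group_perm_group]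

lemma row_sum_left: "t \<in> row_group p \<Longrightarrow> single t 1 \<star> row_sum p = (row_sum p :: 'f::field galg)"
  unfolding row_sum_def
  by (subst character_sum_left[where \<chi> = "\<lambda>_. 1", OF row_group_perm_group]) auto

lemma row_sum_square: "row_sum p \<star> row_sum p = pscale (of_nat (card (row_group p))) (row_sum p :: 'f::field galg)"
  unfolding row_sum_def
  by (subst character_sum_square[where \<chi> = "\<lambda>_. 1", OF row_group_perm_group]) auto

lemma star_row_sum: "star (row_sum p) = (row_sum p :: 'f::field galg)"
  unfolding row_sum_def
  by (subst star_character_sum[where \<chi> = "\<lambda>_. 1", OF row_group_perm_group]) auto

lemma lookup_row_sum: "lookup (row_sum p :: 'f::field galg) t = (if t \<in> row_group p then 1 else 0)"
  unfolding row_sum_def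
  by (subst lookup_character_sum[where \<chi> = "\<lambda>_. 1", OF row_group_perm_group]) auto

lemma row_sum_closed: "row_sum p \<in> group_algebra (sum_list p)"
  unfolding row_sum_def
  by (rule character_sum_closed[where \<chi> = "\<lambda>_. 1", OF row_group_perm_group]) auto

lemma column_sum_right:
  "t \<in> column_group p \<Longrightarrow> signed_column_sum p \<star> single t 1 = pscale (of_int (sign t)) (signed_column_sum p)"
  unfolding signed_column_sum_def by (rule character_sum_right[OF column_character])

lemma column_sum_square: "signed_column_sum p \<star> signed_column_sum p =
    pscale (of_nat (card (column_group p))) (signed_column_sum p)"
  unfolding signed_column_sum_def by (rule character_sum_square[OF column_character])

lemma star_column_sum: "star (signed_column_sum p) = signed_column_sum p"
  unfolding signed_column_sum_def by (rule star_character_sum[OF column_character])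

lemma lookup_column_sum:
  "lookup (signed_column_sum p) t = (if t \<in> column_group p then of_int (sign t) else 0)"
  unfolding signed_column_sum_def by (rule lookup_character_sum[OF column_character])

lemma column_sum_closed: "signed_column_sum p \<in> group_algebra (sum_list p)"
  unfolding signed_column_sum_def by (rule character_sum_closed[OF column_character])

lemma young_symmetrizer_closed: "young_symmetrizer p \<in> group_algebra (sum_list p)"
  unfolding young_symmetrizer_def by (intro group_algebra_mult row_sum_closed column_sum_closed)

text \<open>Take two positions in one row of \<open>p\<close> that \<open>s\<close> sends to one
  column of \<open>q\<close>. Their transposition is absorbed by the row sum; moved across
  \<open>s\<close> it becomes a transposition in the column group, absorbed with sign -1. So the
  product equals its own negative.\<close>

lemma column_row_vanish:
  assumes s: "s permutes {..<n}" and n: "sum_list p = n" "sum_list q = n" and np: "\<not> no_pair p q s"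
  shows "signed_column_sum q \<star> single s 1 \<star> row_sum p = (0 :: 'f::field_char_0 galg)"
proof -
  from np n obtain i j where ij: "i < n" "j < n" "i \<noteq> j" "box_row p i = box_row p j" "box_col q (s i) = box_col q (s j)"
    unfolding no_pair_def by auto
  have sij: "s i < n" "s j < n" using ij permutes_in_image[OF s] by auto
  have inj: "s a = s b \<longleftrightarrow> a = b" for a b using permutes_inj[OF s] by (auto simp: inj_def)
  let ?t = "Transposition.transpose i j" and ?u = "Transposition.transpose (s i) (s j)"
  have t: "?t \<in> row_group p"
    using ij n unfolding row_group_def box_row_def by (auto simp: permutes_swap_id Transposition.transpose_def)
  have u: "?u \<in> column_group q"
    using ij sij n unfolding column_group_def box_col_def by (auto simp: permutes_swap_id Transposition.transpose_def)
  have su: "s \<circ> ?t = ?u \<circ> s" by (auto simp: fun_eq_iff Transposition.transpose_def inj)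
  have sg: "sign ?u = - 1" using ij(3) inj by (simp add: sign_swap_id)
  let ?C = "signed_column_sum q :: 'f galg" and ?R = "row_sum p :: 'f galg" and ?s = "single s 1 :: 'f galg"
  have "?C \<star> ?s \<star> ?R = ?C \<star> (?s \<star> single ?t 1) \<star> ?R"
    by (simp add: galg_mult_assoc row_sum_left[OF t] del: galg_mult_single)
  also have "?s \<star> single ?t 1 = single ?u 1 \<star> ?s" by (simp add: su)
  also have "?C \<star> (single ?u 1 \<star> ?s) \<star> ?R = - (?C \<star> ?s \<star> ?R)"
    by (simp only: galg_mult_assoc[symmetric] column_sum_right[OF u] sg)
       (simp add: galg_mult_minus_left)
  finally have e: "?C \<star> ?s \<star> ?R = - (?C \<star> ?s \<star> ?R)" .
  have "x = 0" if "x = - x" for x :: "'f galg"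
  proof (rule poly_mapping_eqI)
    fix k
    have "lookup x k = - lookup x k" using arg_cong[OF that, of "\<lambda>x. lookup x k"] by simp
    then show "lookup x k = lookup 0 k" by simp
  qed
  from this[OF e] show ?thesis .
qed

text \<open>Let \<open>t\<close> move each \<open>m\<close> within its row to the column of
  \<open>s m\<close>, which is possible by \<open>no_pair_box\<close> and injective by
  \<open>no_pair\<close>. What is left of \<open>s\<close> preserves columns.\<close>

lemma column_row_factor:
  assumes p: "is_partition p" "sum_list p = n" and s: "s permutes {..<n}" and np: "no_pair p p s"
  obtains u t where "u \<in> column_group p" "t \<in> row_group p" "s = u \<circ> t"
proof -
  have ex: "\<exists>m'<n. box_row p m' = box_row p m \<and> box_col p m' = box_col p (s m)" if "m < n" for m
    using no_pair_box[OF p s np that] by metis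
  define t where "t m = (if m < n then SOME m'. m' < n \<and> box_row p m' = box_row p m \<and> box_col p m' = box_col p (s m) else m)" for m
  have t: "t m < n" "box_row p (t m) = box_row p m" "box_col p (t m) = box_col p (s m)" if "m < n" for m
    using someI_ex[OF ex[OF that]] that unfolding t_def by auto
  have inj: "inj_on t {..<n}"
  proof (rule inj_onI)
    fix a b assume ab: "a \<in> {..<n}" "b \<in> {..<n}" "t a = t b"
    then have "box_row p a = box_row p b" "box_col p (s a) = box_col p (s b)" using t by (metis lessThan_iff)+
    then show "a = b" using np ab p unfolding no_pair_def by auto
  qed
  have tp: "t permutes {..<n}"
  proof (rule bij_imp_permutes)
    have "t ` {..<n} \<subseteq> {..<n}" using t by auto
    then show "bij_betw t {..<n} {..<n}"
      using inj by (simp add: bij_betw_def endo_inj_surj)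
    show "t x = x" if "x \<notin> {..<n}" for x using that by (simp add: t_def)
  qed
  define u where "u = s \<circ> inv_into UNIV t"
  have ip: "inv_into UNIV t permutes {..<n}" using permutes_inv[OF tp] .
  have "box_col p (u m) = box_col p m" if "m < n" for m
  proof -
    have "inv_into UNIV t m < n" using permutes_in_image[OF ip] that by auto
    from t(3)[OF this] show ?thesis by (simp add: u_def permutes_inverses(1)[OF tp])
  qed
  moreover have "u permutes {..<n}" unfolding u_def using permutes_compose[OF ip s] .
  ultimately have "u \<in> column_group p" using p unfolding column_group_def box_col_def by auto
  moreover have "t \<in> row_group p" using t tp p unfolding row_group_def box_row_def by auto
  moreover have "s = u \<circ> t" by (simp add: u_def o_assoc[symmetric] permutes_inv_o(2)[OF tp])
  ultimately show ?thesis using that by blast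
qed

text \<open>For a single permutation in the middle there are two cases: the product vanishes, or the
  permutation splits into a column and a row part, which the outer factors absorb up to a
  sign.\<close>

lemma column_row_sandwich:
  assumes p: "is_partition p" and x: "x \<in> group_algebra (sum_list p)"
  shows "\<exists>\<eta>. signed_column_sum p \<star> x \<star> row_sum p = pscale \<eta> (young_symmetrizer p :: 'f::field_char_0 galg)"
  using x
proof (induction x rule: group_algebra_induct)
  case zero
  have "pscale 0 (young_symmetrizer p) = (0 :: 'f galg)" by simp
  then show ?case by (metis galg_mult_zero)
next
  case (single s a)
  have sc: "signed_column_sum p \<star> single s a \<star> row_sum p = pscale a (signed_column_sum p \<star> single s 1 \<star> row_sum p)"
    using galg_mult_pscale_right[of "signed_column_sum p" a "single s 1"] galg_mult_pscale_left
    by (metis mult.right_neutral pscale_single)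
  show ?case
  proof (cases "no_pair p p s")
    case True
    from column_row_factor[OF p refl single this] obtain u t where
      ut: "u \<in> column_group p" "t \<in> row_group p" "s = u \<circ> t" .
    have "single s 1 = single u 1 \<star> (single t 1 :: 'f galg)" by (simp add: ut)
    then have "signed_column_sum p \<star> single s 1 \<star> row_sum p
        = (signed_column_sum p \<star> single u 1) \<star> (single t 1 \<star> (row_sum p :: 'f galg))"
      by (simp only: galg_mult_assoc)
    also have "\<dots> = pscale (of_int (sign u)) (young_symmetrizer p)"
      by (simp only: column_sum_right[OF ut(1)] row_sum_left[OF ut(2)] young_symmetrizer_def galg_mult_pscale_left)
    finally show ?thesis unfolding sc by auto
  next
    case False
    then show ?thesis using column_row_vanish[OF single refl refl False] sc
      by (metis pscale_eq_0_iff)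
  qed
next
  case (add a b)
  then show ?case by (metis galg_mult_add_left galg_mult_add_right pscale_add_left)
qed

section \<open>Positivity for integral coefficients\<close>

definition integral_coeffs :: "'f::field_char_0 galg \<Rightarrow> bool" where
  "integral_coeffs a \<longleftrightarrow> (\<forall>s. lookup a s \<in> \<int>)"

lemma integral_coeffs_mult: "integral_coeffs a \<Longrightarrow> integral_coeffs b \<Longrightarrow> integral_coeffs (a \<star> b)"
  unfolding integral_coeffs_def galg_mult_lext lookup_lext
  by (auto intro!: Ints_sum Ints_mult simp: lookup_single when_def)

lemma integral_coeffs_sum: "(\<And>i. i \<in> I \<Longrightarrow> integral_coeffs (F i)) \<Longrightarrow> integral_coeffs (sum F I)"
  unfolding integral_coeffs_def by (auto simp: lookup_sum)

lemma integral_coeffs_single: "integral_coeffs (single s 1)"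
  by (simp add: integral_coeffs_def lookup_single when_def)

lemma integral_coeffs_row_sum: "integral_coeffs (row_sum p)"
  and integral_coeffs_column_sum: "integral_coeffs (signed_column_sum p)"
  by (simp_all add: integral_coeffs_def lookup_row_sum lookup_column_sum)

text \<open>The coefficient of \<open>a \<star> star a\<close> at \<open>id\<close> is a sum of
  squares of integers, and in characteristic 0 it vanishes in the field only if it vanishes in the
  integers.\<close>

lemma integral_positive:
  fixes a :: "'f::field_char_0 galg"
  assumes "a \<in> group_algebra n" "integral_coeffs a" "a \<star> star a = 0"
  shows "a = 0"
proof -
  from assms(2) have "\<forall>s. \<exists>z. lookup a s = of_int z" by (auto simp: integral_coeffs_def elim: Ints_cases)
  then obtain z where z: "\<And>s. lookup a s = of_int (z s)" by metis
  have fin: "finite {s. s permutes {..<n}}" by (simp add: finite_permutations)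
  have "0 = lookup (a \<star> star a) id" using assms by simp
  also have "\<dots> = (\<Sum>s | s permutes {..<n}. lookup a s * lookup a s)"
    unfolding lookup_mult_id[OF assms(1) star_closed[OF assms(1)]]
    by (rule sum.cong) (auto simp: lookup_star[OF assms(1) permutes_inv] permutes_inv_inv)
  also have "\<dots> = of_int (\<Sum>s | s permutes {..<n}. z s * z s)" by (simp add: z)
  finally have "(\<Sum>s | s permutes {..<n}. z s * z s) = 0" by (metis of_int_eq_0_iff)
  then have "z s = 0" if "s permutes {..<n}" for s using that fin by (subst (asm) sum_nonneg_eq_0_iff) auto
  then have "lookup a s = 0" if "s permutes {..<n}" for s using that z by simp
  moreover have "lookup a s = 0" if "\<not> s permutes {..<n}" for s
    using that assms(1) by (auto simp: group_algebra_def in_keys_iff)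
  ultimately show ?thesis by (intro poly_mapping_eqI) (metis lookup_zero)
qed

lemma row_column_trivial: "s \<in> column_group p \<Longrightarrow> s \<in> row_group p \<Longrightarrow> s = id"
proof
  fix m assume s: "s \<in> column_group p" "s \<in> row_group p"
  show "s m = id m"
  proof (cases "m < sum_list p")
    case True
    then have "s m < sum_list p" using s permutes_in_image unfolding row_group_def by fastforce
    then show ?thesis using s box_eqI[of "s m" p m] True unfolding row_group_def column_group_def box_row_def box_col_def by auto
  next
    case False
    then show ?thesis using s unfolding row_group_def permutes_def by auto
  qed
qed

text \<open>The row and column groups meet only in \<open>id\<close>, so a single pair contributes
  to this coefficient.\<close>

lemma lookup_young_symmetrizer_id: "lookup (young_symmetrizer p :: 'f::field galg) id = 1"
proof -
  have "lookup (young_symmetrizer p :: 'f galg) id = (\<Sum>s | s permutes {..<sum_list p}. if s = id then 1 else 0)"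
    unfolding young_symmetrizer_def lookup_mult_id[OF column_sum_closed row_sum_closed]
  proof (rule sum.cong)
    fix s assume s: "s \<in> {s. s permutes {..<sum_list p}}"
    have "s = id" if "s \<in> column_group p" "inv_into UNIV s \<in> row_group p"
      using perm_groupD(4)[OF row_group_perm_group that(2)] row_column_trivial[OF that(1)] s
      by (simp add: permutes_inv_inv)
    moreover have "id \<in> column_group p" "id \<in> row_group p"
      using perm_groupD(2)[OF row_group_perm_group] perm_groupD(2)[OF column_group_perm_group] by auto
    ultimately show "lookup (signed_column_sum p) s * lookup (row_sum p) (inv_into UNIV s) = (if s = id then 1 else 0 :: 'f)"
      by (auto simp: lookup_column_sum lookup_row_sum)
  qed simp
  also have "\<dots> = 1" by (simp add: finite_permutations permutes_id)
  finally show ?thesis .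
qed

lemma young_symmetrizer_nonzero: "(young_symmetrizer p :: 'f::field galg) \<noteq> 0"
  using lookup_young_symmetrizer_id[of p, where ?'f = 'f] by auto

lemma star_young_symmetrizer: "star (young_symmetrizer p) = row_sum p \<star> signed_column_sum p"
  unfolding young_symmetrizer_def
  by (simp add: star_mult[OF column_sum_closed row_sum_closed] star_row_sum star_column_sum)

text \<open>The form \<open>(a, b) \<mapsto> (a b\<^sup>*)\<^sub>i\<^sub>d\<close> is positive definite on elements with integral coefficients, so that
  no such element other than 0 has vanishing product with its adjoint.\<close>

lemma young_symmetrizer_square_nonzero:
  "young_symmetrizer p \<star> young_symmetrizer p \<noteq> (0 :: 'f::field_char_0 galg)"
proof
  let ?C = "signed_column_sum p :: 'f galg" and ?R = "row_sum p :: 'f galg" and ?n = "sum_list p"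
  assume "young_symmetrizer p \<star> young_symmetrizer p = (0 :: 'f galg)"
  then have z: "?C \<star> ?R \<star> (?C \<star> ?R) = 0" by (simp add: young_symmetrizer_def)
  note cl = column_sum_closed[of p] row_sum_closed[of p]
  note it = integral_coeffs_row_sum[of p] integral_coeffs_column_sum[of p]
  \<comment> \<open>Positivity is applied twice. The product of \<open>C R C\<close> with its
    adjoint is a multiple of \<open>C R C R C\<close>, which contains the square assumed to vanish;
    the product of \<open>C R\<close> with its adjoint is a multiple of
    \<open>C R C\<close>.\<close>
  have "?C \<star> ?R \<star> ?C \<star> star (?C \<star> ?R \<star> ?C) = ?C \<star> ?R \<star> (?C \<star> ?C) \<star> ?R \<star> ?C"
    by (simp only: star_mult[OF group_algebra_mult[OF cl] cl(1)] star_mult[OF cl] star_row_sum star_column_sum) (simp only: galg_mult_assoc)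
  also have "\<dots> = pscale (of_nat (card (column_group p))) (?C \<star> ?R \<star> (?C \<star> ?R) \<star> ?C)"
    by (simp add: column_sum_square galg_mult_pscale_left galg_mult_pscale_right galg_mult_assoc)
  also have "\<dots> = 0" by (simp add: z)
  finally have 1: "?C \<star> ?R \<star> ?C \<star> star (?C \<star> ?R \<star> ?C) = 0" .
  have "?C \<star> ?R \<star> ?C = 0"
    by (rule integral_positive[OF _ _ 1, of ?n]) (intro group_algebra_mult cl integral_coeffs_mult it)+
  have "?C \<star> ?R \<star> star (?C \<star> ?R) = ?C \<star> (?R \<star> ?R) \<star> ?C"
    by (simp only: star_mult[OF cl] star_row_sum star_column_sum galg_mult_assoc)
  also have "\<dots> = pscale (of_nat (card (row_group p))) (?C \<star> ?R \<star> ?C)"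
    by (simp only: row_sum_square galg_mult_pscale_left galg_mult_pscale_right)
  also have "\<dots> = 0" by (simp only: \<open>?C \<star> ?R \<star> ?C = 0\<close>) simp
  finally have 2: "?C \<star> ?R \<star> star (?C \<star> ?R) = 0" .
  have "?C \<star> ?R = 0"
    by (rule integral_positive[OF _ _ 2, of ?n]) (intro group_algebra_mult cl integral_coeffs_mult it)+
  then show False using young_symmetrizer_nonzero[of p, where ?'f = 'f] by (simp add: young_symmetrizer_def)
qed

text \<open>Read as \<open>C (R C) R\<close>, the square has the sandwich form and is therefore a
  multiple of the symmetrizer; the factor is nonzero because the square is.\<close>

lemma young_symmetrizer_quasi_idempotent:
  assumes "is_partition p"
  obtains N :: "'f::field_char_0" where "N \<noteq> 0"
    "young_symmetrizer p \<star> young_symmetrizer p = pscale N (young_symmetrizer p)"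
proof -
  have "row_sum p \<star> signed_column_sum p \<in> group_algebra (sum_list p)"
    by (intro group_algebra_mult row_sum_closed column_sum_closed)
  from column_row_sandwich[OF assms this, where ?'f = 'f] obtain N :: 'f where
    "young_symmetrizer p \<star> young_symmetrizer p = pscale N (young_symmetrizer p)"
    by (auto simp: young_symmetrizer_def galg_mult_assoc)
  then show ?thesis using that[of N] young_symmetrizer_square_nonzero[of p, where ?'f = 'f] by auto
qed

section \<open>Completeness of the Young symmetrizers\<close>

text \<open>A trace with values in the centre: the result is central by
  \<open>conj_sum_central\<close>, and \<open>conj_sum_commute\<close> shows that the order of a
  product does not matter.\<close>

definition conj_sum :: "nat \<Rightarrow> 'f::field galg \<Rightarrow> 'f galg" where
  "conj_sum n a = (\<Sum>s | s permutes {..<n}. single s 1 \<star> a \<star> single (inv_into UNIV s) 1)"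

lemma conj_sum_add: "conj_sum n (a + b) = conj_sum n a + conj_sum n b"
  by (simp add: conj_sum_def galg_mult_add_left galg_mult_add_right sum.distrib)

lemma conj_sum_zero [simp]: "conj_sum n 0 = 0"
  by (simp add: conj_sum_def)

lemma conj_sum_pscale: "conj_sum n (pscale x a) = pscale x (conj_sum n a)"
  by (simp add: conj_sum_def galg_mult_pscale_left galg_mult_pscale_right pscale_sum)

lemma conj_sum_closed: "a \<in> group_algebra n \<Longrightarrow> conj_sum n a \<in> group_algebra n"
  unfolding conj_sum_def by (intro group_algebra_sum group_algebra_mult group_algebra_single permutes_inv) auto

lemma inv_comp_permutes:
  "s permutes A \<Longrightarrow> t permutes A \<Longrightarrow> inv_into UNIV (s \<circ> t) = inv_into UNIV t \<circ> inv_into UNIV s"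
  by (simp add: o_inv_distrib permutes_bij)

lemma conj_sum_conjugate:
  assumes t: "t permutes {..<n}"
  shows "conj_sum n (single t 1 \<star> a \<star> single (inv_into UNIV t) 1) = conj_sum n a"
proof -
  let ?P = "{s. s permutes {..<n}}"
  have "conj_sum n a = (\<Sum>s\<in>?P. single (s \<circ> t) 1 \<star> a \<star> single (inv_into UNIV (s \<circ> t)) 1)"
    unfolding conj_sum_def
    by (rule sum.reindex_bij_betw[OF perm_group_bij_right[OF perm_group_all], symmetric]) (simp add: t)
  also have "\<dots> = (\<Sum>s\<in>?P. single s 1 \<star> (single t 1 \<star> a \<star> single (inv_into UNIV t) 1) \<star> single (inv_into UNIV s) 1)"
  proof (rule sum.cong)
    fix s assume "s \<in> ?P"
    then have "single (s \<circ> t) 1 = single s 1 \<star> (single t 1 :: 'a galg)"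
      "single (inv_into UNIV (s \<circ> t)) 1 = single (inv_into UNIV t) 1 \<star> (single (inv_into UNIV s) 1 :: 'a galg)"
      using t by (simp_all add: inv_comp_permutes)
    then show "single (s \<circ> t) 1 \<star> a \<star> single (inv_into UNIV (s \<circ> t)) 1 =
        single s 1 \<star> (single t 1 \<star> a \<star> single (inv_into UNIV t) 1) \<star> single (inv_into UNIV s) 1"
      by (simp only: galg_mult_assoc)
  qed simp
  finally show ?thesis by (simp add: conj_sum_def)
qed

lemma conj_sum_central:
  assumes "x \<in> group_algebra n" shows "x \<star> conj_sum n a = conj_sum n a \<star> x"
  using assms
proof (induction x rule: group_algebra_induct)
  case (single t c)
  let ?P = "{s. s permutes {..<n}}"
  have "single t 1 \<star> conj_sum n a = (\<Sum>s\<in>?P. single (t \<circ> s) 1 \<star> a \<star> single (inv_into UNIV s) 1)"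
    by (simp add: conj_sum_def galg_mult_sum_right galg_mult_assoc[symmetric])
  also have "\<dots> = (\<Sum>s\<in>?P. single (t \<circ> s) 1 \<star> a \<star> single (inv_into UNIV (t \<circ> s)) 1 \<star> single t 1)"
  proof (rule sum.cong)
    fix s assume "s \<in> ?P"
    then have "inv_into UNIV (t \<circ> s) \<circ> t = inv_into UNIV s"
      using single by (simp add: inv_comp_permutes o_assoc[symmetric] permutes_inv_o)
    then show "single (t \<circ> s) 1 \<star> a \<star> single (inv_into UNIV s) 1 =
        single (t \<circ> s) 1 \<star> a \<star> single (inv_into UNIV (t \<circ> s)) 1 \<star> single t (1::'a)"
      by (simp add: galg_mult_assoc)
  qed simp
  also have "\<dots> = (\<Sum>s\<in>?P. single s 1 \<star> a \<star> single (inv_into UNIV s) 1 \<star> single t 1)"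
    by (rule sum.reindex_bij_betw[OF perm_group_bij_left[OF perm_group_all]]) (simp add: single)
  also have "\<dots> = conj_sum n a \<star> single t 1" by (simp add: conj_sum_def galg_mult_sum_left)
  finally have "pscale c (single t 1) \<star> conj_sum n a = conj_sum n a \<star> pscale c (single t 1)"
    by (simp only: galg_mult_pscale_left galg_mult_pscale_right)
  then show ?case by simp
qed (simp_all add: galg_mult_add_left galg_mult_add_right)

text \<open>Conjugating \<open>b \<star> s\<close> by \<open>s\<close> gives
  \<open>s \<star> b\<close>, and conjugate elements have the same sum of conjugates. The
  consequence wanted is that \<open>C R\<close> and \<open>R C\<close> have equal images, which
  makes \<open>central_young\<close> fixed by \<open>star\<close>.\<close>

lemma conj_sum_commute:
  assumes "a \<in> group_algebra n" "b \<in> group_algebra n"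
  shows "conj_sum n (a \<star> b) = conj_sum n (b \<star> a)"
  using assms(1)
proof (induction a rule: group_algebra_induct)
  case (single s x)
  have "single s 1 \<star> (b \<star> single s 1) \<star> single (inv_into UNIV s) 1 = single s 1 \<star> b"
    by (simp add: galg_mult_assoc permutes_inv_o(1)[OF single] )
  then have "conj_sum n (single s 1 \<star> b) = conj_sum n (b \<star> single s 1)"
    using conj_sum_conjugate[OF single, of "b \<star> single s 1"] by simp
  then have "conj_sum n (pscale x (single s 1) \<star> b) = conj_sum n (b \<star> pscale x (single s 1))"
    by (simp only: galg_mult_pscale_left galg_mult_pscale_right conj_sum_pscale)
  then show ?case by simp
qed (simp_all add: galg_mult_add_left galg_mult_add_right conj_sum_add)

lemma star_conj_sum:
  assumes "a \<in> group_algebra n" shows "star (conj_sum n a) = conj_sum n (star a)"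
  unfolding conj_sum_def star_sum
proof (rule sum.cong)
  fix s assume "s \<in> {s. s permutes {..<n}}"
  then have s: "s permutes {..<n}" by simp
  show "star (single s 1 \<star> a \<star> single (inv_into UNIV s) 1) = single s 1 \<star> star a \<star> single (inv_into UNIV s) 1"
    using s assms
    by (simp add: star_mult[of _ n] group_algebra_mult group_algebra_single permutes_inv galg_mult_assoc permutes_inv_inv)
qed simp

text \<open>It is central, and as a sum of conjugates of the symmetrizer it kills every tensor that
  all these conjugates kill.\<close>

definition central_young :: "nat list \<Rightarrow> 'f::field galg" where
  "central_young p = conj_sum (sum_list p) (young_symmetrizer p)"

lemma lookup_conj_id:
  assumes s: "s permutes {..<n}" and a: "a \<in> group_algebra n"
  shows "lookup (single s 1 \<star> a \<star> single (inv_into UNIV s) 1) id = lookup a id"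
  using a
proof (induction a rule: group_algebra_induct)
  case (single t x)
  have "s \<circ> t \<circ> inv_into UNIV s = id \<longleftrightarrow> t = id"
  proof
    assume h: "s \<circ> t \<circ> inv_into UNIV s = id"
    have "t = inv_into UNIV s \<circ> (s \<circ> t \<circ> inv_into UNIV s) \<circ> s"
      by (simp add: o_assoc permutes_inv_o(2)[OF s]) (simp add: o_assoc[symmetric] permutes_inv_o(2)[OF s])
    then show "t = id" by (simp add: h permutes_inv_o(2)[OF s])
  qed (simp add: permutes_inv_o(1)[OF s])
  then show ?case unfolding galg_mult_single by (simp only: lookup_single when_def) simp
qed (simp_all add: galg_mult_add_left galg_mult_add_right lookup_add)

text \<open>The element is fixed by \<open>star\<close> and has integer coefficients, so a vanishing
  square would force it to be 0; but its coefficient at \<open>id\<close> is the order of the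
  symmetric group.\<close>

lemma central_young_square_nonzero:
  "central_young p \<star> central_young p \<noteq> (0 :: 'f::field_char_0 galg)"
proof
  let ?n = "sum_list p" and ?z = "central_young p :: 'f galg"
  assume z: "?z \<star> ?z = 0"
  have "star ?z = conj_sum ?n (row_sum p \<star> signed_column_sum p)"
    by (simp add: central_young_def star_conj_sum young_symmetrizer_closed star_young_symmetrizer)
  also have "\<dots> = ?z"
    by (simp add: central_young_def young_symmetrizer_def conj_sum_commute[OF row_sum_closed column_sum_closed])
  finally have "?z \<star> star ?z = 0" using z by simp
  moreover have "integral_coeffs ?z"
    unfolding central_young_def conj_sum_def young_symmetrizer_def
    by (intro integral_coeffs_sum integral_coeffs_mult integral_coeffs_single integral_coeffs_row_sum integral_coeffs_column_sum)
  moreover have "?z \<in> group_algebra ?n"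
    unfolding central_young_def by (intro conj_sum_closed young_symmetrizer_closed)
  ultimately have "?z = 0" using integral_positive by blast
  moreover have "lookup ?z id = of_nat (card {s. s permutes {..<?n}})"
    by (simp add: central_young_def conj_sum_def lookup_sum lookup_conj_id[OF _ young_symmetrizer_closed]
        lookup_young_symmetrizer_id)
  ultimately have "(of_nat (card {s. s permutes {..<?n}}) :: 'f) = 0" by simp
  then show False by (simp add: card_permutations)
qed

text \<open>If neither of the two pairings of rows with columns were always obstructed, each
  partition would dominate the other and they would be equal. The obstructed pairing kills the
  product in one order, and centrality gives the other order.\<close>

lemma central_young_orthogonal:
  assumes p: "is_partition p" "sum_list p = n" and q: "is_partition q" "sum_list q = n" and ne: "p \<noteq> q"
  shows "central_young p \<star> central_young q = (0 :: 'f::field_char_0 galg)"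
proof -
  have main: "central_young q \<star> central_young p = (0 :: 'f galg)"
    if p: "sum_list p = n" and q: "sum_list q = n"
      and np: "\<And>s. s permutes {..<n} \<Longrightarrow> \<not> no_pair q p s" for p q
  proof -
    \<comment> \<open>The antipode turns the vanishing of column sum times row sum into that of row
      sum times column sum, the form met inside a product of two symmetrizers.\<close>
    have v: "row_sum q \<star> single s 1 \<star> signed_column_sum p = (0 :: 'f galg)" if s: "s permutes {..<n}" for s
    proof -
      have "star (signed_column_sum p \<star> single (inv_into UNIV s) 1 \<star> (row_sum q :: 'f galg)) = 0"
        by (simp add: column_row_vanish[OF permutes_inv[OF s] q p np[OF permutes_inv[OF s]]])
      moreover have "star (signed_column_sum p \<star> single (inv_into UNIV s) 1 \<star> row_sum q)
          = row_sum q \<star> single s 1 \<star> (signed_column_sum p :: 'f galg)"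
      proof -
        note c = column_sum_closed[of p, unfolded p] and r = row_sum_closed[of q, unfolded q]
          and g = group_algebra_single[OF permutes_inv[OF s], of 1]
        show ?thesis
          by (simp only: star_mult[OF group_algebra_mult[OF c g] r] star_mult[OF c g] star_row_sum
              star_column_sum star_single permutes_inv_inv[OF s]) (simp only: galg_mult_assoc)
      qed
      ultimately show ?thesis by simp
    qed
    have "single s 1 \<star> young_symmetrizer q \<star> single (inv_into UNIV s) 1 \<star>
        (single t 1 \<star> young_symmetrizer p \<star> single (inv_into UNIV t) 1) = (0 :: 'f galg)"
      if s: "s permutes {..<n}" and t: "t permutes {..<n}" for s t
    proof -
      have "single s 1 \<star> young_symmetrizer q \<star> single (inv_into UNIV s) 1 \<star>
        (single t 1 \<star> young_symmetrizer p \<star> single (inv_into UNIV t) 1) =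
        single s 1 \<star> signed_column_sum q \<star> (row_sum q \<star> (single (inv_into UNIV s) 1 \<star> single t 1) \<star> signed_column_sum p)
         \<star> row_sum p \<star> (single (inv_into UNIV t) 1 :: 'f galg)"
        by (simp only: young_symmetrizer_def galg_mult_assoc)
      also have "row_sum q \<star> (single (inv_into UNIV s) 1 \<star> single t 1) \<star> signed_column_sum p = (0 :: 'f galg)"
        using v[OF permutes_compose[OF t permutes_inv[OF s]]] by simp
      finally show ?thesis by simp
    qed
    then show ?thesis
      unfolding central_young_def conj_sum_def p q
      by (simp add: galg_mult_sum_left galg_mult_sum_right)
  qed
  have "(\<forall>s. s permutes {..<n} \<longrightarrow> \<not> no_pair q p s) \<or> (\<forall>s. s permutes {..<n} \<longrightarrow> \<not> no_pair p q s)"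
  proof (rule ccontr)
    assume "\<not> ?thesis"
    then obtain s t where s: "s permutes {..<n}" "no_pair q p s" and t: "t permutes {..<n}" "no_pair p q t" by auto
    have "p = q"
      using no_pair_dominance[OF p(1) q(2) p(2) s] no_pair_dominance[OF q(1) p(2) q(2) t]
      by (intro partition_eqI p q) (auto simp: p q intro: antisym)
    then show False using ne by simp
  qed
  then show ?thesis
  proof
    assume "\<forall>s. s permutes {..<n} \<longrightarrow> \<not> no_pair q p s"
    then have "central_young q \<star> central_young p = (0 :: 'f galg)" using main[OF p(2) q(2)] by blast
    moreover have "central_young p \<in> group_algebra n"
      unfolding central_young_def p(2) by (rule conj_sum_closed[OF young_symmetrizer_closed[of p, unfolded p(2)]])
    from conj_sum_central[OF this, of "young_symmetrizer q"]
    have "central_young p \<star> central_young q = central_young q \<star> (central_young p :: 'f galg)"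
      unfolding central_young_def[of q] q(2) .
    ultimately show ?thesis by simp
  next
    assume "\<forall>s. s permutes {..<n} \<longrightarrow> \<not> no_pair p q s"
    then show ?thesis using main[OF q(2) p(2)] by blast
  qed
qed

section \<open>Cycle types and conjugacy\<close>

lemma orbit_eq_or_disjoint:
  assumes "permutation s" "y \<in> orbit s x" shows "orbit s y = orbit s x"
proof
  show "orbit s y \<subseteq> orbit s x" using assms(2) by (auto intro: orbit_trans)
  have "x \<in> orbit s y" using assms permutation_self_in_orbit orbit_swap by metis
  then show "orbit s x \<subseteq> orbit s y" by (auto intro: orbit_trans)
qed

lemma orbit_funpow:
  assumes s: "permutation s"
  shows "bij_betw (\<lambda>j. (s ^^ j) x) {..<card (orbit s x)} (orbit s x)" "(s ^^ card (orbit s x)) x = x"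
    "0 < card (orbit s x)"
proof -
  have x: "x \<in> orbit s x" by (rule permutation_self_in_orbit[OF s])
  have i: "inj_on (\<lambda>j. (s ^^ j) x) {0..<funpow_dist1 s x x}" by (rule inj_on_funpow_dist1[OF x])
  have o: "orbit s x = (\<lambda>n. (s ^^ n) x) ` {0..<funpow_dist1 s x x}" by (rule orbit_conv_funpow_dist1[OF x])
  have c: "card (orbit s x) = funpow_dist1 s x x" unfolding o using card_image[OF i] by simp
  show "bij_betw (\<lambda>j. (s ^^ j) x) {..<card (orbit s x)} (orbit s x)"
    unfolding bij_betw_def c using i o by (simp add: atLeast0LessThan)
  show "(s ^^ card (orbit s x)) x = x" unfolding c by (rule funpow_dist1_prop[OF x])
  show "0 < card (orbit s x)" unfolding c by simp
qed

text \<open>A permutation acts as the cyclic shift of the rows of a Young diagram, under a suitable labelling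
  of its boxes; the row lengths are the cycle type.\<close>

definition has_type :: "nat \<Rightarrow> (nat \<Rightarrow> nat) \<Rightarrow> nat list \<Rightarrow> (nat \<times> nat \<Rightarrow> nat) \<Rightarrow> bool" where
  "has_type n s p b \<longleftrightarrow> bij_betw b {(i, j). i < length p \<and> j < p ! i} {..<n} \<and>
     (\<forall>i j. i < length p \<and> j < p ! i \<longrightarrow> s (b (i, j)) = b (i, Suc j mod p ! i))"

text \<open>The cycles, sorted by decreasing length, become the rows; box \<open>(i, j)\<close>
  carries the \<open>j\<close>-th iterate of a point chosen on cycle \<open>i\<close>.\<close>

lemma has_type_ex:
  assumes s: "s permutes {..<n}"
  obtains p b where "is_partition p" "sum_list p = n" "has_type n s p b"
proof -
  have ps: "permutation s" using permutes_permutation[OF s] .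
  have "finite (orbit s ` {..<n})" by simp
  then obtain xs where xs: "set xs = orbit s ` {..<n}" "distinct xs" using finite_distinct_list by metis
  define L where "L = rev (sort_key card xs)"
  have L: "set L = orbit s ` {..<n}" "distinct L" using xs by (simp_all add: L_def)
  define p where "p = map card L"
  define r where "r i = (SOME x. x < n \<and> orbit s x = L ! i)" for i
  have r: "r i < n" "orbit s (r i) = L ! i" if "i < length p" for i
  proof -
    have "L ! i \<in> orbit s ` {..<n}" using that L(1) nth_mem[of i L] by (simp add: p_def)
    then have "\<exists>x. x < n \<and> orbit s x = L ! i" by auto
    from someI_ex[OF this] show "r i < n" "orbit s (r i) = L ! i" by (auto simp: r_def)
  qed
  have pc: "p ! i = card (orbit s (r i))" if "i < length p" for i
    using r(2)[OF that] that by (simp add: p_def)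
  define b where "b = (\<lambda>(i, j). (s ^^ j) (r i))"
  let ?D = "{(i, j). i < length p \<and> j < p ! i}"
  have bij: "bij_betw b ?D {..<n}"
  proof (rule bij_betw_imageI)
    show "inj_on b ?D"
    proof (rule inj_onI, clarify)
      fix i j i' j' assume h: "i < length p" "j < p ! i" "i' < length p" "j' < p ! i'" "b (i, j) = b (i', j')"
      have "b (i, j) \<in> orbit s (r i)" "b (i', j') \<in> orbit s (r i')"
        using funpow_in_orbit[OF permutation_self_in_orbit[OF ps]] by (auto simp: b_def)
      then have "orbit s (r i) = orbit s (r i')" using h(5) orbit_eq_or_disjoint[OF ps] by metis
      then have "L ! i = L ! i'" using r h by simp
      then have ii: "i = i'" using h L(2) by (simp add: p_def nth_eq_iff_index_eq)
      then have "j = j'" using h bij_betw_imp_inj_on[OF orbit_funpow(1)[OF ps, of "r i"]] pc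
        by (auto simp: b_def dest: inj_onD)
      with ii show "i = i' \<and> j = j'" by simp
    qed
    show "b ` ?D = {..<n}"
    proof (intro equalityI subsetI)
      fix y assume "y \<in> b ` ?D"
      then obtain i j where "i < length p" "y = (s ^^ j) (r i)" by (auto simp: b_def)
      moreover have "(s ^^ j) x < n" if "x < n" for j x
        using that permutes_in_image[OF s] by (induction j) auto
      ultimately show "y \<in> {..<n}" using r by auto
    next
      fix y assume "y \<in> {..<n}"
      then have "orbit s y \<in> set L" by (simp add: L(1))
      then obtain i where i: "i < length p" "L ! i = orbit s y" by (auto simp: in_set_conv_nth p_def)
      then have "y \<in> orbit s (r i)" using r(2)[OF i(1)] permutation_self_in_orbit[OF ps] by simp
      then obtain j where "j < p ! i" "y = (s ^^ j) (r i)"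
        using bij_betw_imp_surj_on[OF orbit_funpow(1)[OF ps, of "r i"]] pc[OF i(1)] by auto
      then show "y \<in> b ` ?D" using i by (intro image_eqI[of _ _ "(i, j)"]) (auto simp: b_def)
    qed
  qed
  have "has_type n s p b" unfolding has_type_def
  proof (intro conjI bij allI impI)
    fix i j assume ij: "i < length p \<and> j < p ! i"
    show "s (b (i, j)) = b (i, Suc j mod p ! i)"
    proof (cases "Suc j = p ! i")
      case True
      have "s (b (i, j)) = (s ^^ Suc j) (r i)" by (simp add: b_def)
      also have "\<dots> = r i" using True orbit_funpow(2)[OF ps, of "r i"] pc[of i] ij by simp
      finally show ?thesis using True by (simp add: b_def)
    next
      case False
      then show ?thesis using ij by (simp add: b_def)
    qed
  qed
  moreover have "is_partition p"
  proof -
    have "sorted (map card (sort_key card xs))" by simp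
    then have "sorted_wrt (\<ge>) p" by (simp add: p_def L_def rev_map[symmetric] sorted_wrt_rev)
    moreover have "0 \<notin> set p"
      using orbit_funpow(3)[OF ps] L(1) by (auto simp: p_def) (metis less_irrefl)
    ultimately show ?thesis by (simp add: is_partition_def)
  qed
  moreover have "sum_list p = n"
  proof -
    have "?D = (\<lambda>m. boxes p ! m) ` {..<sum_list p}"
      unfolding set_boxes[symmetric] length_boxes[symmetric] by (auto simp: set_conv_nth)
    then have "card ?D = sum_list p"
      using distinct_card[OF distinct_boxes[of p]] unfolding set_boxes length_boxes by simp
    then show ?thesis using bij_betw_same_card[OF bij] by simp
  qed
  ultimately show ?thesis using that by blast
qed

text \<open>Both permutations are the same shift of boxes, so the change from one labelling to the
  other conjugates the first into the second.\<close>

lemma has_type_conjugate: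
  assumes s: "s permutes {..<n}" "has_type n s p b" and t: "t permutes {..<n}" "has_type n t p c"
  obtains u where "u permutes {..<n}" "t = u \<circ> s \<circ> inv_into UNIV u"
proof -
  let ?D = "{(i, j). i < length p \<and> j < p ! i}"
  have b: "bij_betw b ?D {..<n}" and c: "bij_betw c ?D {..<n}" using s t by (auto simp: has_type_def)
  define u where "u x = (if x < n then c (inv_into ?D b x) else x)" for x
  have "bij_betw (c \<circ> inv_into ?D b) {..<n} {..<n}"
    by (rule bij_betw_trans[OF bij_betw_inv_into[OF b] c])
  then have "bij_betw u {..<n} {..<n}" by (rule bij_betw_cong[THEN iffD1, rotated]) (simp add: u_def)
  then have u: "u permutes {..<n}" by (rule bij_imp_permutes) (simp add: u_def)
  have ub: "u (b d) = c d" if "d \<in> ?D" for d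
    using bij_betw_inv_into_left[OF b that] bij_betwE[OF b] that by (auto simp: u_def)
  have "t \<circ> u = u \<circ> s"
  proof
    fix x show "(t \<circ> u) x = (u \<circ> s) x"
    proof (cases "x < n")
      case True
      then have "x \<in> b ` ?D" using bij_betw_imp_surj_on[OF b] by simp
      then obtain i j where d: "(i, j) \<in> ?D" "x = b (i, j)" by blast
      then have d': "(i, Suc j mod p ! i) \<in> ?D" by auto
      have "s x = b (i, Suc j mod p ! i)" using s(2) d by (simp add: has_type_def)
      moreover have "t (c (i, j)) = c (i, Suc j mod p ! i)" using t(2) d by (simp add: has_type_def)
      ultimately show ?thesis using ub[OF d(1)] ub[OF d'] d(2) by simp
    next
      case False
      then show ?thesis using s(1) t(1) by (simp add: u_def permutes_def)
    qed
  qed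
  then have "t = u \<circ> s \<circ> inv_into UNIV u"
    by (metis o_assoc o_id permutes_inv_o(1)[OF u])
  with u show ?thesis using that by blast
qed

definition partitions_of :: "nat \<Rightarrow> nat list set" where
  "partitions_of n = {p. is_partition p \<and> sum_list p = n}"

lemma finite_partitions_of: "finite (partitions_of n)"
proof -
  have "p \<in> {xs. set xs \<subseteq> {..n} \<and> length xs \<le> n}" if "p \<in> partitions_of n" for p
  proof -
    have p: "0 \<notin> set p" "sum_list p = n" using that by (auto simp: partitions_of_def is_partition_def)
    have "length p \<le> sum_list p" using p(1) by (induction p) auto
    moreover have "x \<le> n" if "x \<in> set p" for x using member_le_sum_list[OF that] p by simp
    ultimately show ?thesis using p by auto
  qed
  then have "partitions_of n \<subseteq> {xs. set xs \<subseteq> {..n} \<and> length xs \<le> n}" by blast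
  then show ?thesis using finite_lists_length_le[of "{..n}" n] by (rule finite_subset) simp
qed

lemma vector_space_pscale: "vector_space (pscale :: 'f::field \<Rightarrow> ('a \<Rightarrow>\<^sub>0 'f) \<Rightarrow> _)"
  by unfold_locales (simp_all add: pscale_add pscale_add_left)

text \<open>The central Young elements are independent, and the centre is spanned by class sums, of which there
  are at most as many as partitions.\<close>

theorem young_completeness:
  obtains a where "single id 1 = (\<Sum>p\<in>partitions_of n. pscale (a p) (central_young p :: 'f::field_char_0 galg))"
proof -
  interpret vs: vector_space "pscale :: 'f \<Rightarrow> 'f galg \<Rightarrow> 'f galg" by (rule vector_space_pscale)
  let ?P = "partitions_of n" and ?S = "{s. s permutes {..<n}}"
  let ?z = "central_young :: nat list \<Rightarrow> 'f galg"
  have fin: "finite ?P" "finite ?S" by (simp_all add: finite_partitions_of finite_permutations)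
  have orth: "?z p \<star> ?z q = 0" if "p \<in> ?P" "q \<in> ?P" "p \<noteq> q" for p q
    using that by (auto simp: partitions_of_def intro: central_young_orthogonal)
  have inj: "inj_on ?z ?P"
    using orth central_young_square_nonzero by (metis inj_onI)
  have "vs.independent (?z ` ?P)"
  proof (subst vs.dependent_finite)
    show "\<not> (\<exists>u. (\<exists>v\<in>?z ` ?P. u v \<noteq> 0) \<and> (\<Sum>v\<in>?z ` ?P. pscale (u v) v) = 0)"
    proof clarify
      fix u q assume z: "(\<Sum>v\<in>?z ` ?P. pscale (u v) v) = 0" and q: "q \<in> ?P" "u (?z q) \<noteq> 0"
      \<comment> \<open>Multiplication by one of the elements isolates its coefficient, by
        orthogonality.\<close>
      have "0 = ?z q \<star> (\<Sum>p\<in>?P. pscale (u (?z p)) (?z p))"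
        using z by (simp add: sum.reindex[OF inj])
      also have "\<dots> = (\<Sum>p\<in>?P. if p = q then pscale (u (?z q)) (?z q \<star> ?z q) else 0)"
        unfolding galg_mult_sum_right by (rule sum.cong) (auto simp: galg_mult_pscale_right orth q)
      also have "\<dots> = pscale (u (?z q)) (?z q \<star> ?z q)" using fin q by simp
      finally show False using q central_young_square_nonzero[of q, where ?'f = 'f] by (metis pscale_eq_0_iff)
    qed
  qed (simp add: fin)
  have "\<exists>p b. p \<in> ?P \<and> has_type n s p b" if "s \<in> ?S" for s
    using that has_type_ex[of s n] by (simp add: partitions_of_def) metis
  then obtain ty b where ty: "\<And>s. s \<in> ?S \<Longrightarrow> ty s \<in> ?P" "\<And>s. s \<in> ?S \<Longrightarrow> has_type n s (ty s) (b s)" by metis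
  \<comment> \<open>The class sum of type \<open>p\<close>, or 0 if the chosen \<open>ty\<close>
    never takes this value. In either case there are at most as many of these elements as
    partitions.\<close>
  define k where "k p = (\<Sum>s | s \<in> ?S \<and> ty s = p. single s (1::'f))" for p
  let ?K = "k ` ?P"
  have central_span: "x \<in> vs.span ?K"
    if x: "x \<in> group_algebra n" and c: "\<And>y. y \<in> group_algebra n \<Longrightarrow> y \<star> x = x \<star> y" for x
  proof -
    \<comment> \<open>Commuting with the conjugating permutation makes the coefficients of a central
      element constant on conjugacy classes.\<close>
    have cf: "lookup x s = lookup x t" if st: "s \<in> ?S" "t \<in> ?S" "ty s = ty t" for s t
    proof -
      obtain u where u: "u permutes {..<n}" "t = u \<circ> s \<circ> inv_into UNIV u"
        using has_type_conjugate[of s n "ty s" "b s" t "b t"] st ty(2)[of s] ty(2)[of t] by auto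
      have eq: "single u 1 \<star> x \<star> single (inv_into UNIV u) 1 = x"
        using c[OF group_algebra_single[OF u(1), of 1]] by (simp add: galg_mult_assoc permutes_inv_o[OF u(1)])
      have "lookup (single u 1 \<star> y \<star> single (inv_into UNIV u) 1) t = lookup y s" if "y \<in> group_algebra n" for y :: "'f galg"
        using that
      proof (induction y rule: group_algebra_induct)
        case (single v a)
        have "u \<circ> v \<circ> inv_into UNIV u = t \<longleftrightarrow> v = s"
        proof
          assume h: "u \<circ> v \<circ> inv_into UNIV u = t"
          then have "inv_into UNIV u \<circ> (u \<circ> v \<circ> inv_into UNIV u) \<circ> u = inv_into UNIV u \<circ> (u \<circ> s \<circ> inv_into UNIV u) \<circ> u"
            using u(2) by simp
          then have "(inv_into UNIV u \<circ> u) \<circ> v \<circ> (inv_into UNIV u \<circ> u) = (inv_into UNIV u \<circ> u) \<circ> s \<circ> (inv_into UNIV u \<circ> u)"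
            by (simp only: o_assoc)
          then show "v = s" by (simp add: permutes_inv_o(2)[OF u(1)])
        qed (simp add: u(2))
        then show ?case unfolding galg_mult_single by (simp only: lookup_single when_def) simp
      qed (simp_all add: galg_mult_add_left galg_mult_add_right lookup_add)
      from this[OF x] show ?thesis unfolding eq by simp
    qed
    define r where "r p = (if \<exists>s. s \<in> ?S \<and> ty s = p then lookup x (SOME s. s \<in> ?S \<and> ty s = p) else 0)" for p
    have r: "lookup x s = r (ty s)" if "s \<in> ?S" for s
    proof -
      have ex: "\<exists>s'. s' \<in> ?S \<and> ty s' = ty s" using that by auto
      from someI_ex[OF this] show ?thesis using cf[OF that] ex unfolding r_def by (metis (no_types, lifting))
    qed
    have "x = (\<Sum>s\<in>?S. single s (lookup x s))"
    proof (subst (1) poly_mapping_sum_singles[of x, symmetric], rule sum.mono_neutral_left)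
      show "keys x \<subseteq> ?S" using x by (rule group_algebraD)
    qed (use fin in \<open>auto simp: in_keys_iff\<close>)
    also have "\<dots> = (\<Sum>p\<in>?P. \<Sum>s | s \<in> ?S \<and> ty s = p. single s (lookup x s))"
      by (rule sum.group[symmetric]) (use fin ty in auto)
    also have "\<dots> = (\<Sum>p\<in>?P. pscale (r p) (k p))"
      unfolding k_def pscale_sum by (intro sum.cong refl) (auto simp: r)
    also have "\<dots> \<in> vs.span ?K"
      by (intro vs.span_sum vs.span_scale vs.span_base) auto
    finally show ?thesis .
  qed
  have sub: "?z ` ?P \<subseteq> vs.span ?K"
  proof clarify
    fix p assume "p \<in> ?P"
    then have p: "sum_list p = n" by (simp add: partitions_of_def)
    show "?z p \<in> vs.span ?K"
    proof (rule central_span)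
      show "?z p \<in> group_algebra n"
        unfolding central_young_def p by (rule conj_sum_closed[OF young_symmetrizer_closed[of p, unfolded p]])
    qed (simp add: central_young_def p conj_sum_central)
  qed
  have one: "single id 1 \<in> vs.span ?K"
    by (rule central_span) (auto intro: group_algebra_single permutes_id)
  have "single id 1 \<in> vs.span (?z ` ?P)"
  proof (rule ccontr)
    \<comment> \<open>Adjoining the unit would give more independent vectors than the class sums
      that span them.\<close>
    assume ns: "single id 1 \<notin> vs.span (?z ` ?P)"
    then have ind: "vs.independent (insert (single id 1) (?z ` ?P))"
      using \<open>vs.independent (?z ` ?P)\<close> by (rule vs.independent_insertI)
    have "card (insert (single id 1) (?z ` ?P)) \<le> card ?K"
      using vs.independent_span_bound[OF _ ind, of ?K] sub one fin by auto
    moreover have "single id 1 \<notin> ?z ` ?P" using ns vs.span_base by blast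
    ultimately have "Suc (card ?P) \<le> card ?K" using fin by (simp add: card_image[OF inj])
    then show False using card_image_le[OF fin(1), of k] by simp
  qed
  then obtain u where "single id 1 = (\<Sum>v\<in>?z ` ?P. pscale (u v) v)"
    using vs.span_finite[of "?z ` ?P"] fin by auto
  then have "single id 1 = (\<Sum>p\<in>?P. pscale (u (?z p)) (?z p))" by (simp add: sum.reindex[OF inj])
  then show ?thesis by (rule that[of "\<lambda>p. u (?z p)"])
qed

lemma poly_mapping_add_induct [case_names zero single add]:
  fixes t :: "'a \<Rightarrow>\<^sub>0 'f::comm_monoid_add"
  assumes "P 0" and "\<And>w a. P (single w a)" and "\<And>s t. P s \<Longrightarrow> P t \<Longrightarrow> P (s + t)"
  shows "P t"
  by (rule poly_mapping_induct_on[of t UNIV]) (use assms in auto)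

lemma Abs_poly_mapping_eqI: assumes "\<And>v. f v = lookup X v" shows "Abs_poly_mapping f = X"
proof -
  have "f = lookup X" using assms by auto
  then show ?thesis by (simp add: lookup_inverse)
qed

section \<open>Place permutations\<close>

definition tensors :: "nat \<Rightarrow> (nat list \<Rightarrow>\<^sub>0 'f::zero) set" where
  "tensors n = {t. keys t \<subseteq> {w. length w = n}}"

lemma tensors_zero [simp]: "0 \<in> tensors n"
  by (simp add: tensors_def)

lemma tensors_single: "length w = n \<Longrightarrow> single w a \<in> tensors n"
  by (simp add: tensors_def)

lemma tensors_add: "s \<in> tensors n \<Longrightarrow> t \<in> tensors n \<Longrightarrow> s + t \<in> tensors n"
  using keys_add[of s t] by (auto simp: tensors_def)

lemma tensors_pscale: "t \<in> tensors n \<Longrightarrow> pscale a t \<in> tensors n"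
  using keys_pscale[of a t] by (auto simp: tensors_def)

lemma tensors_induct [consumes 1, case_names zero single add]:
  fixes t :: "nat list \<Rightarrow>\<^sub>0 'f::field"
  assumes "t \<in> tensors n" and "P 0"
    and "\<And>w x. length w = n \<Longrightarrow> P (single w x)"
    and "\<And>a b. a \<in> tensors n \<Longrightarrow> b \<in> tensors n \<Longrightarrow> P a \<Longrightarrow> P b \<Longrightarrow> P (a + b)"
  shows "P t"
proof -
  have "keys t \<subseteq> {w. length w = n}" using assms(1) by (simp add: tensors_def)
  then show ?thesis by (induction t rule: poly_mapping_induct_on) (auto intro: assms simp: tensors_def)
qed

lemma tensors_lext:
  "t \<in> tensors n \<Longrightarrow> (\<And>w. length w = n \<Longrightarrow> \<phi> w \<in> tensors m) \<Longrightarrow> lext \<phi> t \<in> tensors m"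
  by (induction t rule: tensors_induct) (auto simp: lext_add intro: tensors_add tensors_pscale)

lemma place_right_lext:
  "place_right t a = lext (\<lambda>w. lext (\<lambda>s. single (permute_list s w) 1) a) t"
  unfolding place_right_def lext_def by (simp add: pscale_sum)

lemma place_right_single [simp]:
  "place_right (single w a) (single s b) = single (permute_list s w) (a * b)"
  by (simp add: place_right_lext)

lemma place_right_zero [simp]: "place_right 0 a = 0" "place_right t 0 = 0"
  by (simp_all add: place_right_lext)

lemma place_right_add_left: "place_right (s + t) a = place_right s a + place_right t a"
  by (simp add: place_right_lext lext_add)

lemma place_right_add_right: "place_right t (a + b) = place_right t a + place_right t b"
  by (simp add: place_right_lext lext_add lext_add_fun)

lemma place_right_pscale_left: "place_right (pscale x t) a = pscale x (place_right t a)"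
  by (simp add: place_right_lext lext_pscale)

lemma place_right_pscale_right: "place_right t (pscale x a) = pscale x (place_right t a)"
  by (simp add: place_right_lext lext_pscale lext_pscale_fun)

lemma place_right_id [simp]: "place_right t (single id 1) = t"
  by (simp add: place_right_lext)

lemma place_right_closed:
  assumes "t \<in> tensors n" shows "place_right t a \<in> tensors n"
  unfolding place_right_lext using assms
proof (rule tensors_lext)
  fix w :: "nat list" assume w: "length w = n"
  have "keys (lext (\<lambda>s. single (permute_list s w) (1::'a)) a) \<subseteq> {v. length v = n}"
    using keys_lext[of "\<lambda>s. single (permute_list s w) 1" a] w by fastforce
  then show "lext (\<lambda>s. single (permute_list s w) 1) a \<in> tensors n" by (simp add: tensors_def)
qed

text \<open>The left factor of a composition permutes the word first under
  \<open>permute_list\<close>, so place permutations act from the right.\<close>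

lemma place_right_mult:
  assumes t: "t \<in> tensors n" and a: "a \<in> group_algebra n" and b: "b \<in> group_algebra n"
  shows "place_right (place_right t a) b = place_right t (a \<star> b)"
  using t
proof (induction t rule: tensors_induct)
  case (single w x)
  note w = this
  from a show ?case
  proof (induction a rule: group_algebra_induct)
    case (single s y)
    from b show ?case
    proof (induction b rule: group_algebra_induct)
      case (single u z)
      then show ?case using w by (simp add: permute_list_compose mult.assoc)
    qed (simp_all add: place_right_add_right galg_mult_add_right)
  qed (simp_all add: place_right_add_right place_right_add_left galg_mult_add_left)
qed (simp_all add: place_right_add_left)

section \<open>Extension of scalars from the base field to rational functions\<close>

lemma Const_zero [simp]: "Const 0 = 0" and Const_one [simp]: "Const 1 = 1"
  and Const_add: "Const (a + b) = Const a + Const b"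
  and Const_mult: "Const (a * b) = Const a * Const b"
  by (simp_all add: Const_def single_add mult_single)

lemma Const_inject [simp]: "Const a = Const b \<longleftrightarrow> a = b"
  by (metis Const_def lookup_single_eq)

lemma of_k_zero [simp]: "of_k 0 = 0" and of_k_one [simp]: "of_k 1 = 1"
  and of_k_add: "of_k (a + b) = of_k a + of_k b"
  and of_k_mult: "of_k (a * b) = of_k a * of_k b"
  by (simp_all add: of_k_def Const_add Const_mult Zero_fract_def One_fract_def)

lemma of_k_inject [simp]: "of_k a = of_k b \<longleftrightarrow> a = b"
  by (simp add: of_k_def eq_fract)

lemma of_k_eq_0_iff [simp]: "of_k a = 0 \<longleftrightarrow> a = 0"
  using of_k_inject[of a 0] by simp

lemma of_k_uminus: "of_k (- a) = - of_k a"
  using of_k_add[of a "- a"] by (simp add: eq_neg_iff_add_eq_0 add.commute)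

lemma of_k_prod: "of_k (prod f I) = (\<Prod>i\<in>I. of_k (f i))"
  by (induction I rule: infinite_finite_induct) (simp_all add: of_k_mult)

abbreviation kmap :: "('a \<Rightarrow>\<^sub>0 'k::field) \<Rightarrow> ('a \<Rightarrow>\<^sub>0 'k ratfun)" where
  "kmap \<equiv> Poly_Mapping.map of_k"

lemma lookup_kmap [simp]: "lookup (kmap t) w = of_k (lookup t w)"
  by (simp add: lookup_map_hom)

lemma keys_kmap [simp]: "keys (kmap t) = keys t"
  by (auto simp: in_keys_iff)

lemma kmap_add: "kmap (s + t) = kmap s + kmap t"
  by (rule map_hom_add) (simp_all add: of_k_add)

lemma kmap_single [simp]: "kmap (single w a) = single w (of_k a)"
  by simp

lemma kmap_pscale: "kmap (pscale a t) = pscale (of_k a) (kmap t)"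
  by (rule poly_mapping_eqI) (simp add: of_k_mult)

lemma kmap_lext: "kmap (lext \<phi> t) = lext (\<lambda>w. kmap (\<phi> w)) (kmap t)"
  by (rule map_hom_lext) (simp_all add: of_k_add of_k_mult)

lemma kmap_galg_mult: "kmap (a \<star> b) = kmap a \<star> kmap b"
  unfolding galg_mult_lext by (simp add: kmap_lext)

lemma kmap_place_right: "kmap (place_right t a) = place_right (kmap t) (kmap a)"
  unfolding place_right_lext by (simp add: kmap_lext)

lemma kmap_group_algebra: "a \<in> group_algebra n \<Longrightarrow> kmap a \<in> group_algebra n"
  by (simp add: group_algebra_def)

text \<open>The mixed action: group algebra elements keep coefficients in \<open>k\<close>, while
  tensors have theirs in the field of rational functions.\<close>

definition ract :: "'k::field Ktensor \<Rightarrow> 'k galg \<Rightarrow> 'k Ktensor" where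
  "ract t a = place_right t (kmap a)"

lemma ract_zero [simp]: "ract 0 a = 0" "ract t 0 = 0"
  and ract_add_left: "ract (s + t) a = ract s a + ract t a"
  and ract_add_right: "ract t (a + b) = ract t a + ract t b"
  and ract_pscale_left: "ract (pscale x t) a = pscale x (ract t a)"
  and ract_pscale_right: "ract t (pscale y a) = pscale (of_k y) (ract t a)"
  and ract_id [simp]: "ract t (single id 1) = t"
  and ract_single: "ract (single w z) (single u c) = single (permute_list u w) (z * of_k c)"
  by (simp_all add: ract_def place_right_add_left place_right_add_right place_right_pscale_left
      place_right_pscale_right kmap_add kmap_pscale)

lemma ract_closed: "t \<in> tensors n \<Longrightarrow> ract t a \<in> tensors n"
  by (simp add: ract_def place_right_closed)

lemma ract_sum_left: "ract (sum F I) a = (\<Sum>i\<in>I. ract (F i) a)"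
  by (induction I rule: infinite_finite_induct) (simp_all add: ract_add_left)

lemma ract_sum_right: "ract t (sum F I) = (\<Sum>i\<in>I. ract t (F i))"
  by (induction I rule: infinite_finite_induct) (simp_all add: ract_add_right)

lemma ract_mult:
  "t \<in> tensors n \<Longrightarrow> a \<in> group_algebra n \<Longrightarrow> b \<in> group_algebra n \<Longrightarrow> ract (ract t a) b = ract t (a \<star> b)"
  unfolding ract_def kmap_galg_mult by (rule place_right_mult) (auto intro: kmap_group_algebra)

lemma place_act_ract: "place_act s t = ract t (single (inv_into UNIV s) 1)"
  by (simp add: place_act_def ract_def)

text \<open>By completeness the unit is a combination of sums of the elements
  \<open>s c\<^sub>q s\<^sup>-\<^sup>1\<close>, so a tensor killed by all \<open>s c\<^sub>q\<close>
  is 0. This reduces the vanishing of a contraction to that of maps into the modules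
  \<open>K_schur \<sigma> q\<close>.\<close>

lemma tensor_detected_by_young_symmetrizers:
  fixes y :: "'k::field_char_0 Ktensor"
  assumes y: "y \<in> tensors n"
    and z: "\<And>q s. is_partition q \<Longrightarrow> sum_list q = n \<Longrightarrow> s permutes {..<n} \<Longrightarrow>
      ract (ract y (single s 1)) (young_symmetrizer q) = 0"
  shows "y = 0"
proof -
  obtain a where a: "single id 1 = (\<Sum>p\<in>partitions_of n. pscale (a p) (central_young p :: 'k galg))"
    by (rule young_completeness)
  have "ract y (central_young q) = 0" if q: "is_partition q" "sum_list q = n" for q
  proof -
    have "ract y (single s 1 \<star> young_symmetrizer q \<star> single (inv_into UNIV s) 1) = 0" if s: "s permutes {..<n}" for s
    proof -
      note g = group_algebra_single[OF s, of "1::'k"] group_algebra_single[OF permutes_inv[OF s], of "1::'k"]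
        young_symmetrizer_closed[of q, unfolded q(2)]
      have "ract y (single s 1 \<star> young_symmetrizer q \<star> single (inv_into UNIV s) 1) =
          ract (ract (ract y (single s 1)) (young_symmetrizer q)) (single (inv_into UNIV s) 1)"
        using ract_mult[OF y g(1,3)] ract_mult[OF y group_algebra_mult[OF g(1,3)] g(2)] by simp
      also have "\<dots> = 0" by (simp add: z[OF q s])
      finally show ?thesis .
    qed
    then show ?thesis unfolding central_young_def conj_sum_def q(2) ract_sum_right by (intro sum.neutral) auto
  qed
  then have "ract y (\<Sum>p\<in>partitions_of n. pscale (a p) (central_young p)) = 0"
    unfolding ract_sum_right by (intro sum.neutral) (simp add: ract_pscale_right partitions_of_def)
  then show ?thesis using a by (metis ract_id)
qed

section \<open>Evaluation of polynomials\<close>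

definition mono_eval :: "(nat \<times> nat list \<Rightarrow> 'r::comm_semiring_1) \<Rightarrow> ((nat \<times> nat list) \<Rightarrow>\<^sub>0 nat) \<Rightarrow> 'r" where
  "mono_eval \<nu> m = (\<Prod>x\<in>keys m. \<nu> x ^ lookup m x)"

lemma mono_eval_superset:
  "finite I \<Longrightarrow> keys m \<subseteq> I \<Longrightarrow> mono_eval \<nu> m = (\<Prod>x\<in>I. \<nu> x ^ lookup m x)"
  unfolding mono_eval_def by (rule prod.mono_neutral_left) (auto simp: in_keys_iff)

lemma mono_eval_zero [simp]: "mono_eval \<nu> 0 = 1"
  by (simp add: mono_eval_def)

lemma mono_eval_single [simp]: "mono_eval \<nu> (single x k) = \<nu> x ^ k"
  by (simp add: mono_eval_def)

lemma mono_eval_add: "mono_eval \<nu> (m + m') = mono_eval \<nu> m * mono_eval \<nu> m'"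
proof -
  let ?I = "keys m \<union> keys m'"
  have "keys (m + m') \<subseteq> ?I" by (rule keys_add)
  then have "mono_eval \<nu> (m + m') = (\<Prod>x\<in>?I. \<nu> x ^ lookup m x * \<nu> x ^ lookup m' x)"
    by (simp add: mono_eval_superset[of ?I] lookup_add power_add)
  also have "\<dots> = mono_eval \<nu> m * mono_eval \<nu> m'"
    by (simp add: prod.distrib mono_eval_superset[of ?I])
  finally show ?thesis .
qed

definition poly_eval :: "(nat \<times> nat list \<Rightarrow> 'k mpoly) \<Rightarrow> 'k::field mpoly \<Rightarrow> 'k mpoly" where
  "poly_eval \<nu> p = (\<Sum>m\<in>keys p. Const (lookup p m) * mono_eval \<nu> m)"

lemma poly_eval_add: "poly_eval \<nu> (p + q) = poly_eval \<nu> p + poly_eval \<nu> q"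
  unfolding poly_eval_def
  by (rule setsum_keys_plus_distrib[where f = "\<lambda>m a. Const a * mono_eval \<nu> m"])
     (simp_all add: Const_add algebra_simps)

lemma poly_eval_zero [simp]: "poly_eval \<nu> 0 = 0"
  by (simp add: poly_eval_def)

lemma poly_eval_single: "poly_eval \<nu> (single m a) = Const a * mono_eval \<nu> m"
  by (simp add: poly_eval_def)

lemma poly_eval_mult: "poly_eval \<nu> (p * q) = poly_eval \<nu> p * poly_eval \<nu> q"
proof (induction p rule: poly_mapping_add_induct)
  case (single m a)
  show ?case
    by (induction q rule: poly_mapping_add_induct)
       (simp_all add: mult_single poly_eval_single mono_eval_add Const_mult distrib_left poly_eval_add)
qed (simp_all add: distrib_right poly_eval_add)

lemma poly_eval_Const [simp]: "poly_eval \<nu> (Const c) = Const c"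
  by (simp add: Const_def poly_eval_single)

lemma poly_eval_one [simp]: "poly_eval \<nu> 1 = 1"
  using poly_eval_Const[of \<nu> 1] by simp

lemma poly_eval_Var [simp]: "poly_eval \<nu> (Var i w) = \<nu> (i, w)"
  by (simp add: Var_def poly_eval_single)

lemma poly_eval_power: "poly_eval \<nu> (p ^ k) = poly_eval \<nu> p ^ k"
  by (induction k) (simp_all add: poly_eval_mult)

lemma poly_eval_sum: "poly_eval \<nu> (sum f I) = (\<Sum>i\<in>I. poly_eval \<nu> (f i))"
  by (induction I rule: infinite_finite_induct) (simp_all add: poly_eval_add)

lemma mpoly_induct [case_names Const Var add mult]:
  fixes p :: "'k::field mpoly"
  assumes C: "\<And>c. P (Const c)" and V: "\<And>i w. P (Var i w)"
    and A: "\<And>p q. P p \<Longrightarrow> P q \<Longrightarrow> P (p + q)" and M: "\<And>p q. P p \<Longrightarrow> P q \<Longrightarrow> P (p * q)"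
  shows "P p"
proof -
  have one: "P 1" using C[of 1] by simp
  have mono: "P (single m 1)" for m :: "(nat \<times> nat list) \<Rightarrow>\<^sub>0 nat"
  proof (induction m rule: poly_mapping_add_induct)
    case (single x k)
    show ?case
    proof (induction k)
      case (Suc k)
      have "single (single x (Suc k)) 1 = Var (fst x) (snd x) * (single (single x k) 1 :: 'k mpoly)"
        by (simp add: Var_def mult_single single_add[symmetric])
      then show ?case using Suc V M by simp
    qed (simp add: one)
  next
    case (add s t)
    have "single (s + t) 1 = single s 1 * (single t 1 :: 'k mpoly)" by (simp add: mult_single)
    then show ?case using add M by simp
  qed (simp_all add: one)
  show ?thesis
  proof (induction p rule: poly_mapping_add_induct)
    case (single m a)
    have "single m a = Const a * single m 1" by (simp add: Const_def mult_single)
    then show ?case using M C mono by simp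
  next
    case zero show ?case using C[of 0] by simp
  qed (auto intro: A)
qed

lemma poly_eval_poly_eval:
  "poly_eval \<mu> (poly_eval \<nu> p) = poly_eval (\<lambda>x. poly_eval \<mu> (\<nu> x)) p"
  by (induction p rule: mpoly_induct) (simp_all add: poly_eval_add poly_eval_mult)

lemma poly_eval_Var_id: "(\<And>i w. \<nu> (i, w) = Var i w) \<Longrightarrow> poly_eval \<nu> p = p"
  by (induction p rule: mpoly_induct) (simp_all add: poly_eval_add poly_eval_mult)

lemma linear_form_add: "linear_form i (s + t) = linear_form i s + linear_form i t"
  unfolding linear_form_def
  by (rule setsum_keys_plus_distrib[where f = "\<lambda>w a. Const a * Var i w"]) (simp_all add: Const_add algebra_simps)

lemma linear_form_zero [simp]: "linear_form i 0 = 0"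
  by (simp add: linear_form_def)

lemma linear_form_single [simp]: "linear_form i (single w a) = Const a * Var i w"
  by (simp add: linear_form_def)

lemma linear_form_sum: "linear_form i (sum f I) = (\<Sum>j\<in>I. linear_form i (f j))"
  by (induction I rule: infinite_finite_induct) (simp_all add: linear_form_add)

lemma linear_form_pscale: "linear_form i (pscale a t) = Const a * linear_form i t"
  by (induction t rule: poly_mapping_add_induct)
     (simp_all add: pscale_add linear_form_add Const_mult distrib_left mult.assoc)

section \<open>The action of matrices with finite columns\<close>

text \<open>Finite columns make the image of each word finitely supported and are inherited by
  products. Injectivity on polynomials is kept apart as \<open>regular\<close>.\<close>

definition col_finite :: "'k::field mat \<Rightarrow> bool" where
  "col_finite g \<longleftrightarrow> (\<forall>a. finite {i. g i a \<noteq> 0})"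

definition col :: "'k::field mat \<Rightarrow> nat \<Rightarrow> (nat \<Rightarrow>\<^sub>0 'k)" where
  "col g a = Abs_poly_mapping (\<lambda>i. g i a)"

lemma lookup_col: "col_finite g \<Longrightarrow> lookup (col g a) i = g i a"
  by (simp add: col_def col_finite_def)

lemma GL_col_finite: assumes "g \<in> GL" shows "col_finite g"
proof -
  from assms obtain n where b: "block n g" by (auto simp: GL_def GL_n_def)
  have "{i. g i a \<noteq> 0} \<subseteq> {..<n} \<union> {a}" for a
    using b by (auto simp: block_def mat_one_def) (metis leI)
  then show ?thesis unfolding col_finite_def by (meson finite.emptyI finite.insertI finite_UnI finite_lessThan finite_subset)
qed

lemma gl_word_Nil: "gl_word g [] = single [] 1"
  unfolding gl_word_def by (rule Abs_poly_mapping_eqI) (auto simp: lookup_single when_def)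

lemma lookup_cons_ext:
  "lookup (lext (\<lambda>x. lext (\<lambda>v. single (x # v) 1) B) A) u =
    (case u of [] \<Rightarrow> 0 | y # v \<Rightarrow> lookup A y * lookup B v)"
proof (induction A rule: poly_mapping_add_induct)
  case (single x a)
  show ?case
    by (induction B rule: poly_mapping_add_induct)
       (auto simp: lookup_add lookup_single when_def algebra_simps lext_add split: list.splits)
qed (auto simp: lext_add lookup_add algebra_simps split: list.splits)

text \<open>\<open>gl_word\<close> is defined by its coefficients; this recursion on the letters
  opens the way to inductions over the word.\<close>

lemma gl_word_foldr:
  assumes "col_finite g"
  shows "gl_word g w = foldr (\<lambda>a B. lext (\<lambda>x. lext (\<lambda>v. single (x # v) 1) B) (col g a)) w (single [] 1)"
proof -
  have "lookup (foldr (\<lambda>a B. lext (\<lambda>x. lext (\<lambda>v. single (x # v) 1) B) (col g a)) w (single [] 1)) v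
     = (if length v = length w then \<Prod>l<length w. g (v ! l) (w ! l) else 0)" for v
  proof (induction w arbitrary: v)
    case Nil
    show ?case by (auto simp: lookup_single when_def)
  next
    case (Cons a w)
    show ?case
      by (cases v) (simp_all add: lookup_cons_ext Cons.IH lookup_col[OF assms] prod.lessThan_Suc_shift del: prod.lessThan_Suc)
  qed
  then show ?thesis unfolding gl_word_def by (intro Abs_poly_mapping_eqI) simp
qed

lemma gl_word_Cons:
  "col_finite g \<Longrightarrow> gl_word g (a # w) = lext (\<lambda>x. lext (\<lambda>v. single (x # v) 1) (gl_word g w)) (col g a)"
  by (simp add: gl_word_foldr)

lemma lookup_gl_word_col_finite:
  assumes "col_finite g"
  shows "lookup (gl_word g w) v = (if length v = length w then \<Prod>l<length w. g (v ! l) (w ! l) else 0)"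
proof (induction w arbitrary: v)
  case Nil
  show ?case by (auto simp: lookup_single when_def gl_word_Nil)
next
  case (Cons a w)
  show ?case
    by (cases v) (simp_all add: gl_word_Cons[OF assms] lookup_cons_ext Cons.IH lookup_col[OF assms] prod.lessThan_Suc_shift del: prod.lessThan_Suc)
qed

lemma gl_word_tensors: "col_finite g \<Longrightarrow> gl_word g w \<in> tensors (length w)"
  by (auto simp: tensors_def in_keys_iff lookup_gl_word_col_finite split: if_splits)

lemma col_mat_mult:
  assumes g: "col_finite g" and h: "col_finite h"
  shows "col_finite (mat_mult g h)" "col (mat_mult g h) a = lext (col g) (col h a)"
proof -
  have l: "mat_mult g h i b = lookup (lext (col g) (col h b)) i" for i b
  proof -
    have "mat_mult g h i b = (\<Sum>l\<in>keys (col h b). g i l * h l b)"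
      unfolding mat_mult_def by (rule Sum_any.expand_superset) (auto simp: in_keys_iff lookup_col[OF h])
    then show ?thesis by (simp add: lookup_lext lookup_col[OF h] lookup_col[OF g] mult.commute)
  qed
  show f: "col_finite (mat_mult g h)"
    unfolding col_finite_def l by (simp add: finite_lookup)
  show "col (mat_mult g h) a = lext (col g) (col h a)"
    by (rule poly_mapping_eqI) (simp add: lookup_col[OF f] l)
qed

lemma gl_word_mat_mult:
  assumes g: "col_finite g" and h: "col_finite h"
  shows "gl_word (mat_mult g h) w = lext (gl_word g) (gl_word h w)"
proof (induction w)
  case Nil
  show ?case by (simp add: gl_word_Nil)
next
  case (Cons a w)
  have "lext (gl_word g) (gl_word h (a # w)) =
      lext (\<lambda>x. lext (\<lambda>v. lext (\<lambda>y. lext (\<lambda>u. single (y # u) 1) (gl_word g v)) (col g x)) (gl_word h w)) (col h a)"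
    by (simp add: gl_word_Cons[OF h] lext_lext gl_word_Cons[OF g])
  also have "\<dots> = lext (\<lambda>x. lext (\<lambda>y. lext (\<lambda>v. lext (\<lambda>u. single (y # u) 1) (gl_word g v)) (gl_word h w)) (col g x)) (col h a)"
    by (subst lext_swap) rule
  also have "\<dots> = lext (\<lambda>y. lext (\<lambda>u. single (y # u) 1) (lext (gl_word g) (gl_word h w))) (lext (col g) (col h a))"
    by (simp add: lext_lext)
  also have "\<dots> = gl_word (mat_mult g h) (a # w)"
    by (simp add: gl_word_Cons col_mat_mult g h Cons)
  finally show ?case ..
qed

lemma col_finite_mat_one: "col_finite mat_one"
  by (simp add: col_finite_def mat_one_def)

lemma col_mat_one: "col mat_one a = single a 1"
  by (rule poly_mapping_eqI) (simp add: lookup_col[OF col_finite_mat_one] lookup_single when_def mat_one_def)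

lemma gl_word_mat_one: "gl_word mat_one w = single w 1"
  by (induction w) (simp_all add: gl_word_Nil gl_word_Cons[OF col_finite_mat_one] col_mat_one)

lemma permute_list_inverse:
  assumes s: "s permutes {..<n}" and w: "length w = n"
  shows "permute_list s (permute_list (inv_into UNIV s) w) = w" "permute_list (inv_into UNIV s) (permute_list s w) = w"
  using permute_list_compose[of s w "inv_into UNIV s"] permute_list_compose[of "inv_into UNIV s" w s] s w
    permutes_inv_o[OF s] permutes_inv[OF s]
  by simp_all

text \<open>The diagonal action commutes with place permutations, because the product of matrix
  entries over all positions can be reindexed by \<open>s\<close>.\<close>

lemma gl_word_permute_list:
  assumes g: "col_finite g" and s: "s permutes {..<length w}"
  shows "gl_word g (permute_list s w) = lext (\<lambda>v. single (permute_list s v) 1) (gl_word g w)"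
proof (rule poly_mapping_eqI)
  fix u :: "nat list"
  let ?n = "length w" and ?v = "permute_list (inv_into UNIV s) u"
  have "lookup (lext (\<lambda>v. single (permute_list s v) 1) (gl_word g w)) u =
      (\<Sum>v\<in>keys (gl_word g w). if v = ?v \<and> length u = ?n then lookup (gl_word g w) v else 0)"
    unfolding lookup_lext
  proof (rule sum.cong)
    fix v assume "v \<in> keys (gl_word g w)"
    then have v: "length v = ?n" using gl_word_tensors[OF g, of w] by (auto simp: tensors_def)
    have "permute_list s v = u \<longleftrightarrow> v = ?v \<and> length u = ?n"
      using permute_list_inverse[OF s, of v] permute_list_inverse[OF s, of u] v by auto
    then show "lookup (gl_word g w) v * lookup (single (permute_list s v) 1) u =
        (if v = ?v \<and> length u = ?n then lookup (gl_word g w) v else 0)"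
      by (simp add: lookup_single when_def)
  qed simp
  also have "\<dots> = (if length u = ?n then lookup (gl_word g w) ?v else 0)"
    by (auto simp: sum.delta in_keys_iff)
  also have "\<dots> = lookup (gl_word g (permute_list s w)) u"
  proof (cases "length u = ?n")
    case True
    have "(\<Prod>l<?n. g (?v ! l) (w ! l)) = (\<Prod>l<?n. g (?v ! (s l)) (w ! (s l)))"
      using permutes_imp_bij[OF s] by (rule prod.reindex_bij_betw[symmetric])
    also have "\<dots> = (\<Prod>l<?n. g (u ! l) (permute_list s w ! l))"
    proof (rule prod.cong)
      fix l assume l: "l \<in> {..<?n}"
      then have "s l < ?n" using permutes_in_image[OF s] by auto
      then have "?v ! (s l) = u ! l"
        using True permutes_inv[OF s] by (simp add: permute_list_nth permutes_inverses(2)[OF s])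
      then show "g (?v ! s l) (w ! s l) = g (u ! l) (permute_list s w ! l)"
        using l s by (simp add: permute_list_nth)
    qed simp
    finally show ?thesis using True by (simp add: lookup_gl_word_col_finite[OF g])
  next
    case False
    then show ?thesis by (simp add: lookup_gl_word_col_finite[OF g])
  qed
  finally show "lookup (gl_word g (permute_list s w)) u = lookup (lext (\<lambda>v. single (permute_list s v) 1) (gl_word g w)) u" ..
qed

text \<open>The tensor power is the product of the factors inside and outside \<open>S\<close>, and
  \<open>g\<close> acts on each. In the induction the leading letter joins one of the two parts and
  \<open>S\<close> is shifted down by one.\<close>

lemma gl_word_split:
  assumes g: "col_finite g"
  shows "lext (\<lambda>v. single (nths v S, nths v (- S)) 1) (gl_word g w) =
    lext (\<lambda>a. lext (\<lambda>b. single (a, b) 1) (gl_word g (nths w (- S)))) (gl_word g (nths w S))"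
proof (induction w arbitrary: S)
  case Nil
  show ?case by (simp add: gl_word_Nil)
next
  case (Cons x w)
  let ?T = "{j. Suc j \<in> S}"
  have c: "{j. Suc j \<notin> S} = - ?T" by auto
  have "lext (\<lambda>v. single (nths v S, nths v (- S)) 1) (gl_word g (x # w)) =
      lext (\<lambda>y. lext (\<lambda>v. single (nths (y # v) S, nths (y # v) (- S)) 1) (gl_word g w)) (col g x)"
    by (simp add: gl_word_Cons[OF g] lext_lext)
  also have "\<dots> = lext (\<lambda>y. lext (\<lambda>(a, b). single (if 0 \<in> S then (y # a, b) else (a, y # b)) 1)
      (lext (\<lambda>v. single (nths v ?T, nths v (- ?T)) 1) (gl_word g w))) (col g x)"
    by (cases "0 \<in> S") (simp_all add: lext_lext nths_Cons c)
  also have "\<dots> = lext (\<lambda>y. lext (\<lambda>a. lext (\<lambda>b. single (if 0 \<in> S then (y # a, b) else (a, y # b)) 1)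
      (gl_word g (nths w (- ?T)))) (gl_word g (nths w ?T))) (col g x)"
    by (simp add: Cons lext_lext)
  also have "\<dots> = lext (\<lambda>a. lext (\<lambda>b. single (a, b) 1) (gl_word g (nths (x # w) (- S)))) (gl_word g (nths (x # w) S))"
  proof (cases "0 \<in> S")
    case True
    then show ?thesis by (simp add: nths_Cons c gl_word_Cons[OF g] lext_lext)
  next
    case False
    then show ?thesis
      by (simp add: nths_Cons c gl_word_Cons[OF g] lext_lext)
         (subst lext_swap, simp)
  qed
  finally show ?case .
qed

section \<open>The action on the field of rational functions\<close>

lemma poly_act_eval: "poly_act g = poly_eval (\<lambda>(i, w). linear_form i (gl_word g w))"
  unfolding poly_act_def poly_eval_def mono_eval_def by (simp add: fun_eq_iff case_prod_unfold)

lemma poly_act_add: "poly_act g (p + q) = poly_act g p + poly_act g q"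
  and poly_act_mult: "poly_act g (p * q) = poly_act g p * poly_act g q"
  and poly_act_zero [simp]: "poly_act g 0 = 0"
  and poly_act_one [simp]: "poly_act g 1 = 1"
  and poly_act_Const [simp]: "poly_act g (Const c) = Const c"
  and poly_act_Var: "poly_act g (Var i w) = linear_form i (gl_word g w)"
  by (simp_all add: poly_act_eval poly_eval_add poly_eval_mult)

lemma poly_act_linear_form: "poly_act g (linear_form i t) = linear_form i (lext (gl_word g) t)"
  by (induction t rule: poly_mapping_add_induct)
     (simp_all add: linear_form_add poly_act_add lext_add poly_act_mult poly_act_Var linear_form_pscale)

lemma poly_act_mat_mult:
  assumes "col_finite g" "col_finite h"
  shows "poly_act (mat_mult g h) p = poly_act g (poly_act h p)"
  by (induction p rule: mpoly_induct)
     (simp_all add: poly_act_add poly_act_mult poly_act_Var poly_act_linear_form gl_word_mat_mult assms)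

lemma poly_act_mat_one [simp]: "poly_act mat_one p = p"
  by (induction p rule: mpoly_induct)
     (simp_all add: poly_act_add poly_act_mult poly_act_Var gl_word_mat_one)

text \<open>Injectivity on polynomials keeps denominators nonzero, so that the action on fractions
  makes sense and can be computed on any representative.\<close>

definition regular :: "'k::field mat \<Rightarrow> bool" where
  "regular g \<longleftrightarrow> col_finite g \<and> (\<forall>p. poly_act g p = 0 \<longrightarrow> p = 0)"

lemma regular_col_finite: "regular g \<Longrightarrow> col_finite g"
  by (simp add: regular_def)

lemma GL_regular: assumes "g \<in> GL" shows "regular g"
proof -
  from assms obtain n h where h: "block n h" "mat_mult h g = mat_one" "mat_mult g h = mat_one" and n: "n \<ge> 1" "block n g"
    by (auto simp: GL_def GL_n_def)
  then have "h \<in> GL" unfolding GL_def GL_n_def by auto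
  then have c: "col_finite h" "col_finite g" using assms GL_col_finite by auto
  have "p = 0" if "poly_act g p = 0" for p
    using poly_act_mat_mult[OF c, of p] that by (simp add: h)
  then show ?thesis using c by (simp add: regular_def)
qed

lemma regular_mat_mult: "regular g \<Longrightarrow> regular h \<Longrightarrow> regular (mat_mult g h)"
  unfolding regular_def using poly_act_mat_mult[of g h] col_mat_mult(1)[of g h] by metis

lemma K_act_Fract:
  assumes g: "regular g" and b: "b \<noteq> 0"
  shows "K_act g (Fract a b) = Fract (poly_act g a) (poly_act g b)"
proof -
  have nz: "poly_act g q \<noteq> 0" if "q \<noteq> 0" for q using g that by (auto simp: regular_def)
  have "y = Fract (poly_act g a) (poly_act g b)"
    if d: "d \<noteq> 0" and e: "Fract a b = Fract c d" and y: "y = Fract (poly_act g c) (poly_act g d)" for c d y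
  proof -
    have "a * d = c * b" using e b d by (simp add: eq_fract)
    then have "poly_act g a * poly_act g d = poly_act g c * poly_act g b"
      by (metis poly_act_mult)
    then show ?thesis using nz[OF b] nz[OF d] y by (simp add: eq_fract)
  qed
  then show ?thesis unfolding K_act_def using b by (intro the_equality) blast+
qed

abbreviation emb :: "'k::field mpoly \<Rightarrow> 'k ratfun" where "emb p \<equiv> Fract p 1"

lemma emb_zero [simp]: "emb 0 = 0" and emb_one [simp]: "emb 1 = 1"
  and emb_Const: "emb (Const c) = of_k c"
  by (simp_all add: Zero_fract_def One_fract_def of_k_def)

lemma emb_add: "emb (p + q) = emb p + emb q" and emb_mult: "emb (p * q) = emb p * emb q"
  by simp_all

lemma emb_inject [simp]: "emb p = emb q \<longleftrightarrow> p = q"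
  by (simp add: eq_fract)

lemma emb_eq_0_iff [simp]: "emb p = 0 \<longleftrightarrow> p = 0"
  using emb_inject[of p 0] unfolding emb_zero .

lemma emb_sum: "emb (sum f I) = (\<Sum>i\<in>I. emb (f i))"
  by (induction I rule: infinite_finite_induct) (simp_all add: emb_add del: add_fract)

lemma K_act_emb: "regular g \<Longrightarrow> K_act g (emb p) = emb (poly_act g p)"
  by (simp add: K_act_Fract)

lemma K_act_zero [simp]: "regular g \<Longrightarrow> K_act g 0 = 0"
  and K_act_one [simp]: "regular g \<Longrightarrow> K_act g 1 = 1"
  and K_act_of_k [simp]: "regular g \<Longrightarrow> K_act g (of_k c) = of_k c"
  using K_act_emb[of g 0] K_act_emb[of g 1] K_act_emb[of g "Const c"]
  by (simp_all only: poly_act_zero poly_act_one poly_act_Const emb_zero emb_one emb_Const)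

lemma K_act_add: assumes g: "regular g" shows "K_act g (x + y) = K_act g x + K_act g y"
proof -
  obtain a b c d where x: "x = Fract a b" "b \<noteq> 0" and y: "y = Fract c d" "d \<noteq> 0"
    by (metis Fract_cases)
  have "poly_act g b \<noteq> 0" "poly_act g d \<noteq> 0" using g x y by (auto simp: regular_def)
  then show ?thesis using x y by (simp add: K_act_Fract[OF g] poly_act_add poly_act_mult)
qed

lemma K_act_mult: assumes g: "regular g" shows "K_act g (x * y) = K_act g x * K_act g y"
proof -
  obtain a b c d where x: "x = Fract a b" "b \<noteq> 0" and y: "y = Fract c d" "d \<noteq> 0"
    by (metis Fract_cases)
  then show ?thesis by (simp add: K_act_Fract[OF g] poly_act_mult)
qed

lemma K_act_eq_0_iff [simp]: assumes g: "regular g" shows "K_act g x = 0 \<longleftrightarrow> x = 0"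
proof
  obtain a b where x: "x = Fract a b" "b \<noteq> 0" by (metis Fract_cases)
  have nz: "poly_act g b \<noteq> 0" using x(2) g unfolding regular_def by blast
  assume "K_act g x = 0"
  then have "Fract (poly_act g a) (poly_act g b) = Fract 0 1"
    by (simp only: x(1) K_act_Fract[OF g x(2)] Zero_fract_def)
  then have "poly_act g a = 0" by (subst (asm) eq_fract(1)) (use nz in auto)
  then have "a = 0" using g unfolding regular_def by blast
  then show "x = 0" using x by (simp add: fract_collapse)
qed (simp add: g)

lemma K_act_mat_mult:
  assumes g: "regular g" and h: "regular h" shows "K_act (mat_mult g h) x = K_act g (K_act h x)"
proof -
  obtain a b where x: "x = Fract a b" "b \<noteq> 0" by (metis Fract_cases)
  moreover have "poly_act h b \<noteq> 0" using x h by (auto simp: regular_def)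
  ultimately show ?thesis
    using regular_mat_mult[OF g h] g h by (simp add: K_act_Fract poly_act_mat_mult regular_col_finite)
qed

lemma regular_mat_one: "regular mat_one"
  by (simp add: regular_def col_finite_mat_one)

lemma K_act_mat_one [simp]: "K_act mat_one x = x"
  by (cases x) (simp add: K_act_Fract[OF regular_mat_one])

section \<open>Stability under GL of Schur functors, the symmetric algebra and its fraction
  field\<close>

lemma lext_gl_word_place_right:
  assumes t: "t \<in> tensors n" and a: "a \<in> group_algebra n" and g: "col_finite g"
  shows "lext (gl_word g) (place_right t a) = place_right (lext (gl_word g) t) a"
  using t
proof (induction t rule: tensors_induct)
  case (single w x)
  note w = this
  from a show ?case
  proof (induction a rule: group_algebra_induct)
    case (single s y)
    then show ?case using w
      by (simp add: gl_word_permute_list[OF g] place_right_pscale_left)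
         (simp add: place_right_lext lext_pscale_fun[of y "\<lambda>v. single (permute_list s v) 1", simplified] mult.commute)
  qed (simp_all add: place_right_add_right lext_add)
qed (simp_all add: place_right_add_left lext_add)

lemma gl_word_closed: "col_finite g \<Longrightarrow> length w = n \<Longrightarrow> gl_word g w \<in> tensors n"
  using gl_word_tensors by blast

lemma schur_iff: "x \<in> schur p \<longleftrightarrow> (\<exists>t\<in>tensors (sum_list p). x = place_right t (young_symmetrizer p))"
  by (auto simp: schur_def tensors_def subset_iff)

lemma schur_gl:
  assumes x: "x \<in> schur p" and g: "col_finite g" shows "lext (gl_word g) x \<in> schur p"
proof -
  from x obtain t where t: "t \<in> tensors (sum_list p)" "x = place_right t (young_symmetrizer p)"
    by (auto simp: schur_iff)
  have "lext (gl_word g) t \<in> tensors (sum_list p)"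
    using t(1) by (rule tensors_lext) (rule gl_word_closed[OF g])
  then show ?thesis using t by (auto simp: schur_iff lext_gl_word_place_right[OF t(1) young_symmetrizer_closed g])
qed

lemma Sym_gl: assumes g: "col_finite g" shows "a \<in> Sym \<sigma> \<Longrightarrow> poly_act g a \<in> Sym \<sigma>"
  by (induction a rule: Sym.induct)
     (auto simp: poly_act_linear_form poly_act_add poly_act_mult intro: Sym.intros schur_gl[OF _ g])

lemma Sym_one [simp]: "1 \<in> Sym \<sigma>" and Sym_zero [simp]: "0 \<in> Sym \<sigma>"
  using Sym.const[of 1 \<sigma>] Sym.const[of 0 \<sigma>] by simp_all

lemma K_fieldI: "a \<in> Sym \<sigma> \<Longrightarrow> b \<in> Sym \<sigma> \<Longrightarrow> b \<noteq> 0 \<Longrightarrow> Fract a b \<in> K_field \<sigma>"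
  by (auto simp: K_field_def)

lemma K_field_emb: "a \<in> Sym \<sigma> \<Longrightarrow> emb a \<in> K_field \<sigma>"
  by (rule K_fieldI) auto

lemma K_field_of_k [simp]: "of_k c \<in> K_field \<sigma>"
  unfolding of_k_def by (rule K_field_emb[OF Sym.const])

lemma K_field_zero [simp]: "0 \<in> K_field \<sigma>" and K_field_one [simp]: "1 \<in> K_field \<sigma>"
  using K_field_of_k[of 0 \<sigma>] K_field_of_k[of 1 \<sigma>] by simp_all

lemma K_field_add: "x \<in> K_field \<sigma> \<Longrightarrow> y \<in> K_field \<sigma> \<Longrightarrow> x + y \<in> K_field \<sigma>"
  by (auto simp: K_field_def) (metis Sym.add Sym.mult mult_eq_0_iff)

lemma K_field_mult: "x \<in> K_field \<sigma> \<Longrightarrow> y \<in> K_field \<sigma> \<Longrightarrow> x * y \<in> K_field \<sigma>"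
  by (auto simp: K_field_def) (metis Sym.mult mult_eq_0_iff)

lemma K_field_uminus: "x \<in> K_field \<sigma> \<Longrightarrow> - x \<in> K_field \<sigma>"
  using K_field_mult[OF K_field_of_k[of "-1"]] by (simp add: of_k_uminus)

lemma K_field_inverse: assumes "x \<in> K_field \<sigma>" shows "inverse x \<in> K_field \<sigma>"
proof -
  from assms obtain a b where x: "x = Fract a b" "a \<in> Sym \<sigma>" "b \<in> Sym \<sigma>" "b \<noteq> 0" by (auto simp: K_field_def)
  show ?thesis
  proof (cases "a = 0")
    case True
    then show ?thesis using x by (simp add: eq_fract Zero_fract_def[symmetric] fract_collapse)
  qed (use x K_fieldI in auto)
qed

lemma K_field_sum: "(\<And>i. i \<in> I \<Longrightarrow> f i \<in> K_field \<sigma>) \<Longrightarrow> sum f I \<in> K_field \<sigma>"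
  by (induction I rule: infinite_finite_induct) (auto intro: K_field_add)

lemma K_field_act:
  assumes g: "regular g" and x: "x \<in> K_field \<sigma>" shows "K_act g x \<in> K_field \<sigma>"
proof -
  from x obtain a b where "x = Fract a b" "a \<in> Sym \<sigma>" "b \<in> Sym \<sigma>" "b \<noteq> 0" by (auto simp: K_field_def)
  then show ?thesis using g K_act_Fract[OF g, of b a]
    by (auto intro!: K_fieldI Sym_gl simp: regular_def)
qed

section \<open>Tensors with coefficients in K\<close>

lemma T_power_iff: "t \<in> T_power \<sigma> n \<longleftrightarrow> t \<in> tensors n \<and> (\<forall>w. lookup t w \<in> K_field \<sigma>)"
  unfolding T_power_def tensors_def
  by (auto simp: subset_iff) (metis K_field_zero not_in_keys_iff_lookup_eq_zero)

lemma T_power_tensors: "t \<in> T_power \<sigma> n \<Longrightarrow> t \<in> tensors n"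
  by (simp add: T_power_iff)

lemma T_power_zero [simp]: "0 \<in> T_power \<sigma> n"
  and T_power_add: "s \<in> T_power \<sigma> n \<Longrightarrow> t \<in> T_power \<sigma> n \<Longrightarrow> s + t \<in> T_power \<sigma> n"
  and T_power_pscale: "a \<in> K_field \<sigma> \<Longrightarrow> t \<in> T_power \<sigma> n \<Longrightarrow> pscale a t \<in> T_power \<sigma> n"
  and T_power_kmap: "u \<in> tensors n \<Longrightarrow> kmap u \<in> T_power \<sigma> n"
  and T_power_single: "length w = n \<Longrightarrow> a \<in> K_field \<sigma> \<Longrightarrow> single w a \<in> T_power \<sigma> n"
  by (auto simp: T_power_iff lookup_add lookup_single when_def
      intro: tensors_add tensors_pscale tensors_single K_field_add K_field_mult)
     (auto simp: tensors_def)

lemma T_power_sum: "(\<And>i. i \<in> I \<Longrightarrow> F i \<in> T_power \<sigma> n) \<Longrightarrow> sum F I \<in> T_power \<sigma> n"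
  by (induction I rule: infinite_finite_induct) (auto intro: T_power_add)

lemma T_power_lext:
  "t \<in> T_power \<sigma> n \<Longrightarrow> (\<And>w. length w = n \<Longrightarrow> \<phi> w \<in> T_power \<sigma> m) \<Longrightarrow> lext \<phi> t \<in> T_power \<sigma> m"
  unfolding lext_def
  by (rule T_power_sum, rule T_power_pscale) (auto simp: T_power_iff tensors_def)

lemma T_power_induct [consumes 1, case_names zero single add]:
  assumes t: "t \<in> T_power \<sigma> n" and "P 0"
    and "\<And>w x. length w = n \<Longrightarrow> x \<in> K_field \<sigma> \<Longrightarrow> P (single w x)"
    and A: "\<And>a b. a \<in> T_power \<sigma> n \<Longrightarrow> b \<in> T_power \<sigma> n \<Longrightarrow> P a \<Longrightarrow> P b \<Longrightarrow> P (a + b)"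
  shows "P t"
proof -
  have "finite I \<Longrightarrow> I \<subseteq> keys t \<Longrightarrow> P (\<Sum>w\<in>I. single w (lookup t w))" for I
  proof (induction I rule: finite_induct)
    case (insert w I)
    have k: "length v = n" "lookup t v \<in> K_field \<sigma>" if "v \<in> keys t" for v
      using that t by (auto simp: T_power_iff tensors_def)
    have "P (single w (lookup t w) + (\<Sum>w\<in>I. single w (lookup t w)))"
      using insert k by (intro A assms(3) T_power_single T_power_sum) auto
    then show ?case using insert by simp
  qed (use assms in simp)
  from this[of "keys t"] show ?thesis by (simp add: poly_mapping_sum_singles)
qed

lemma ract_T_power: "t \<in> T_power \<sigma> n \<Longrightarrow> a \<in> group_algebra n \<Longrightarrow> ract t a \<in> T_power \<sigma> n"
proof (induction t rule: T_power_induct)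
  case (single w x)
  note w = single(1,2)
  from single(3) show ?case
  proof (induction a rule: group_algebra_induct)
    case (single s c)
    show ?case using w unfolding ract_single by (intro T_power_single K_field_mult) auto
  qed (auto simp: ract_add_right intro: T_power_add)
qed (auto simp: ract_add_left intro: T_power_add)

text \<open>The action is only semilinear; it is separated here into the action on coefficients and
  the linear extension of the action on words.\<close>

lemma Ktensor_act_lext:
  assumes g: "regular g"
  shows "Ktensor_act g t = lext (\<lambda>w. kmap (gl_word g w)) (Poly_Mapping.map (K_act g) t)"
proof -
  have k: "keys (Poly_Mapping.map (K_act g) t) = keys t"
    using g by (auto simp: in_keys_iff lookup_map_hom)
  have "pscale a (kmap u) = (\<Sum>v\<in>keys u. single v (a * of_k (lookup u v)))" for a and u :: "nat list \<Rightarrow>\<^sub>0 'a"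
  proof -
    have "kmap u = (\<Sum>v\<in>keys u. single v (of_k (lookup u v)))"
      using poly_mapping_sum_singles[of "kmap u"] by simp
    then show ?thesis by (simp add: pscale_sum)
  qed
  then show ?thesis unfolding Ktensor_act_def lext_def k using g by (simp add: lookup_map_hom)
qed

lemma Ktensor_act_zero [simp]: "Ktensor_act g 0 = 0"
  by (simp add: Ktensor_act_def)

lemma Ktensor_act_add:
  assumes g: "regular g" shows "Ktensor_act g (s + t) = Ktensor_act g s + Ktensor_act g t"
  unfolding Ktensor_act_lext[OF g] by (subst map_hom_add) (simp_all add: g K_act_add lext_add)

lemma Ktensor_act_pscale:
  assumes g: "regular g" shows "Ktensor_act g (pscale a t) = pscale (K_act g a) (Ktensor_act g t)"
proof -
  have "Poly_Mapping.map (K_act g) (pscale a t) = pscale (K_act g a) (Poly_Mapping.map (K_act g) t)"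
    by (rule poly_mapping_eqI) (simp add: lookup_map_hom g K_act_mult)
  then show ?thesis by (simp add: Ktensor_act_lext[OF g] lext_pscale)
qed

lemma Ktensor_act_single:
  assumes g: "regular g" shows "Ktensor_act g (single w a) = pscale (K_act g a) (kmap (gl_word g w))"
  unfolding Ktensor_act_lext[OF g] by (simp add: g)

lemma Ktensor_act_sum: "regular g \<Longrightarrow> Ktensor_act g (sum F I) = (\<Sum>i\<in>I. Ktensor_act g (F i))"
  by (induction I rule: infinite_finite_induct) (simp_all add: Ktensor_act_add)

lemma Ktensor_act_kmap:
  assumes g: "regular g" shows "Ktensor_act g (kmap u) = kmap (lext (gl_word g) u)"
  by (induction u rule: poly_mapping_add_induct)
     (simp_all add: kmap_add Ktensor_act_add g lext_add Ktensor_act_single kmap_pscale)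

lemma Ktensor_act_ract:
  assumes t: "t \<in> tensors n" and a: "a \<in> group_algebra n" and g: "regular g"
  shows "Ktensor_act g (ract t a) = ract (Ktensor_act g t) a"
  using t
proof (induction t rule: tensors_induct)
  case (single w x)
  have w: "single w 1 \<in> tensors n" using single by (rule tensors_single)
  have "single w x = pscale x (kmap (single w 1))" by simp
  then show ?case
    using lext_gl_word_place_right[OF w a regular_col_finite[OF g]]
    by (simp only: ract_pscale_left Ktensor_act_pscale[OF g] ract_def kmap_place_right[symmetric]
        Ktensor_act_kmap[OF g] place_right_pscale_left)
qed (simp_all add: ract_add_left Ktensor_act_add g)

lemma Ktensor_act_mat_mult:
  assumes g: "regular g" and h: "regular h"
  shows "Ktensor_act (mat_mult g h) t = Ktensor_act g (Ktensor_act h t)"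
  by (induction t rule: poly_mapping_add_induct)
     (simp_all add: Ktensor_act_add g h regular_mat_mult Ktensor_act_single Ktensor_act_pscale Ktensor_act_kmap
        K_act_mat_mult gl_word_mat_mult regular_col_finite)

lemma Ktensor_act_mat_one: "Ktensor_act mat_one t = t"
  by (induction t rule: poly_mapping_add_induct)
     (simp_all add: Ktensor_act_add regular_mat_one Ktensor_act_single gl_word_mat_one)

lemma Ktensor_act_T_power:
  assumes "t \<in> T_power \<sigma> n" and g: "regular g" shows "Ktensor_act g t \<in> T_power \<sigma> n"
  using assms(1)
  by (induction t rule: T_power_induct)
     (auto simp: Ktensor_act_add g Ktensor_act_single intro!: T_power_add T_power_pscale T_power_kmap K_field_act
        gl_word_closed regular_col_finite)

section \<open>The contractions\<close>

text \<open>The value of \<open>phi_x i x\<close> on a basis word, kept as a polynomial before it is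
  embedded in the field.\<close>

definition contraction :: "nat \<Rightarrow> 'k::field galg \<Rightarrow> nat list \<Rightarrow> 'k mpoly" where
  "contraction i x w = linear_form i (place_right (single w 1) x)"

lemma phi_kmap: "phi i (kmap t) = emb (linear_form i t)"
  by (simp add: phi_def linear_form_def emb_sum emb_mult emb_Const del: mult_fract)

lemma phi_x_contraction: "phi_x i x (single w 1) = emb (contraction i x w)"
proof -
  have "place_right (single w 1) (kmap x) = kmap (place_right (single w 1) x)" by (simp add: kmap_place_right)
  then show ?thesis by (simp add: phi_x_def contraction_def phi_kmap)
qed

lemma phi_xS_lext:
  "phi_xS i x S t = lext (\<lambda>w. single (nths w (- S)) (emb (contraction i x (nths w S)))) t"
  unfolding phi_xS_def lext_def phi_x_contraction by simp

lemma phi_xS_zero [simp]: "phi_xS i x S 0 = 0"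
  and phi_xS_add: "phi_xS i x S (s + t) = phi_xS i x S s + phi_xS i x S t"
  and phi_xS_pscale: "phi_xS i x S (pscale a t) = pscale a (phi_xS i x S t)"
  and phi_xS_single: "phi_xS i x S (single w a) = single (nths w (- S)) (a * emb (contraction i x (nths w S)))"
  by (simp_all add: phi_xS_lext lext_add lext_pscale)

lemma contraction_gl:
  assumes x: "x \<in> group_algebra (length w)" and g: "col_finite g"
  shows "poly_act g (contraction i x w) = (\<Sum>v\<in>keys (gl_word g w). Const (lookup (gl_word g w) v) * contraction i x v)"
proof -
  have w: "single w 1 \<in> tensors (length w)" by (simp add: tensors_single)
  have "poly_act g (contraction i x w) = linear_form i (place_right (gl_word g w) x)"
    by (simp add: contraction_def poly_act_linear_form lext_gl_word_place_right[OF w x g])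
  also have "place_right (gl_word g w) x =
      (\<Sum>v\<in>keys (gl_word g w). pscale (lookup (gl_word g w) v) (place_right (single v 1) x))"
    by (simp add: place_right_lext lext_def[of _ "gl_word g w"])
  finally show ?thesis by (simp add: linear_form_sum linear_form_pscale contraction_def)
qed

lemma contraction_permute:
  assumes a: "a permutes {..<length w}" and x: "x \<in> group_algebra (length w)"
  shows "contraction i x (permute_list a w) = contraction i (single a 1 \<star> x) w"
  using place_right_mult[of "single w 1" "length w" "single a 1" x] a x
  by (simp add: contraction_def tensors_single group_algebra_single)

lemma lext_pscale_const: "lext (\<lambda>a. pscale (f a) Y) t = pscale (\<Sum>w\<in>keys t. lookup t w * f w) Y"
  by (rule poly_mapping_eqI) (simp add: lookup_lext sum_distrib_right mult.assoc)

lemma length_nths_subset: "S \<subseteq> {..<length w} \<Longrightarrow> length (nths w S) = card S"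
  unfolding length_nths by (rule arg_cong[where f = card]) auto

lemma length_nths_compl: "S \<subseteq> {..<length w} \<Longrightarrow> length (nths w (- S)) = length w - card S"
proof -
  assume S: "S \<subseteq> {..<length w}"
  have "{i. i < length w \<and> i \<in> - S} = {..<length w} - S" by auto
  then show ?thesis using S by (simp add: length_nths card_Diff_subset finite_subset)
qed

text \<open>After splitting words along \<open>S\<close>, the part inside contributes an equivariant
  element of the field and the part outside transforms as a tensor.\<close>

lemma phi_xS_gl:
  assumes t: "t \<in> tensors n" and g: "regular g" and S: "S \<subseteq> {..<n}" and x: "x \<in> group_algebra (card S)"
  shows "phi_xS i x S (Ktensor_act g t) = Ktensor_act g (phi_xS i x S t)"
  using t
proof (induction t rule: tensors_induct)
  case (single w a)
  let ?A = "nths w S" and ?B = "nths w (- S)"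
  let ?\<Theta> = "\<lambda>(u, v). single v (emb (contraction i x u))"
  have cg: "col_finite g" by (rule regular_col_finite[OF g])
  have xl: "x \<in> group_algebra (length ?A)" using x S single by (simp add: length_nths_subset)
  have "phi_xS i x S (kmap (gl_word g w)) =
      lext ?\<Theta> (kmap (lext (\<lambda>v. single (nths v S, nths v (- S)) 1) (gl_word g w)))"
    by (simp add: phi_xS_lext kmap_lext lext_lext)
  also have "\<dots> = lext (\<lambda>u. lext (\<lambda>v. single v (emb (contraction i x u))) (kmap (gl_word g ?B))) (kmap (gl_word g ?A))"
    by (simp add: gl_word_split[OF cg] kmap_lext lext_lext)
  also have "\<dots> = lext (\<lambda>u. pscale (emb (contraction i x u)) (kmap (gl_word g ?B))) (kmap (gl_word g ?A))"
  proof (rule lext_cong)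
    fix u
    show "lext (\<lambda>v. single v (emb (contraction i x u))) (kmap (gl_word g ?B)) =
        pscale (emb (contraction i x u)) (kmap (gl_word g ?B))"
      using lext_pscale_fun[of "emb (contraction i x u)" "\<lambda>v. single v 1" "kmap (gl_word g ?B)"] by simp
  qed
  also have "\<dots> = pscale (emb (poly_act g (contraction i x ?A))) (kmap (gl_word g ?B))"
    unfolding lext_pscale_const contraction_gl[OF xl cg]
    by (simp add: emb_sum emb_mult emb_Const del: mult_fract)
  finally show ?case
    by (simp add: Ktensor_act_single[OF g] phi_xS_pscale phi_xS_single K_act_mult[OF g] K_act_emb[OF g])
qed (simp_all add: Ktensor_act_add g phi_xS_add)

section \<open>Contractions and place permutations\<close>

lemma nths_map_filter: "nths w S = map ((!) w) (filter (\<lambda>i. i \<in> S) [0..<length w])"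
proof (induction w rule: rev_induct)
  case (snoc x w)
  have "map ((!) (w @ [x])) (filter (\<lambda>i. i \<in> S) [0..<length w]) = map ((!) w) (filter (\<lambda>i. i \<in> S) [0..<length w])"
    by (auto simp: nth_append)
  then show ?case by (simp add: nths_append snoc)
qed simp

text \<open>The letters read at \<open>S\<close> are those of \<open>w\<close> at the image of
  \<open>S\<close> under \<open>s\<close>, but possibly not in increasing order of position;
  \<open>a\<close> accounts for the order.\<close>

lemma nths_permute_list:
  assumes s: "s permutes {..<n}"
  obtains a where "a permutes {..<card (S \<inter> {..<n})}"
    "\<And>w. length w = n \<Longrightarrow> nths (permute_list s w) S = permute_list a (nths w (s ` S))"
proof -
  let ?L = "filter (\<lambda>i. i \<in> S) [0..<n]" and ?M = "filter (\<lambda>i. i \<in> s ` S) [0..<n]"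
  have inj: "inj s" using permutes_inj[OF s] .
  have "distinct (map s ?L)" using inj by (auto simp: distinct_map inj_on_def inj_def)
  moreover have "set (map s ?L) = set ?M"
  proof (intro equalityI subsetI)
    fix y assume "y \<in> set ?M"
    then obtain x where x: "x \<in> S" "y = s x" "y < n" by auto
    then have "x < n" using permutes_in_image[OF s, of x] by simp
    then show "y \<in> set (map s ?L)" using x by auto
  qed (use permutes_in_image[OF s] in auto)
  ultimately have m: "mset (map s ?L) = mset ?M"
    by (metis distinct_filter distinct_upt set_eq_iff_mset_eq_distinct)
  then obtain a where a: "a permutes {..<length ?M}" "permute_list a ?M = map s ?L"
    by (rule mset_eq_permutation)
  have "length ?M = length ?L" using mset_eq_length[OF m] by simp
  also have "\<dots> = card (S \<inter> {..<n})"
    using distinct_card[of ?L] by (simp add: Int_def conj_commute)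
  finally have len: "length ?M = card (S \<inter> {..<n})" .
  have "nths (permute_list s w) S = permute_list a (nths w (s ` S))" if w: "length w = n" for w :: "'a list"
  proof -
    have "nths (permute_list s w) S = map ((!) w) (map s ?L)"
      using w s by (auto simp: nths_map_filter permute_list_nth)
    also have "\<dots> = permute_list a (map ((!) w) ?M)"
      by (simp only: a(2)[symmetric] permute_list_map[OF a(1)])
    finally show ?thesis by (simp add: nths_map_filter w)
  qed
  then show ?thesis using that a(1) len by metis
qed

text \<open>The reordering inside \<open>S\<close> is moved into \<open>x\<close>, and the one
  outside acts on the result. As Specht modules are left ideals, the new contraction is again among
  those that define \<open>T_bracket\<close>.\<close>

lemma phi_xS_place:
  assumes s: "s permutes {..<n}" and S: "S \<subseteq> {..<n}" and x: "x \<in> group_algebra (card S)"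
  obtains a b where "a permutes {..<card S}" "\<And>t. t \<in> tensors n \<Longrightarrow>
     phi_xS i x S (ract t (single s 1)) = ract (phi_xS i (single a 1 \<star> x) (s ` S) t) (single b 1)"
proof -
  obtain a where a: "a permutes {..<card (S \<inter> {..<n})}"
    "\<And>w::nat list. length w = n \<Longrightarrow> nths (permute_list s w) S = permute_list a (nths w (s ` S))"
    using nths_permute_list[OF s] by metis
  obtain b where b: "\<And>w::nat list. length w = n \<Longrightarrow> nths (permute_list s w) (- S) = permute_list b (nths w (s ` (- S)))"
    using nths_permute_list[OF s, of "- S"] by metis
  have ac: "a permutes {..<card S}" using a(1) S by (simp add: Int_absorb2)
  have im: "s ` (- S) = - s ` S" using bij_image_Compl_eq[OF permutes_bij[OF s]] .
  have sS: "s ` S \<subseteq> {..<n}" "card (s ` S) = card S"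
    using S permutes_in_image[OF s] card_image[OF permutes_inj_on[OF s]] by auto
  have "phi_xS i x S (ract t (single s 1)) = ract (phi_xS i (single a 1 \<star> x) (s ` S) t) (single b 1)"
    if "t \<in> tensors n" for t
    using that
  proof (induction t rule: tensors_induct)
    case (single w z)
    have l: "length (nths w (s ` S)) = card S" using sS single by (simp add: length_nths_subset)
    have "contraction i x (permute_list a (nths w (s ` S))) = contraction i (single a 1 \<star> x) (nths w (s ` S))"
      by (rule contraction_permute) (simp_all add: l ac x)
    then show ?case using single by (simp add: ract_single phi_xS_single a(2) b im)
  qed (simp_all add: ract_add_left phi_xS_add)
  with ac show ?thesis using that by blast
qed

section \<open>The modules \<open>K\<^bsup>\<oplus>p\<^esup>\<close> and \<open>T\<^bsup>[n]\<^esup>\<close>\<close>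

lemma specht_iff: "x \<in> specht p \<longleftrightarrow> (\<exists>a\<in>group_algebra (sum_list p). x = a \<star> young_symmetrizer p)"
  by (auto simp: specht_def)

lemma specht_closed: "x \<in> specht p \<Longrightarrow> x \<in> group_algebra (sum_list p)"
  by (auto simp: specht_iff intro: group_algebra_mult young_symmetrizer_closed)

lemma specht_mult: "x \<in> specht p \<Longrightarrow> a \<in> group_algebra (sum_list p) \<Longrightarrow> a \<star> x \<in> specht p"
  by (auto simp: specht_iff galg_mult_assoc[symmetric] intro: group_algebra_mult)

lemma contraction_Sym:
  assumes i: "i < length \<sigma>" and x: "x \<in> specht (\<sigma> ! i)" and w: "length w = sum_list (\<sigma> ! i)"
  shows "contraction i x w \<in> Sym \<sigma>"
proof -
  from x obtain a where a: "a \<in> group_algebra (sum_list (\<sigma> ! i))" "x = a \<star> young_symmetrizer (\<sigma> ! i)"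
    by (auto simp: specht_iff)
  have t: "single w 1 \<in> tensors (sum_list (\<sigma> ! i))" using w by (simp add: tensors_single)
  have "place_right (single w 1) x = place_right (place_right (single w 1) a) (young_symmetrizer (\<sigma> ! i))"
    using place_right_mult[OF t a(1) young_symmetrizer_closed] a(2) by simp
  then have "place_right (single w 1) x \<in> schur (\<sigma> ! i)"
    using place_right_closed[OF t] by (auto simp: schur_iff)
  then show ?thesis unfolding contraction_def using i by (rule Sym.gen[rotated])
qed

lemma phi_xS_T_power:
  assumes t: "t \<in> T_power \<sigma> n" and i: "i < length \<sigma>" and x: "x \<in> specht (\<sigma> ! i)"
    and S: "S \<subseteq> {..<n}" "card S = sum_list (\<sigma> ! i)"
  shows "phi_xS i x S t \<in> T_power \<sigma> (n - card S)"
  unfolding phi_xS_lext using t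
proof (rule T_power_lext)
  fix w :: "nat list" assume w: "length w = n"
  show "single (nths w (- S)) (emb (contraction i x (nths w S))) \<in> T_power \<sigma> (n - card S)"
    using w S length_nths_subset[of S w] length_nths_compl[of S w]
    by (intro T_power_single K_field_emb contraction_Sym[OF i x]) auto
qed

lemma T_bracket_T_power: "t \<in> T_bracket \<sigma> n \<Longrightarrow> t \<in> T_power \<sigma> n"
  by (simp add: T_bracket_def)

lemma T_bracketD: "t \<in> T_bracket \<sigma> n \<Longrightarrow> i < length \<sigma> \<Longrightarrow> x \<in> specht (\<sigma> ! i) \<Longrightarrow> S \<subseteq> {..<n} \<Longrightarrow>
    card S = sum_list (\<sigma> ! i) \<Longrightarrow> phi_xS i x S t = 0"
  by (simp add: T_bracket_def)

lemma T_bracket_zero [simp]: "0 \<in> T_bracket \<sigma> n"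
  and T_bracket_add: "s \<in> T_bracket \<sigma> n \<Longrightarrow> t \<in> T_bracket \<sigma> n \<Longrightarrow> s + t \<in> T_bracket \<sigma> n"
  and T_bracket_pscale: "a \<in> K_field \<sigma> \<Longrightarrow> t \<in> T_bracket \<sigma> n \<Longrightarrow> pscale a t \<in> T_bracket \<sigma> n"
  by (auto simp: T_bracket_def phi_xS_add phi_xS_pscale intro: T_power_add T_power_pscale)

lemma T_bracket_ract:
  fixes t :: "'k::field Ktensor"
  assumes t: "t \<in> T_bracket \<sigma> n" and a: "a \<in> group_algebra n"
  shows "ract t a \<in> T_bracket \<sigma> n"
  using a
proof (induction a rule: group_algebra_induct)
  case (single s c)
  have tn: "t \<in> tensors n" "t \<in> T_power \<sigma> n" using T_bracket_T_power[OF t] T_power_tensors[OF T_bracket_T_power[OF t]] by auto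
  have "ract t (single s 1) \<in> T_bracket \<sigma> n"
    unfolding T_bracket_def
  proof (intro CollectI conjI allI impI ballI)
    show "ract t (single s 1) \<in> T_power \<sigma> n"
      by (rule ract_T_power[OF tn(2) group_algebra_single[OF single]])
    fix i S and x :: "'k galg" assume i: "i < length \<sigma>" and x: "x \<in> specht (\<sigma> ! i)"
      and S: "S \<subseteq> {..<n} \<and> card S = sum_list (\<sigma> ! i)"
    have xg: "x \<in> group_algebra (card S)" using specht_closed[OF x] S by simp
    obtain a b where ab: "a permutes {..<card S}"
      "phi_xS i x S (ract t (single s 1)) = ract (phi_xS i (single a 1 \<star> x) (s ` S) t) (single b 1)"
      using phi_xS_place[OF single _ xg] S tn by metis
    have "single a 1 \<star> x \<in> specht (\<sigma> ! i)"
      using ab(1) S by (intro specht_mult[OF x] group_algebra_single) simp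
    moreover have "s ` S \<subseteq> {..<n}" "card (s ` S) = sum_list (\<sigma> ! i)"
      using S permutes_in_image[OF single] card_image[OF permutes_inj_on[OF single]] by auto
    ultimately show "phi_xS i x S (ract t (single s 1)) = 0"
      unfolding ab(2) using T_bracketD[OF t i] by simp
  qed
  then have "ract t (pscale c (single s 1)) \<in> T_bracket \<sigma> n"
    unfolding ract_pscale_right by (intro T_bracket_pscale) auto
  then show ?case by simp
qed (auto simp: ract_add_right intro: T_bracket_add)

lemma T_bracket_gl:
  fixes t :: "'k::field Ktensor"
  assumes t: "t \<in> T_bracket \<sigma> n" and g: "regular g"
  shows "Ktensor_act g t \<in> T_bracket \<sigma> n"
  unfolding T_bracket_def
proof (intro CollectI conjI allI impI ballI)
  have tn: "t \<in> tensors n" "t \<in> T_power \<sigma> n" using T_bracket_T_power[OF t] T_power_tensors[OF T_bracket_T_power[OF t]] by auto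
  show "Ktensor_act g t \<in> T_power \<sigma> n" by (rule Ktensor_act_T_power[OF tn(2) g])
  fix i S and x :: "'k galg" assume i: "i < length \<sigma>" and x: "x \<in> specht (\<sigma> ! i)"
    and S: "S \<subseteq> {..<n} \<and> card S = sum_list (\<sigma> ! i)"
  have xg: "x \<in> group_algebra (card S)" using specht_closed[OF x] S by simp
  show "phi_xS i x S (Ktensor_act g t) = 0"
    using phi_xS_gl[OF tn(1) g _ xg, of i] T_bracketD[OF t i x, of S] S by simp
qed

text \<open>The span of the image of the symmetrizer over \<open>k\<close> is its image over
  \<open>K\<close>, since the symmetrizer has coefficients in \<open>k\<close>.\<close>

lemma K_schur_iff:
  "t \<in> K_schur \<sigma> p \<longleftrightarrow> (\<exists>u\<in>T_power \<sigma> (sum_list p). t = ract u (young_symmetrizer p))"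
proof
  let ?c = "young_symmetrizer p :: 'a galg" and ?n = "sum_list p"
  assume "t \<in> K_schur \<sigma> p"
  then obtain a B where aB: "finite B" "B \<subseteq> schur p" "a ` B \<subseteq> K_field \<sigma>"
    "t = (\<Sum>s\<in>B. pscale (a s) (kmap s))" by (auto simp: K_schur_def)
  have "\<forall>s\<in>B. \<exists>v. v \<in> tensors ?n \<and> s = place_right v ?c"
    using aB(2) by (auto simp: schur_iff subset_iff Bex_def)
  then obtain v where v: "\<And>s. s \<in> B \<Longrightarrow> v s \<in> tensors ?n" "\<And>s. s \<in> B \<Longrightarrow> s = place_right (v s) ?c"
    by metis
  have "t = (\<Sum>s\<in>B. ract (pscale (a s) (kmap (v s))) ?c)"
    unfolding aB(4)
  proof (rule sum.cong)
    fix s assume "s \<in> B"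
    then have "kmap s = kmap (place_right (v s) ?c)" using v by simp
    then show "pscale (a s) (kmap s) = ract (pscale (a s) (kmap (v s))) ?c"
      by (simp only: ract_def place_right_pscale_left kmap_place_right)
  qed simp
  also have "\<dots> = ract (\<Sum>s\<in>B. pscale (a s) (kmap (v s))) ?c" by (simp add: ract_sum_left)
  finally show "\<exists>u\<in>T_power \<sigma> ?n. t = ract u ?c"
    using aB v by (intro bexI[of _ "\<Sum>s\<in>B. pscale (a s) (kmap (v s))"])
      (auto intro!: T_power_sum T_power_pscale T_power_kmap)
next
  let ?c = "young_symmetrizer p :: 'a galg" and ?n = "sum_list p"
  assume "\<exists>u\<in>T_power \<sigma> ?n. t = ract u ?c"
  then obtain u where u: "u \<in> T_power \<sigma> ?n" "t = ract u ?c" by auto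
  let ?e = "\<lambda>w. place_right (single w (1::'a)) ?c"
  \<comment> \<open>Summands of \<open>K_schur\<close> are indexed by vectors, and several words may
    have the same image; their coefficients are collected.\<close>
  define a where "a s = (\<Sum>w | w \<in> keys u \<and> ?e w = s. lookup u w)" for s
  have "t = (\<Sum>w\<in>keys u. pscale (lookup u w) (kmap (?e w)))"
    unfolding u(2) ract_def place_right_lext lext_def[of _ u] by (simp add: kmap_lext)
  also have "\<dots> = (\<Sum>s\<in>?e ` keys u. \<Sum>w | w \<in> keys u \<and> ?e w = s. pscale (lookup u w) (kmap (?e w)))"
    by (rule sum.image_gen) simp
  also have "\<dots> = (\<Sum>s\<in>?e ` keys u. pscale (a s) (kmap s))"
  proof (rule sum.cong)
    fix s
    have "(\<Sum>w | w \<in> keys u \<and> ?e w = s. pscale (lookup u w) (kmap (?e w))) =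
       (\<Sum>w | w \<in> keys u \<and> ?e w = s. pscale (lookup u w) (kmap s))"
      by (rule sum.cong) auto
    also have "\<dots> = pscale (a s) (kmap s)"
      unfolding a_def by (rule poly_mapping_eqI) (simp add: lookup_sum sum_distrib_right)
    finally show "(\<Sum>w | w \<in> keys u \<and> ?e w = s. pscale (lookup u w) (kmap (?e w))) = pscale (a s) (kmap s)" .
  qed simp
  finally have t: "t = (\<Sum>s\<in>?e ` keys u. pscale (a s) (kmap s))" .
  have "a s \<in> K_field \<sigma>" for s
    unfolding a_def by (rule K_field_sum) (use u in \<open>auto simp: T_power_iff\<close>)
  then have aK: "a ` ?e ` keys u \<subseteq> K_field \<sigma>" by auto
  have eB: "?e ` keys u \<subseteq> schur p"
  proof clarify
    fix w assume "w \<in> keys u"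
    then have "single w 1 \<in> tensors ?n" using u(1) by (auto simp: T_power_iff tensors_def)
    then show "?e w \<in> schur p" by (auto simp: schur_iff)
  qed
  show "t \<in> K_schur \<sigma> p" unfolding K_schur_def
    by (intro CollectI exI[of _ a] exI[of _ "?e ` keys u"] conjI t finite_imageI finite_keys aK eB)
qed

lemma K_schur_T_power: "t \<in> K_schur \<sigma> p \<Longrightarrow> t \<in> T_power \<sigma> (sum_list p)"
  by (auto simp: K_schur_iff intro: ract_T_power young_symmetrizer_closed)

lemma K_schur_zero [simp]: "0 \<in> K_schur \<sigma> p"
  unfolding K_schur_iff by (rule bexI[of _ 0]) auto

lemma K_schur_add: "s \<in> K_schur \<sigma> p \<Longrightarrow> t \<in> K_schur \<sigma> p \<Longrightarrow> s + t \<in> K_schur \<sigma> p"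
  unfolding K_schur_iff using ract_add_left T_power_add by metis

lemma K_schur_pscale: "a \<in> K_field \<sigma> \<Longrightarrow> t \<in> K_schur \<sigma> p \<Longrightarrow> pscale a t \<in> K_schur \<sigma> p"
  unfolding K_schur_iff using ract_pscale_left T_power_pscale by metis

lemma K_schur_gl: "t \<in> K_schur \<sigma> p \<Longrightarrow> regular g \<Longrightarrow> Ktensor_act g t \<in> K_schur \<sigma> p"
  unfolding K_schur_iff
  using Ktensor_act_ract[OF T_power_tensors young_symmetrizer_closed] Ktensor_act_T_power by metis

lemma K_schur_ract: "u \<in> T_power \<sigma> (sum_list p) \<Longrightarrow> ract u (young_symmetrizer p) \<in> K_schur \<sigma> p"
  by (auto simp: K_schur_iff)

lemma Ktensor_module_simps [simp]:
  "carrier (Ktensor_module C) = C" "x \<oplus>\<^bsub>Ktensor_module C\<^esub> y = x + y" "\<zero>\<^bsub>Ktensor_module C\<^esub> = 0"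
  "a \<odot>\<^bsub>Ktensor_module C\<^esub> x = pscale a x"
  by (simp_all add: Ktensor_module_def mk_module_def)

lemma K_ring_simps [simp]:
  "carrier (K_ring \<sigma>) = K_field \<sigma>" "x \<oplus>\<^bsub>K_ring \<sigma>\<^esub> y = x + y" "x \<otimes>\<^bsub>K_ring \<sigma>\<^esub> y = x * y"
  "\<zero>\<^bsub>K_ring \<sigma>\<^esub> = 0" "\<one>\<^bsub>K_ring \<sigma>\<^esub> = 1"
  by (simp_all add: K_ring_def)

lemma K_module_hom_Ktensor_iff:
  "K_module_hom \<sigma> (Ktensor_module A) Ktensor_act (Ktensor_module B) Ktensor_act f \<longleftrightarrow>
    (\<forall>x\<in>A. f x \<in> B) \<and> (\<forall>x\<in>A. \<forall>y\<in>A. f (x + y) = f x + f y) \<and>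
    (\<forall>a\<in>K_field \<sigma>. \<forall>x\<in>A. f (pscale a x) = pscale a (f x)) \<and>
    (\<forall>g\<in>GL. \<forall>x\<in>A. f (Ktensor_act g x) = Ktensor_act g (f x))"
  by (simp add: K_module_hom_def linear_map_def equivariant_def)

lemma pure_tuple_pos:
  assumes "pure_tuple \<sigma>" "i < length \<sigma>"
  shows "0 < sum_list (\<sigma> ! i)" "is_partition (\<sigma> ! i)"
proof -
  have p: "is_partition (\<sigma> ! i)" "\<sigma> ! i \<noteq> []" using assms by (auto simp: pure_tuple_def)
  show "is_partition (\<sigma> ! i)" by (rule p(1))
  show "0 < sum_list (\<sigma> ! i)" using p by (cases "\<sigma> ! i") (auto simp: is_partition_def)
qed

lemma L_simple_subset_T_bracket:
  fixes \<sigma> :: "nat list list"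
  assumes \<sigma>: "pure_tuple \<sigma>" and t: "t \<in> (L_simple \<sigma> p :: 'k::field_char_0 Ktensor set)"
  shows "t \<in> T_bracket \<sigma> (sum_list p)"
  unfolding T_bracket_def
proof (intro CollectI conjI allI impI ballI)
  let ?n = "sum_list p"
  have tK: "t \<in> K_schur \<sigma> p" using t by (simp add: L_simple_def)
  then show tT: "t \<in> T_power \<sigma> ?n" by (rule K_schur_T_power)
  fix i S and x :: "'k galg" assume i: "i < length \<sigma>" and x: "x \<in> specht (\<sigma> ! i)"
    and S: "S \<subseteq> {..<?n} \<and> card S = sum_list (\<sigma> ! i)"
  let ?m = "?n - card S"
  have xg: "x \<in> group_algebra (card S)" using specht_closed[OF x] S by simp
  \<comment> \<open>Purity enters here: \<open>card S\<close> is positive, so the degree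
    drops.\<close>
  have lt: "?m < ?n" using pure_tuple_pos(1)[OF \<sigma> i] S card_mono[of "{..<?n}" S] by simp
  have pT: "phi_xS i x S u \<in> T_power \<sigma> ?m" if "u \<in> T_power \<sigma> ?n" for u
    using phi_xS_T_power[OF that i x] S by simp
  show "phi_xS i x S t = 0"
  proof (rule tensor_detected_by_young_symmetrizers)
    show "phi_xS i x S t \<in> tensors ?m" using pT[OF tT] by (rule T_power_tensors)
    fix q s assume q: "is_partition q" "sum_list q = ?m" and s: "s permutes {..<?m}"
    \<comment> \<open>Contract, permute and symmetrize: a module map to
      \<open>K_schur \<sigma> q\<close> of smaller degree, which kills \<open>t\<close> by the
      definition of \<open>L_simple\<close>.\<close>
    define f where "f u = ract (ract (phi_xS i x S u) (single s 1)) (young_symmetrizer q)" for u :: "'k Ktensor"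
    have sg: "single s 1 \<in> group_algebra ?m" using s by (rule group_algebra_single)
    have cg: "young_symmetrizer q \<in> group_algebra ?m" using young_symmetrizer_closed[of q] q by simp
    have "K_module_hom \<sigma> (Ktensor_module (K_schur \<sigma> p)) Ktensor_act (Ktensor_module (K_schur \<sigma> q)) Ktensor_act f"
      unfolding K_module_hom_Ktensor_iff
    proof (intro conjI ballI)
      fix u assume u: "u \<in> (K_schur \<sigma> p :: 'k Ktensor set)"
      note uT = K_schur_T_power[OF u]
      show "f u \<in> K_schur \<sigma> q" unfolding f_def
        by (rule K_schur_ract) (use ract_T_power[OF pT[OF uT] sg] q in simp)
      show "f (u + v) = f u + f v" for v by (simp add: f_def phi_xS_add ract_add_left)
      show "f (pscale a u) = pscale a (f u)" for a by (simp add: f_def phi_xS_pscale ract_pscale_left)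
      show "f (Ktensor_act g u) = Ktensor_act g (f u)" if "g \<in> GL" for g
      proof -
        have g: "regular g" using that by (rule GL_regular)
        have 1: "phi_xS i x S (Ktensor_act g u) = Ktensor_act g (phi_xS i x S u)"
          using phi_xS_gl[OF T_power_tensors[OF uT] g _ xg] S by simp
        have 2: "phi_xS i x S u \<in> tensors ?m" using pT[OF uT] by (rule T_power_tensors)
        show ?thesis unfolding f_def 1
          by (simp add: Ktensor_act_ract[OF ract_closed[OF 2] cg g] Ktensor_act_ract[OF 2 sg g])
      qed
    qed
    moreover have all: "\<forall>q f. is_partition q \<and> sum_list q < ?n \<and>
        K_module_hom \<sigma> (Ktensor_module (K_schur \<sigma> p)) Ktensor_act
          (Ktensor_module (K_schur \<sigma> q)) Ktensor_act f \<longrightarrow> f t = 0"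
      using CollectD[OF t[unfolded L_simple_def]] by (rule conjunct2)
    ultimately have "f t = 0" using q lt by (intro all[rule_format, of q f]) simp
    then show "ract (ract (phi_xS i x S t) (single s 1)) (young_symmetrizer q) = 0" by (simp add: f_def)
  qed
qed

section \<open>Some elements of GL\<close>

lemma GL_I:
  assumes b: "block N g" "block N h" and c: "col_finite g" "col_finite h"
    and gh: "\<And>a. lext (col g) (col h a) = single a 1" "\<And>a. lext (col h) (col g a) = single a 1"
  shows "g \<in> GL"
proof -
  have eq: "mat_mult g h = mat_one"
    if "col_finite g" "col_finite h" "\<And>a. lext (col g) (col h a) = single a 1" for g h :: "'a mat"
  proof (intro ext)
    fix i j
    have "mat_mult g h i j = lookup (col (mat_mult g h) j) i" using that by (simp add: lookup_col col_mat_mult(1))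
    also have "\<dots> = mat_one i j" by (simp add: col_mat_mult(2)[OF that(1,2)] that(3) lookup_single when_def mat_one_def)
    finally show "mat_mult g h i j = mat_one i j" .
  qed
  have mono: "block (Suc N) f" if "block N f" for f :: "'a mat" using that unfolding block_def by (meson Suc_leD)
  \<comment> \<open>\<open>GL\<close> is the union over positive sizes, so a block of size
    \<open>N\<close> is taken as one of size \<open>Suc N\<close>.\<close>
  have "g \<in> GL_n (Suc N)"
    unfolding GL_n_def using mono b eq[OF c gh(1)] eq[OF c(2,1) gh(2)] by blast
  then show ?thesis unfolding GL_def by auto
qed

definition shear :: "nat \<Rightarrow> nat \<Rightarrow> 'k::field \<Rightarrow> 'k mat" where
  "shear x y \<tau> i j = (if i = j then 1 else 0) + (if i = y \<and> j = x then \<tau> else 0)"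

lemma col_finite_shear: "col_finite (shear x y \<tau>)"
proof -
  have "{i. shear x y \<tau> i a \<noteq> 0} \<subseteq> {a, y}" for a by (auto simp: shear_def)
  then show ?thesis unfolding col_finite_def by (meson finite.emptyI finite.insertI finite_subset)
qed

lemma col_shear: "col (shear x y \<tau>) a = single a 1 + (if a = x then single y \<tau> else 0)"
  by (rule poly_mapping_eqI)
     (auto simp: lookup_col[OF col_finite_shear] shear_def lookup_add lookup_single when_def)

lemma shear_GL: "x \<noteq> y \<Longrightarrow> shear x y \<tau> \<in> GL"
proof (rule GL_I[where h = "shear x y (- \<tau>)" and N = "Suc (max x y)"])
  show "block (Suc (max x y)) (shear x y \<tau>)" "block (Suc (max x y)) (shear x y (- \<tau>))"
    by (auto simp: block_def shear_def mat_one_def)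
  assume "x \<noteq> y"
  then show "lext (col (shear x y \<tau>)) (col (shear x y (- \<tau>)) a) = single a 1"
    "lext (col (shear x y (- \<tau>))) (col (shear x y \<tau>) a) = single a 1" for a
    by (auto simp: col_shear lext_add pscale_add add.assoc single_add[symmetric])
qed (rule col_finite_shear)+

lemma shear_zero: "shear x y 0 = mat_one"
  by (auto simp: shear_def mat_one_def fun_eq_iff)

text \<open>Here \<open>u\<close> is a word of positions, to which \<open>\<phi>\<close> assigns letters.\<close>

lemma gl_word_shear:
  assumes "\<And>l. l \<in> set u \<Longrightarrow> \<phi> l = x \<longleftrightarrow> l = k" "\<phi>' = \<phi>(k := y)"
  shows "count_list u k = 0 \<Longrightarrow> gl_word (shear x y \<tau>) (map \<phi> u) = single (map \<phi> u) 1"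
    "count_list u k = 1 \<Longrightarrow> gl_word (shear x y \<tau>) (map \<phi> u) = single (map \<phi> u) 1 + single (map \<phi>' u) \<tau>"
  using assms(1)
proof (induction u)
  case (Cons a u)
  {
    case 1
    then show ?case using Cons.IH(1)
      by (simp add: gl_word_Cons[OF col_finite_shear] col_shear split: if_splits)
  next
    case 2
    have m: "map \<phi>' u = map \<phi> u" if "count_list u k = 0"
      using that by (auto simp: assms(2) count_list_0_iff)
    show ?case
    proof (cases "a = k")
      case True
      then have c: "count_list u k = 0" using 2 by simp
      have a: "\<phi>' a = y" "\<phi> a = x" using 2 True by (simp_all add: assms(2))
      show ?thesis using Cons.IH(1)[OF c] 2
        by (simp add: gl_word_Cons[OF col_finite_shear] col_shear lext_add a m[OF c])
    next
      case False
      then show ?thesis using Cons.IH(2) 2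
        by (simp add: gl_word_Cons[OF col_finite_shear] col_shear lext_add assms(2))
    qed
  }
qed (simp_all add: gl_word_Nil)

definition perm_mat :: "(nat \<Rightarrow> nat) \<Rightarrow> 'k::field mat" where
  "perm_mat \<pi> i j = (if i = \<pi> j then 1 else 0)"

lemma col_finite_perm_mat: "col_finite (perm_mat \<pi>)"
  by (simp add: col_finite_def perm_mat_def)

lemma col_perm_mat: "col (perm_mat \<pi>) a = single (\<pi> a) 1"
  by (rule poly_mapping_eqI) (simp add: lookup_col[OF col_finite_perm_mat] perm_mat_def lookup_single when_def)

lemma perm_mat_GL:
  assumes "\<pi> permutes {..<N}" shows "perm_mat \<pi> \<in> GL"
proof (rule GL_I[where h = "perm_mat (inv_into UNIV \<pi>)" and N = N])
  have "block N (perm_mat \<pi>)" if p: "\<pi> permutes {..<N}" for \<pi>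
    unfolding block_def
  proof (intro allI impI)
    fix i j assume "N \<le> i \<or> N \<le> j"
    then show "perm_mat \<pi> i j = mat_one i j"
      using permutes_in_image[OF p, of j] permutes_not_in[OF p, of j] by (auto simp: perm_mat_def mat_one_def)
  qed
  then show "block N (perm_mat \<pi>)" "block N (perm_mat (inv_into UNIV \<pi>))" using assms permutes_inv by blast+
qed (simp_all add: col_finite_perm_mat col_perm_mat permutes_inverses[OF assms])

lemma gl_word_perm_mat: "gl_word (perm_mat \<pi>) w = single (map \<pi> w) 1"
  by (induction w) (simp_all add: gl_word_Nil gl_word_Cons[OF col_finite_perm_mat] col_perm_mat)

definition diag_mat :: "nat \<Rightarrow> 'k::field \<Rightarrow> 'k mat" where
  "diag_mat x \<tau> i j = (if i = j then if i = x then \<tau> else 1 else 0)"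

lemma col_finite_diag_mat: "col_finite (diag_mat x \<tau>)"
  by (simp add: col_finite_def diag_mat_def)

lemma col_diag_mat: "col (diag_mat x \<tau>) a = single a (if a = x then \<tau> else 1)"
  by (rule poly_mapping_eqI) (simp add: lookup_col[OF col_finite_diag_mat] diag_mat_def lookup_single when_def)

lemma diag_mat_GL: "\<tau> \<noteq> 0 \<Longrightarrow> diag_mat x \<tau> \<in> GL"
  by (rule GL_I[where h = "diag_mat x (inverse \<tau>)" and N = "Suc x"])
     (auto simp: block_def diag_mat_def mat_one_def col_finite_diag_mat col_diag_mat)

lemma gl_word_diag_mat: "gl_word (diag_mat x \<tau>) w = single w (\<tau> ^ count_list w x)"
  by (induction w) (simp_all add: gl_word_Nil gl_word_Cons[OF col_finite_diag_mat] col_diag_mat)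

section \<open>Polynomial functions of a parameter\<close>

text \<open>Polynomials in all word variables, not only elements of \<open>Sym\<close>. Their
  relation to the generators of \<open>Sym\<close> is restored by
  \<open>proj_K_field\<close>.\<close>

definition Pol :: "'k::field ratfun set" where "Pol = range emb"

lemma Pol_emb [simp]: "emb p \<in> Pol" by (simp add: Pol_def)
lemma Pol_zero [simp]: "0 \<in> Pol" using Pol_emb[of 0] by (simp only: emb_zero)
lemma Pol_of_k [simp]: "of_k c \<in> Pol" by (simp add: of_k_def)
lemma Pol_one [simp]: "1 \<in> Pol" using Pol_of_k[of 1] by (simp only: of_k_one)

lemma Pol_add: "a \<in> Pol \<Longrightarrow> b \<in> Pol \<Longrightarrow> a + b \<in> Pol"
  unfolding Pol_def by (auto simp: emb_add[symmetric] simp del: add_fract)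

lemma Pol_mult: "a \<in> Pol \<Longrightarrow> b \<in> Pol \<Longrightarrow> a * b \<in> Pol"
  unfolding Pol_def by (auto simp: emb_mult[symmetric] simp del: mult_fract)

lemma Pol_uminus: "a \<in> Pol \<Longrightarrow> - a \<in> Pol"
  unfolding Pol_def by auto

lemma Pol_minus: "a \<in> Pol \<Longrightarrow> b \<in> Pol \<Longrightarrow> a - b \<in> Pol"
  using Pol_add[of a "- b"] Pol_uminus[of b] by simp

lemma Pol_sum: "(\<And>i. i \<in> I \<Longrightarrow> f i \<in> Pol) \<Longrightarrow> sum f I \<in> Pol"
  by (induction I rule: infinite_finite_induct) (auto intro: Pol_add)

definition Pol_poly :: "'k::field ratfun poly \<Rightarrow> bool" where
  "Pol_poly p \<longleftrightarrow> (\<forall>j. coeff p j \<in> Pol)"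

lemma Pol_poly_add: "Pol_poly p \<Longrightarrow> Pol_poly q \<Longrightarrow> Pol_poly (p + q)"
  and Pol_poly_mult: "Pol_poly p \<Longrightarrow> Pol_poly q \<Longrightarrow> Pol_poly (p * q)"
  and Pol_poly_const: "a \<in> Pol \<Longrightarrow> Pol_poly [:a:]"
  and Pol_poly_pCons: "a \<in> Pol \<Longrightarrow> Pol_poly p \<Longrightarrow> Pol_poly (pCons a p)"
  by (auto simp: Pol_poly_def coeff_mult coeff_pCons intro!: Pol_add Pol_sum Pol_mult split: nat.splits)

text \<open>Polynomial dependence on \<tau> with coefficients that are themselves polynomials in the
  word variables. As \<open>k\<close> is infinite in the application, such coefficients can be
  compared.\<close>

definition poly_fun :: "('k::field \<Rightarrow> 'k ratfun) \<Rightarrow> bool" where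
  "poly_fun u \<longleftrightarrow> (\<exists>p. Pol_poly p \<and> (\<forall>\<tau>. u \<tau> = poly p (of_k \<tau>)))"

lemma poly_fun_add: "poly_fun u \<Longrightarrow> poly_fun v \<Longrightarrow> poly_fun (\<lambda>\<tau>. u \<tau> + v \<tau>)"
  unfolding poly_fun_def by (metis Pol_poly_add poly_add)

lemma poly_fun_mult: "poly_fun u \<Longrightarrow> poly_fun v \<Longrightarrow> poly_fun (\<lambda>\<tau>. u \<tau> * v \<tau>)"
  unfolding poly_fun_def by (metis Pol_poly_mult poly_mult)

lemma poly_fun_const: "a \<in> Pol \<Longrightarrow> poly_fun (\<lambda>\<tau>. a)"
  unfolding poly_fun_def by (intro exI[of _ "[:a:]"]) (simp add: Pol_poly_const)

lemma poly_fun_param: "poly_fun (\<lambda>\<tau>. of_k \<tau>)"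
  unfolding poly_fun_def by (intro exI[of _ "[:0, 1:]"]) (simp add: Pol_poly_pCons Pol_poly_const)

lemma poly_fun_sum: "(\<And>i. i \<in> I \<Longrightarrow> poly_fun (u i)) \<Longrightarrow> poly_fun (\<lambda>\<tau>. \<Sum>i\<in>I. u i \<tau>)"
  by (induction I rule: infinite_finite_induct) (auto intro: poly_fun_add poly_fun_const)

lemma poly_fun_prod: "(\<And>i. i \<in> I \<Longrightarrow> poly_fun (u i)) \<Longrightarrow> poly_fun (\<lambda>\<tau>. \<Prod>i\<in>I. u i \<tau>)"
  by (induction I rule: infinite_finite_induct) (auto intro: poly_fun_mult poly_fun_const)

lemma poly_fun_gl_word_shear: "poly_fun (\<lambda>\<tau>. of_k (lookup (gl_word (shear x y \<tau>) w) v))"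
proof (cases "length v = length w")
  case True
  have "of_k (shear x y \<tau> i j) = of_k (if i = j then 1 else 0) + (if i = y \<and> j = x then of_k \<tau> else 0)" for \<tau> :: 'a and i j
    by (simp add: shear_def of_k_add)
  moreover have "poly_fun (\<lambda>\<tau>. if i = y \<and> j = x then of_k \<tau> else (0 :: 'a ratfun))" for i j
    by (cases "i = y \<and> j = x") (auto simp: poly_fun_const poly_fun_param)
  ultimately have "poly_fun (\<lambda>\<tau>. of_k (shear x y \<tau> i j) :: 'a ratfun)" for i j
    by (simp only:) (intro poly_fun_add poly_fun_const Pol_of_k)
  then show ?thesis using True
    by (simp add: lookup_gl_word_col_finite[OF col_finite_shear] of_k_prod poly_fun_prod)
qed (simp add: lookup_gl_word_col_finite[OF col_finite_shear] poly_fun_const)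

lemma gl_word_shear_keys: "keys (gl_word (shear x y \<tau>) w) \<subseteq> {v. set v \<subseteq> insert y (set w) \<and> length v = length w}"
proof (clarify, intro conjI subsetI)
  fix v assume v: "v \<in> keys (gl_word (shear x y \<tau>) w)"
  then show l: "length v = length w" by (auto simp: in_keys_iff lookup_gl_word_col_finite[OF col_finite_shear] split: if_splits)
  fix a assume "a \<in> set v"
  then obtain i where i: "i < length w" "a = v ! i" by (metis in_set_conv_nth l)
  have "(\<Prod>l<length w. shear x y \<tau> (v ! l) (w ! l)) \<noteq> 0"
    using v l by (simp add: in_keys_iff lookup_gl_word_col_finite[OF col_finite_shear])
  then have "shear x y \<tau> (v ! i) (w ! i) \<noteq> 0" using i by auto
  then show "a \<in> insert y (set w)" using i by (auto simp: shear_def split: if_splits)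
qed

lemma linear_form_superset: "finite V \<Longrightarrow> keys t \<subseteq> V \<Longrightarrow> linear_form i t = (\<Sum>v\<in>V. Const (lookup t v) * Var i v)"
  unfolding linear_form_def by (rule sum.mono_neutral_left) (auto simp: in_keys_iff)

lemma poly_fun_poly_act_shear: "poly_fun (\<lambda>\<tau>. emb (poly_act (shear x y \<tau>) p))"
proof (induction p rule: mpoly_induct)
  case (Var i w)
  \<comment> \<open>The support varies with \<tau>; this finite set of words contains it for every
    value.\<close>
  let ?V = "{v. set v \<subseteq> insert y (set w) \<and> length v = length w}"
  have fin: "finite ?V" by (rule finite_lists_length_eq) simp
  have "emb (poly_act (shear x y \<tau>) (Var i w)) = (\<Sum>v\<in>?V. of_k (lookup (gl_word (shear x y \<tau>) w) v) * emb (Var i v))" for \<tau> :: 'a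
    unfolding poly_act_Var linear_form_superset[OF fin gl_word_shear_keys]
    by (simp add: emb_sum emb_mult emb_Const del: mult_fract)
  then show ?case by (auto intro!: poly_fun_sum poly_fun_mult poly_fun_gl_word_shear poly_fun_const)
next
  case (add p q)
  then show ?case unfolding poly_act_add emb_add by (rule poly_fun_add)
next
  case (mult p q)
  then show ?case unfolding poly_act_mult emb_mult by (rule poly_fun_mult)
qed (simp add: poly_fun_const)

definition PolT :: "'k::field Ktensor set" where "PolT = {t. \<forall>v. lookup t v \<in> Pol}"

lemma poly_fun_Ktensor_act_shear:
  assumes xy: "x \<noteq> y" and H: "H \<in> PolT"
  shows "poly_fun (\<lambda>\<tau>. lookup (Ktensor_act (shear x y \<tau>) H) v)"
proof -
  have e: "lookup (Ktensor_act (shear x y \<tau>) H) v =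
      (\<Sum>w\<in>keys H. K_act (shear x y \<tau>) (lookup H w) * of_k (lookup (gl_word (shear x y \<tau>) w) v))" for \<tau>
  proof -
    have g: "regular (shear x y \<tau>)" using shear_GL[OF xy] by (rule GL_regular)
    have k: "keys (Poly_Mapping.map (K_act (shear x y \<tau>)) H) = keys H"
      using g by (auto simp: in_keys_iff lookup_map_hom)
    show ?thesis unfolding Ktensor_act_lext[OF g] lookup_lext k
      by (rule sum.cong) (simp_all add: lookup_map_hom g)
  qed
  have "poly_fun (\<lambda>\<tau>. K_act (shear x y \<tau>) (lookup H w))" for w
  proof -
    obtain P where P: "lookup H w = emb P" using H by (auto simp: PolT_def Pol_def)
    have "K_act (shear x y \<tau>) (lookup H w) = emb (poly_act (shear x y \<tau>) P)" for \<tau>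
      unfolding P by (rule K_act_emb[OF GL_regular[OF shear_GL[OF xy]]])
    then show ?thesis using poly_fun_poly_act_shear[of x y P] by simp
  qed
  then show ?thesis unfolding e by (intro poly_fun_sum poly_fun_mult poly_fun_gl_word_shear)
qed

text \<open>Comparing the coefficients of the parameter in \<open>D\<^sub>\<tau> (a + \<tau> b) = u\<^sub>\<tau>\<close> bounds the denominator of \<open>b\<close>
  in terms of that of \<open>a\<close>.\<close>

lemma shear_denominator:
  fixes a b :: "'k::field_char_0 ratfun"
  assumes u: "poly_fun u" and a: "emb D * a \<in> Pol"
    and eq: "\<And>\<tau>. emb (poly_act (shear x y \<tau>) D) * (a + of_k \<tau> * b) = u \<tau>"
  shows "emb (D * D) * b \<in> Pol"
proof -
  obtain pu where pu: "Pol_poly pu" "\<And>\<tau>. u \<tau> = poly pu (of_k \<tau>)" using u by (auto simp: poly_fun_def)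
  obtain pD where pD: "Pol_poly pD" "\<And>\<tau>. emb (poly_act (shear x y \<tau>) D) = poly pD (of_k \<tau>)"
    using poly_fun_poly_act_shear[of x y D] unfolding poly_fun_def by blast
  \<comment> \<open>This polynomial vanishes on the image of the infinite field \<open>k\<close>,
    hence identically.\<close>
  let ?q = "pD * [:a, b:] - pu"
  have "poly ?q (of_k \<tau>) = 0" for \<tau>
  proof -
    have "poly ?q (of_k \<tau>) = poly pD (of_k \<tau>) * (a + of_k \<tau> * b) - poly pu (of_k \<tau>)"
      by (simp add: distrib_left mult_ac)
    then show ?thesis unfolding pu(2)[symmetric] pD(2)[symmetric] eq by simp
  qed
  then have "range (of_k :: 'k \<Rightarrow> 'k ratfun) \<subseteq> {z. poly ?q z = 0}" by auto
  moreover have "infinite (range (of_k :: 'k \<Rightarrow> 'k ratfun))"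
    using infinite_UNIV_char_0 finite_imageD[of "of_k :: 'k \<Rightarrow> 'k ratfun" UNIV] by (auto simp: inj_def)
  ultimately have "?q = 0" using poly_roots_finite[of ?q] finite_subset by blast
  \<comment> \<open>The constant coefficient of \<open>pD\<close> is \<open>D\<close>, by setting
    \<tau> to 0. So the linear coefficient expresses \<open>D b\<close> through \<open>a\<close>,
    and one more factor \<open>D\<close> clears the denominator of \<open>a\<close>.\<close>
  then have "coeff (pD * [:a, b:]) 1 = coeff pu 1" by simp
  moreover have "coeff (pD * [:a, b:]) 1 = coeff pD 0 * b + coeff pD 1 * a"
    by (simp add: coeff_mult)
  ultimately have c: "coeff pD 0 * b + coeff pD 1 * a = coeff pu 1" by simp
  have "coeff pD 0 = emb D" using pD(2)[of 0] by (simp add: shear_zero poly_0_coeff_0)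
  then have "emb D * (emb D * b) = emb D * coeff pu 1 - coeff pD 1 * (emb D * a)"
    unfolding c[symmetric] \<open>coeff pD 0 = emb D\<close> by (simp only: distrib_left mult_ac add_diff_cancel_right')
  also have "\<dots> \<in> Pol" 
    by (rule Pol_minus[OF Pol_mult Pol_mult[OF _ a]]) (use pu(1) pD(1) in \<open>auto simp: Pol_poly_def\<close>)
  finally show ?thesis unfolding emb_mult by (simp add: mult.assoc del: mult_fract)
qed

section \<open>Variables and extraction of coefficients\<close>

definition vars :: "'k::field mpoly \<Rightarrow> (nat \<times> nat list) set" where
  "vars p = (\<Union>m\<in>keys p. keys m)"

lemma finite_vars: "finite (vars p)"
  by (simp add: vars_def)

lemma vars_add: "vars (p + q) \<subseteq> vars p \<union> vars q"
  using keys_add[of p q] by (auto simp: vars_def)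

lemma vars_mult: "vars (p * q) \<subseteq> vars p \<union> vars q"
proof
  fix x assume "x \<in> vars (p * q)"
  then obtain m where m: "m \<in> keys (p * q)" "x \<in> keys m" by (auto simp: vars_def)
  then obtain a b where "m = a + b" "a \<in> keys p" "b \<in> keys q" using keys_mult[of p q] by auto
  then show "x \<in> vars p \<union> vars q" using m keys_add[of a b] by (auto simp: vars_def)
qed

lemma vars_Const [simp]: "vars (Const c) = {}"
  by (simp add: vars_def Const_def)

lemma vars_zero [simp]: "vars 0 = {}" and vars_one [simp]: "vars 1 = {}"
  by (simp_all add: vars_def)

lemma vars_Var [simp]: "vars (Var i w) = {(i, w)}"
  by (simp add: vars_def Var_def)

lemma vars_sum: "vars (sum f I) \<subseteq> (\<Union>i\<in>I. vars (f i))"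
proof (induction I rule: infinite_finite_induct)
  case (insert i I)
  then show ?case using vars_add[of "f i" "sum f I"] by auto
qed simp_all

lemma vars_prod: "vars (prod f I) \<subseteq> (\<Union>i\<in>I. vars (f i))"
proof (induction I rule: infinite_finite_induct)
  case (insert i I)
  then show ?case using vars_mult[of "f i" "prod f I"] by auto
qed simp_all

lemma vars_power: "vars (p ^ k) \<subseteq> vars p"
proof (induction k)
  case (Suc k)
  then show ?case using vars_mult[of p "p ^ k"] by auto
qed simp

lemma vars_linear_form: "vars (linear_form i t) \<subseteq> {i} \<times> keys t"
proof -
  have "vars (linear_form i t) \<subseteq> (\<Union>w\<in>keys t. vars (Const (lookup t w) * Var i w))"
    unfolding linear_form_def by (rule vars_sum)
  also have "\<dots> \<subseteq> {i} \<times> keys t" using vars_mult[of "Const _" "Var i _"] by fastforce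
  finally show ?thesis .
qed

lemma vars_poly_eval: "vars (poly_eval \<nu> p) \<subseteq> (\<Union>x\<in>vars p. vars (\<nu> x))"
proof -
  have "vars (mono_eval \<nu> m) \<subseteq> (\<Union>x\<in>keys m. vars (\<nu> x))" for m
    unfolding mono_eval_def using vars_prod[of "\<lambda>x. \<nu> x ^ lookup m x" "keys m"] vars_power by blast
  then have "vars (Const (lookup p m) * mono_eval \<nu> m) \<subseteq> (\<Union>x\<in>keys m. vars (\<nu> x))" for m
    using vars_mult[of "Const (lookup p m)" "mono_eval \<nu> m"] by auto
  then have m: "vars (Const (lookup p m) * mono_eval \<nu> m) \<subseteq> (\<Union>x\<in>keys m. vars (\<nu> x))" for m .
  show ?thesis
  proof
    fix x assume "x \<in> vars (poly_eval \<nu> p)"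
    then obtain a where "a \<in> keys p" "x \<in> vars (Const (lookup p a) * mono_eval \<nu> a)"
      unfolding poly_eval_def using vars_sum[of "\<lambda>m. Const (lookup p m) * mono_eval \<nu> m" "keys p"] by auto
    moreover then obtain y where "y \<in> keys a" "x \<in> vars (\<nu> y)" using m[of a] by auto
    ultimately show "x \<in> (\<Union>x\<in>vars p. vars (\<nu> x))" unfolding vars_def[of p] by auto
  qed
qed

text \<open>Used together with purity to exclude the empty word, which would consist of old and of
  fresh letters at once.\<close>

lemma vars_Sym: "a \<in> Sym \<sigma> \<Longrightarrow> (i, w) \<in> vars a \<Longrightarrow> i < length \<sigma> \<and> length w = sum_list (\<sigma> ! i)"
proof (induction a rule: Sym.induct)
  case (gen j s)
  then have "i = j" "w \<in> keys s" using vars_linear_form[of j s] by auto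
  moreover obtain t where "t \<in> tensors (sum_list (\<sigma> ! j))" "s = place_right t (young_symmetrizer (\<sigma> ! j))"
    using gen by (auto simp: schur_iff)
  then have "s \<in> tensors (sum_list (\<sigma> ! j))" by (simp add: place_right_closed)
  ultimately show ?case using gen by (auto simp: tensors_def)
next
  case (add a b)
  then show ?case using vars_add[of a b] by auto
next
  case (mult a b)
  then show ?case using vars_mult[of a b] by auto
qed simp

section \<open>Coefficients with respect to some of the variables\<close>

definition restr :: "'a set \<Rightarrow> ('a \<Rightarrow>\<^sub>0 nat) \<Rightarrow> ('a \<Rightarrow>\<^sub>0 nat)" where
  "restr A m = (\<Sum>x\<in>keys m \<inter> A. single x (lookup m x))"

lemma lookup_restr: "lookup (restr A m) x = (if x \<in> A then lookup m x else 0)"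
proof -
  have "lookup (restr A m) x = (\<Sum>y\<in>keys m \<inter> A. if y = x then lookup m x else 0)"
    unfolding restr_def lookup_sum by (rule sum.cong) (auto simp: lookup_single when_def)
  then show ?thesis by (auto simp: sum.delta in_keys_iff)
qed

lemma restr_add: "restr A (m + m') = restr A m + restr A m'"
  by (rule poly_mapping_eqI) (simp add: lookup_restr lookup_add)

lemma restr_id: "keys m \<subseteq> A \<Longrightarrow> restr A m = m"
  by (rule poly_mapping_eqI) (auto simp: lookup_restr in_keys_iff)

lemma restr_disjoint: "keys m \<inter> A = {} \<Longrightarrow> restr A m = 0"
  by (rule poly_mapping_eqI) (auto simp: lookup_restr in_keys_iff)

text \<open>The coefficient of the monomial \<mu> in the variables outside \<open>Y\<close>, where
  \<open>p\<close> is viewed as a polynomial over the ring in the variables of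
  \<open>Y\<close>.\<close>

definition coeff_in :: "(nat \<times> nat list) set \<Rightarrow> ((nat \<times> nat list) \<Rightarrow>\<^sub>0 nat) \<Rightarrow> 'k::field mpoly \<Rightarrow> 'k mpoly" where
  "coeff_in Y \<mu> p = lext (\<lambda>m. if restr (- Y) m = \<mu> then single (restr Y m) 1 else 0) p"

lemma coeff_in_mult:
  assumes "vars q \<subseteq> Y" shows "coeff_in Y \<mu> (p * q) = coeff_in Y \<mu> p * q"
proof -
  have q: "keys q \<subseteq> {m. keys m \<subseteq> Y}" using assms by (auto simp: vars_def)
  show ?thesis
  proof (induction p rule: poly_mapping_add_induct)
    case (single m a)
    from q show ?case
    proof (induction q rule: poly_mapping_induct_on)
      case (single m' b)
      then have "restr (- Y) m' = 0" "restr Y m' = m'" by (auto intro: restr_id restr_disjoint)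
      then show ?case by (simp add: coeff_in_def mult_single restr_add)
    qed (simp_all add: coeff_in_def distrib_left lext_add)
  qed (simp_all add: coeff_in_def distrib_right lext_add)
qed

lemma coeff_in_constant:
  assumes "vars p \<inter> Y = {}" shows "coeff_in Y \<mu> p = Const (lookup p \<mu>)"
proof -
  have "keys p \<subseteq> {m. keys m \<inter> Y = {}}" using assms by (auto simp: vars_def)
  then show ?thesis
  proof (induction p rule: poly_mapping_induct_on)
    case (single m a)
    then have "restr (- Y) m = m" "restr Y m = 0" by (auto intro: restr_id restr_disjoint)
    then show ?case by (auto simp: coeff_in_def lookup_single when_def Const_def)
  qed (simp_all add: coeff_in_def lext_add lookup_add Const_add)
qed

text \<open>In \<open>D P = G Q\<close> take the coefficient of a monomial that occurs in
  \<open>D\<close>: the factors \<open>P\<close> and \<open>Q\<close> pass through, \<open>D\<close>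
  becomes a nonzero scalar, and so \<open>Q\<close> divides \<open>P\<close>.\<close>

lemma separated_denominator:
  assumes D: "vars D \<inter> Y = {}" "D \<noteq> 0" and PQ: "vars P \<subseteq> Y" "vars Q \<subseteq> Y" "Q \<noteq> 0"
    and h: "emb D * Fract P Q \<in> (Pol :: 'k::field ratfun set)"
  shows "Fract P Q \<in> Pol"
proof -
  obtain G where "emb D * Fract P Q = emb G" using h by (auto simp: Pol_def)
  then have e: "D * P = G * Q" using PQ by (simp add: eq_fract)
  from D obtain \<mu> where \<mu>: "lookup D \<mu> \<noteq> 0" by (metis lookup_zero poly_mapping_eqI)
  have "Const (lookup D \<mu>) * P = coeff_in Y \<mu> G * Q"
    using arg_cong[OF e, of "coeff_in Y \<mu>"] coeff_in_mult[OF PQ(1)] coeff_in_mult[OF PQ(2)] coeff_in_constant[OF D(1)]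
    by metis
  then have "P = Const (inverse (lookup D \<mu>)) * coeff_in Y \<mu> G * Q"
  proof -
    have "Const (inverse (lookup D \<mu>)) * coeff_in Y \<mu> G * Q = Const (inverse (lookup D \<mu>)) * (Const (lookup D \<mu>) * P)"
      using \<open>Const (lookup D \<mu>) * P = _\<close> by (simp add: mult.assoc)
    also have "\<dots> = Const (inverse (lookup D \<mu>) * lookup D \<mu>) * P" by (simp only: Const_mult mult.assoc)
    also have "\<dots> = P" using \<mu> by simp
    finally show ?thesis by simp
  qed
  then have "Fract P Q = emb (Const (inverse (lookup D \<mu>)) * coeff_in Y \<mu> G)"
    using PQ by (subst eq_fract) auto
  then show ?thesis by simp
qed

section \<open>Multilinear equivariant functions on words\<close>

text \<open>A replacement is allowed only at a letter that occurs once. Working from the left, the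
  letter to be replaced is still one of \<open>v\<close>, hence unlike the other letters of
  \<open>v\<close> and all those of \<open>w\<close>; the letters of \<open>w\<close> themselves may
  repeat.\<close>

lemma replace_chain:
  assumes l: "length v = n" "length w = n" and v: "distinct v" "set v \<inter> set w = {}" and P: "P v"
    and step: "\<And>u k y. length u = n \<Longrightarrow> k < n \<Longrightarrow> (\<And>l. l < n \<Longrightarrow> u ! l = u ! k \<longleftrightarrow> l = k) \<Longrightarrow> y \<noteq> u ! k \<Longrightarrow>
      P u \<Longrightarrow> P (u[k := y])"
  shows "P w"
proof -
  have "j \<le> n \<Longrightarrow> P (take j w @ drop j v)" for j
  proof (induction j)
    case 0
    then show ?case using P by simp
  next
    case (Suc j)
    let ?u = "take j w @ drop j v"
    have n: "?u ! l = (if l < j then w ! l else v ! l)" if "l < n" for l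
      using that l Suc.prems by (simp add: nth_append)
    have "?u[j := w ! j] = take (Suc j) w @ drop (Suc j) v"
      using Suc.prems l by (simp add: list_update_append take_Suc_conv_app_nth Cons_nth_drop_Suc[symmetric])
    moreover have "P (?u[j := w ! j])"
    proof (rule step)
      have ne: "w ! l \<noteq> v ! l'" if "l < n" "l' < n" for l l'
        using v(2) that l nth_mem by (metis disjoint_iff)
      show "?u ! l = ?u ! j \<longleftrightarrow> l = j" if "l < n" for l
        using that n[OF that] n[of j] Suc.prems ne[of l j] v(1) l by (auto simp: nth_eq_iff_index_eq)
      show "w ! j \<noteq> ?u ! j" using n[of j] ne[of j j] Suc.prems by simp
    qed (use Suc l in auto)
    ultimately show ?case by simp
  qed
  from this[of n] show ?thesis using l by simp
qed

lemma count_list_distinct: "distinct xs \<Longrightarrow> count_list xs x = (if x \<in> set xs then 1 else 0)"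
  by (induction xs) auto

lemma T_power_denominator:
  assumes "t \<in> T_power \<sigma> n"
  obtains D where "D \<in> Sym \<sigma>" "D \<noteq> 0" "\<And>v. \<exists>P\<in>Sym \<sigma>. emb D * lookup t v = emb P"
proof -
  have "\<exists>D\<in>Sym \<sigma>. D \<noteq> 0 \<and> (\<forall>v. \<exists>P\<in>Sym \<sigma>. emb D * lookup t v = emb P)"
    using assms
  proof (induction t rule: T_power_induct)
    case zero
    then show ?case by (intro bexI[of _ 1]) (auto intro!: bexI[of _ 0])
  next
    case (single w x)
    then obtain a b where ab: "x = Fract a b" "a \<in> Sym \<sigma>" "b \<in> Sym \<sigma>" "b \<noteq> 0" by (auto simp: K_field_def)
    have "emb b * x = emb a" using ab by (simp add: eq_fract)
    then have "\<exists>P\<in>Sym \<sigma>. emb b * lookup (single w x) v = emb P" for v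
      using ab by (cases "v = w") (auto simp: lookup_single when_def simp del: mult_fract intro!: bexI[of _ 0])
    then show ?case using ab by blast
  next
    case (add s t)
    then obtain D E where D: "D \<in> Sym \<sigma>" "D \<noteq> 0" "\<And>v. \<exists>P\<in>Sym \<sigma>. emb D * lookup s v = emb P"
      and E: "E \<in> Sym \<sigma>" "E \<noteq> 0" "\<And>v. \<exists>P\<in>Sym \<sigma>. emb E * lookup t v = emb P" by blast
    have "\<exists>P\<in>Sym \<sigma>. emb (D * E) * lookup (s + t) v = emb P" for v
    proof -
      obtain P Q where P: "P \<in> Sym \<sigma>" "emb D * lookup s v = emb P" and Q: "Q \<in> Sym \<sigma>" "emb E * lookup t v = emb Q"
        using D(3) E(3) by blast
      have "emb (D * E) * lookup (s + t) v = emb E * (emb D * lookup s v) + emb D * (emb E * lookup t v)"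
        unfolding emb_mult lookup_add by (simp only: distrib_left mult_ac)
      also have "\<dots> = emb (E * P + D * Q)" unfolding P Q by (simp only: emb_mult emb_add)
      finally show ?thesis using P(1) Q(1) D(1) E(1) by (blast intro: Sym.add Sym.mult)
    qed
    then show ?case using D E by (intro bexI[of _ "D * E"]) (auto intro: Sym.mult)
  qed
  then show ?thesis using that by blast
qed

lemma lookup_Ktensor_act_perm:
  assumes \<pi>: "\<pi> permutes {..<N}"
  shows "lookup (Ktensor_act (perm_mat \<pi>) t) (map \<pi> v) = K_act (perm_mat \<pi>) (lookup t v)"
proof -
  have g: "regular (perm_mat \<pi>)" using perm_mat_GL[OF \<pi>] by (rule GL_regular)
  have inj: "map \<pi> w = map \<pi> v \<longleftrightarrow> w = v" for w v using permutes_inj[OF \<pi>] by (simp add: inj_map_eq_map)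
  show ?thesis
    by (induction t rule: poly_mapping_add_induct)
       (auto simp: Ktensor_act_add g K_act_add lookup_add Ktensor_act_single gl_word_perm_mat lookup_single when_def inj)
qed

lemma lookup_Ktensor_act_diag:
  assumes \<tau>: "\<tau> \<noteq> 0"
  shows "lookup (Ktensor_act (diag_mat x \<tau>) t) v = of_k (\<tau> ^ count_list v x) * K_act (diag_mat x \<tau>) (lookup t v)"
proof -
  have g: "regular (diag_mat x \<tau>)" using diag_mat_GL[OF \<tau>] by (rule GL_regular)
  show ?thesis
    by (induction t rule: poly_mapping_add_induct)
       (auto simp: Ktensor_act_add g K_act_add lookup_add Ktensor_act_single gl_word_diag_mat lookup_single when_def
         distrib_left mult.commute)
qed

lemma mono_eval_mult: "mono_eval (\<lambda>x. \<nu> x * \<mu> x) m = mono_eval \<nu> m * mono_eval \<mu> m"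
  by (simp add: mono_eval_def power_mult_distrib prod.distrib)

lemma mono_eval_Var: "mono_eval (\<lambda>(i, w). Var i w) m = single m 1"
  using poly_eval_Var_id[of "\<lambda>(i, w). Var i w" "single m 1"] by (simp add: poly_eval_single)

lemma poly_eval_mono_eval: "poly_eval \<nu> (mono_eval \<mu> m) = mono_eval (\<lambda>x. poly_eval \<nu> (\<mu> x)) m"
proof -
  have "poly_eval \<nu> (\<Prod>x\<in>I. \<mu> x ^ lookup m x) = (\<Prod>x\<in>I. poly_eval \<nu> (\<mu> x) ^ lookup m x)" for I
    by (induction I rule: infinite_finite_induct) (simp_all add: poly_eval_mult poly_eval_power)
  then show ?thesis by (simp add: mono_eval_def)
qed

lemma mono_eval_cong: "(\<And>x. x \<in> keys m \<Longrightarrow> \<nu> x = \<mu> x) \<Longrightarrow> mono_eval \<nu> m = mono_eval \<mu> m"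
  by (simp add: mono_eval_def)

lemma mono_eval_remove:
  assumes "x \<in> keys m"
  shows "mono_eval \<nu> m = \<nu> x ^ lookup m x * (\<Prod>y\<in>keys m - {x}. \<nu> y ^ lookup m y)"
  unfolding mono_eval_def using assms by (simp add: prod.remove)

lemma mono_eval_Const: "mono_eval (\<lambda>x. Const (f x)) m = Const (\<Prod>x\<in>keys m. f x ^ lookup m x)"
proof -
  have p: "Const a ^ k = Const (a ^ k)" for a :: 'a and k by (induction k) (simp_all add: Const_mult)
  have "(\<Prod>x\<in>I. Const (f x) ^ lookup m x) = Const (\<Prod>x\<in>I. f x ^ lookup m x)" for I
    by (induction I rule: infinite_finite_induct) (simp_all add: p Const_mult)
  then show ?thesis by (simp add: mono_eval_def)
qed

lemma Const_mult_pscale: "Const a * p = pscale a p"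
  by (simp add: Const_def mult_map_scale_conv_mult)

text \<open>The weight of a monomial under the diagonal matrices that scale the letter
  \<open>x\<close>.\<close>

definition letter_weight :: "nat \<Rightarrow> ((nat \<times> nat list) \<Rightarrow>\<^sub>0 nat) \<Rightarrow> nat" where
  "letter_weight x m = (\<Sum>y\<in>keys m. lookup m y * count_list (snd y) x)"

lemma lookup_poly_act_diag:
  "lookup (poly_act (diag_mat x \<tau>) p) m = \<tau> ^ letter_weight x m * lookup p m"
proof (induction p rule: poly_mapping_add_induct)
  case (single m' a)
  have "poly_act (diag_mat x \<tau>) (single m' a) = Const a * mono_eval (\<lambda>y. Const (\<tau> ^ count_list (snd y) x) * (case y of (i, w) \<Rightarrow> Var i w)) m'"
    unfolding poly_act_eval poly_eval_single by (rule arg_cong[where f = "(*) _"], rule mono_eval_cong)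
      (auto simp: gl_word_diag_mat)
  also have "\<dots> = Const a * (Const (\<tau> ^ letter_weight x m') * single m' 1)"
    unfolding mono_eval_mult mono_eval_Const mono_eval_Var letter_weight_def
    by (simp add: power_sum power_mult[symmetric] mult.commute)
  also have "\<dots> = single m' (\<tau> ^ letter_weight x m' * a)"
    unfolding Const_mult_pscale by (simp add: mult.commute[of a])
  finally show ?case by (simp add: lookup_single when_def)
qed (simp_all add: poly_act_add lookup_add distrib_left)

text \<open>Powers of 2 are distinct in characteristic 0, so the single scaling by 2 separates all
  weights.\<close>

lemma two_power_inject: "(2 :: 'k::field_char_0) ^ a = 2 ^ b \<Longrightarrow> a = b"
proof -
  assume h: "(2 :: 'k) ^ a = 2 ^ b"
  have "(of_nat (2 ^ a) :: 'k) = of_nat (2 ^ b)" using h by simp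
  then have "(2::nat) ^ a = 2 ^ b" by (simp only: of_nat_eq_iff)
  then show ?thesis by simp
qed

text \<open>Exchanges the letters below \<open>M\<close> with \<open>M\<close> fresh ones. Being an
  involution, it also leads back.\<close>

definition swap_blocks :: "nat \<Rightarrow> nat \<Rightarrow> nat" where
  "swap_blocks M l = (if l < M then l + M else if l < 2 * M then l - M else l)"

lemma swap_blocks_swap_blocks [simp]: "swap_blocks M (swap_blocks M l) = l"
  unfolding swap_blocks_def by presburger

lemma swap_blocks_permutes: "swap_blocks M permutes {..<2 * M}"
proof (rule bij_imp_permutes)
  show "bij_betw (swap_blocks M) {..<2 * M} {..<2 * M}"
    by (rule bij_betwI[where g = "swap_blocks M"]) (auto simp: swap_blocks_def)
qed (simp add: swap_blocks_def)

lemma poly_act_perm_mat: "poly_act (perm_mat \<pi>) = poly_eval (\<lambda>(i, w). Var i (map \<pi> w))"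
  unfolding poly_act_eval gl_word_perm_mat by simp

text \<open>Abstracts a module map from a Schur piece of degree \<open>n\<close> to one of degree
  \<open>m\<close>: \<open>F w\<close> is its value at the symmetrized basis word \<open>w\<close>,
  and the linear extension of \<open>F\<close> is an equivariant map of tensor powers.\<close>

locale word_map =
  fixes \<sigma> :: "nat list list" and n m :: nat and F :: "nat list \<Rightarrow> 'k::field_char_0 Ktensor"
  assumes pure: "pure_tuple \<sigma>" and less: "m < n"
    and F_closed: "length w = n \<Longrightarrow> F w \<in> T_power \<sigma> m"
    and F_gl: "g \<in> GL \<Longrightarrow> length w = n \<Longrightarrow> Ktensor_act g (F w) = lext F (kmap (gl_word g w))"
begin

lemma F_shear:
  assumes w: "length w = n" and k: "k < n" "\<And>l. l < n \<Longrightarrow> w ! l = w ! k \<longleftrightarrow> l = k" and y: "y \<noteq> w ! k"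
  shows "Ktensor_act (shear (w ! k) y \<tau>) (F w) = F w + pscale (of_k \<tau>) (F (w[k := y]))"
proof -
  let ?u = "[0..<n]" and ?f = "(!) w" and ?f' = "((!) w)(k := y)"
  have m: "map ?f ?u = w" "map ?f' ?u = w[k := y]"
    using w k(1) by (auto simp: map_nth intro!: nth_equalityI simp: nth_list_update)
  have "count_list ?u k = 1" using k(1) by (simp add: count_list_distinct)
  then have "gl_word (shear (w ! k) y \<tau>) w = single w 1 + single (w[k := y]) \<tau>"
    using gl_word_shear(2)[of ?u ?f "w ! k" k ?f' y \<tau>] k m by auto
  then show ?thesis
    using F_gl[OF shear_GL w] y by (simp add: kmap_add lext_add)
qed

lemma F_perm:
  assumes "\<pi> permutes {..<N}" "length w = n"
  shows "Ktensor_act (perm_mat \<pi>) (F w) = F (map \<pi> w)"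
  using F_gl[OF perm_mat_GL[OF assms(1)] assms(2)] by (simp add: gl_word_perm_mat)

text \<open>Let \<open>D\<close> be a denominator of the value at \<open>0 \<dots> n - 1\<close>.  Exchanging the letters one by one for fresh
  ones multiplies the denominator only by powers of \<open>D\<close>; but the value at a word of fresh letters is also a
  quotient of polynomials in fresh variables, and the variables of \<open>D\<close> are old.\<close>

lemma F_polynomial: "F [0..<n] \<in> PolT"
proof -
  let ?w = "[0..<n]" and ?F = "F [0..<n]"
  have T: "?F \<in> T_power \<sigma> m" by (rule F_closed) simp
  obtain D where D: "D \<in> Sym \<sigma>" "D \<noteq> 0" "\<And>v. \<exists>P\<in>Sym \<sigma>. emb D * lookup ?F v = emb P"
    using T_power_denominator[OF T] by metis
  then obtain P where P: "\<And>v. P v \<in> Sym \<sigma>" "\<And>v. emb D * lookup ?F v = emb (P v)" by metis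
  \<comment> \<open>All letters of the word, of the denominator and of the numerators; those from
    \<open>M\<close> on are fresh.\<close>
  let ?L = "{..<n} \<union> (\<Union>z\<in>vars D \<union> (\<Union>v\<in>keys ?F. vars (P v)). set (snd z))"
  have "finite ?L" by (auto simp: finite_vars)
  then obtain M where M: "\<And>l. l \<in> ?L \<Longrightarrow> l < M" using finite_nat_set_iff_bounded by meson
  have nM: "l < M" if "l < n" for l using M that by simp
  have MD: "set w \<subseteq> {..<M}" if "(i, w) \<in> vars D" for i w
    using M that by (force intro: bexI[of _ "(i, w)"])
  have MP: "set w \<subseteq> {..<M}" if "v \<in> keys ?F" "(i, w) \<in> vars (P v)" for v i w
    using M that by (force intro: bexI[of _ "(i, w)"])
  \<comment> \<open>Variables in fresh letters only. The empty word is excluded, since it would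
    satisfy this condition vacuously and spoil the disjointness from the variables of
    \<open>D\<close>.\<close>
  let ?Y = "{(i, w). w \<noteq> [] \<and> set w \<subseteq> {M..}}" and ?\<pi> = "swap_blocks M"
  let ?w' = "map ?\<pi> ?w"
  have fract: "lookup ?F v = Fract (P v) D" for v
  proof -
    have "lookup ?F v = emb (P v) / emb D" using P(2)[of v] D(2) by (simp add: field_simps del: mult_fract divide_fract)
    then show ?thesis using D(2) by simp
  qed
  have word: "w \<noteq> []" if "a \<in> Sym \<sigma>" "(i, w) \<in> vars a" for a :: "'k mpoly" and i w
    using vars_Sym[OF that] pure_tuple_pos(1)[OF pure, of i] by (metis length_0_conv less_irrefl)
  have moved: "vars (poly_act (perm_mat ?\<pi>) a) \<subseteq> ?Y"
    if a: "a \<in> Sym \<sigma>" "\<And>i w. (i, w) \<in> vars a \<Longrightarrow> set w \<subseteq> {..<M}" for a :: "'k mpoly"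
  proof
    fix x assume "x \<in> vars (poly_act (perm_mat ?\<pi>) a)"
    then obtain i w where iw: "(i, w) \<in> vars a" "x \<in> vars (Var i (map ?\<pi> w) :: 'k mpoly)"
      using vars_poly_eval[of "\<lambda>(i, w). Var i (map ?\<pi> w)" a] unfolding poly_act_perm_mat by auto
    then show "x \<in> ?Y" using word[OF a(1) iw(1)] a(2)[OF iw(1)] by (auto simp: swap_blocks_def)
  qed
  have F': "F ?w' = Ktensor_act (perm_mat ?\<pi>) ?F"
    by (rule F_perm[OF swap_blocks_permutes, symmetric]) simp
  have g: "regular (perm_mat ?\<pi>)" by (rule GL_regular[OF perm_mat_GL[OF swap_blocks_permutes]])
  \<comment> \<open>Powers of the old denominator suffice along the whole chain, as
    \<open>shear_denominator\<close> doubles the exponent at each replacement.\<close>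
  have "\<exists>N. pscale (emb (D ^ N)) (F ?w') \<in> PolT"
  proof (rule replace_chain[where v = ?w and P = "\<lambda>u. \<exists>N. pscale (emb (D ^ N)) (F u) \<in> PolT"])
    show "set ?w \<inter> set ?w' = {}" using nM by (auto simp: swap_blocks_def)
    have "pscale (emb (D ^ 1)) ?F \<in> PolT" by (auto simp: PolT_def P(2) simp del: mult_fract)
    then show "\<exists>N. pscale (emb (D ^ N)) ?F \<in> PolT" by blast
    fix u k y assume u: "length u = n" "k < n" "\<And>l. l < n \<Longrightarrow> u ! l = u ! k \<longleftrightarrow> l = k" "y \<noteq> u ! k"
      and "\<exists>N. pscale (emb (D ^ N)) (F u) \<in> PolT"
    then obtain N where N: "pscale (emb (D ^ N)) (F u) \<in> PolT" by blast
    have gs: "regular (shear (u ! k) y \<tau>)" for \<tau> :: 'k using GL_regular[OF shear_GL] u(4) by metis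
    have fs: "Ktensor_act (shear (u ! k) y \<tau>) (F u) = F u + pscale (of_k \<tau>) (F (u[k := y]))" for \<tau>
      using u by (rule F_shear)
    have "emb (D ^ N * D ^ N) * lookup (F (u[k := y])) v \<in> Pol" for v
    proof (rule shear_denominator)
      show "poly_fun (\<lambda>\<tau>. lookup (Ktensor_act (shear (u ! k) y \<tau>) (pscale (emb (D ^ N)) (F u))) v)"
        by (rule poly_fun_Ktensor_act_shear[OF _ N]) (use u(4) in simp)
      show "emb (D ^ N) * lookup (F u) v \<in> Pol" using N by (auto simp: PolT_def)
      show "emb (poly_act (shear (u ! k) y \<tau>) (D ^ N)) * (lookup (F u) v + of_k \<tau> * lookup (F (u[k := y])) v) =
          lookup (Ktensor_act (shear (u ! k) y \<tau>) (pscale (emb (D ^ N)) (F u))) v" for \<tau>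
        unfolding Ktensor_act_pscale[OF gs] fs K_act_emb[OF gs]
        by (simp add: lookup_add del: mult_fract)
    qed
    then have "pscale (emb (D ^ (N + N))) (F (u[k := y])) \<in> PolT" by (simp add: PolT_def power_add del: mult_fract)
    then show "\<exists>N. pscale (emb (D ^ N)) (F (u[k := y])) \<in> PolT" by blast
  qed simp_all
  then obtain N where N: "pscale (emb (D ^ N)) (F ?w') \<in> PolT" by blast
  have Pol': "lookup (F ?w') (map ?\<pi> v) \<in> Pol" for v
  proof (cases "v \<in> keys ?F")
    case True
    have "vars D \<inter> ?Y = {}"
    proof -
      have "x \<notin> ?Y" if "x \<in> vars D" for x
      proof -
        obtain i w where x: "x = (i, w)" by (cases x)
        then have "w \<noteq> []" "set w \<subseteq> {..<M}" using word[OF D(1)] that MD by auto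
        then show ?thesis using x by (cases w) auto
      qed
      then show ?thesis by blast
    qed
    then have dN: "vars (D ^ N) \<inter> ?Y = {}" using vars_power[of D N] by blast
    have q: "vars (poly_act (perm_mat ?\<pi>) D) \<subseteq> ?Y" by (rule moved[OF D(1)]) (rule MD)
    have q': "vars (poly_act (perm_mat ?\<pi>) (P v)) \<subseteq> ?Y" by (rule moved[OF P(1)]) (rule MP[OF True])
    have nz: "poly_act (perm_mat ?\<pi>) D \<noteq> 0" using g D(2) by (auto simp: regular_def)
    have e: "lookup (F ?w') (map ?\<pi> v) = Fract (poly_act (perm_mat ?\<pi>) (P v)) (poly_act (perm_mat ?\<pi>) D)"
      unfolding F' lookup_Ktensor_act_perm[OF swap_blocks_permutes] fract using K_act_Fract[OF g D(2)] .
    have "emb (D ^ N) * lookup (F ?w') (map ?\<pi> v) \<in> Pol" using N by (auto simp: PolT_def)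
    then show ?thesis unfolding e using dN q q' nz D(2) by (intro separated_denominator[of "D ^ N" ?Y]) auto
  next
    case False
    then show ?thesis unfolding F' lookup_Ktensor_act_perm[OF swap_blocks_permutes]
      by (simp add: not_in_keys_iff_lookup_eq_zero g)
  qed
  \<comment> \<open>Exchanging the blocks once more carries polynomiality back from the fresh
    word.\<close>
  have "lookup ?F v \<in> Pol" for v
  proof -
    have vv: "map ?\<pi> (map ?\<pi> u) = u" for u by (simp add: o_def)
    have "Ktensor_act (perm_mat ?\<pi>) (F ?w') = F (map ?\<pi> ?w')"
      by (rule F_perm[OF swap_blocks_permutes]) simp
    then have "Ktensor_act (perm_mat ?\<pi>) (F ?w') = ?F" unfolding vv .
    then have "lookup ?F v = K_act (perm_mat ?\<pi>) (lookup (F ?w') (map ?\<pi> v))"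
      using lookup_Ktensor_act_perm[OF swap_blocks_permutes, of M "F ?w'" "map ?\<pi> v"] unfolding vv by simp
    moreover obtain a where "lookup (F ?w') (map ?\<pi> v) = emb a" using Pol'[of v] by (auto simp: Pol_def)
    ultimately show ?thesis using K_act_emb[OF g, of a] Pol_emb[of "poly_act (perm_mat ?\<pi>) a"] by (simp only:)
  qed
  then show ?thesis by (simp add: PolT_def)
qed

text \<open>The word \<open>[0..<n]\<close> has each letter below \<open>n\<close> exactly once and
  no other letter. By equivariance under scaling, each monomial of a coefficient together with the
  output word has the same letters in all.\<close>

lemma F_weight:
  assumes P: "lookup (F [0..<n]) v = emb P" and \<mu>: "\<mu> \<in> keys P"
  shows "letter_weight x \<mu> + count_list v x = (if x < n then 1 else 0)"
proof -
  let ?w = "[0..<n]" and ?g = "diag_mat x 2 :: 'k mat" and ?e = "if x < n then 1 else 0 :: nat"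
  have two: "(2 :: 'k) \<noteq> 0" by simp
  have g: "regular ?g" by (rule GL_regular[OF diag_mat_GL[OF two]])
  have "Ktensor_act ?g (F ?w) = pscale (of_k (2 ^ ?e)) (F ?w)"
    using F_gl[OF diag_mat_GL[OF two], of ?w x] by (simp add: gl_word_diag_mat count_list_distinct)
  then have "lookup (Ktensor_act ?g (F ?w)) v = of_k (2 ^ ?e) * lookup (F ?w) v" by simp
  then have "of_k (2 ^ count_list v x) * emb (poly_act ?g P) = of_k (2 ^ ?e) * emb P"
    unfolding lookup_Ktensor_act_diag[OF two] P K_act_emb[OF g] .
  then have "Const (2 ^ count_list v x) * poly_act ?g P = Const (2 ^ ?e) * P"
    unfolding emb_Const[symmetric] emb_mult[symmetric] emb_inject .
  then have "2 ^ count_list v x * lookup (poly_act ?g P) \<mu> = 2 ^ ?e * lookup P \<mu>"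
    unfolding Const_mult_pscale by (metis lookup_pscale)
  then have "2 ^ (letter_weight x \<mu> + count_list v x) * lookup P \<mu> = 2 ^ ?e * lookup P \<mu>"
    unfolding lookup_poly_act_diag by (simp add: power_add mult_ac)
  then have "(2 :: 'k) ^ (letter_weight x \<mu> + count_list v x) = 2 ^ ?e" using \<mu> by (simp add: in_keys_iff)
  then show ?thesis by (rule two_power_inject)
qed

end

section \<open>Renaming letters, and the retraction onto the symmetric algebra\<close>

definition rename :: "(nat \<Rightarrow> nat) \<Rightarrow> nat \<times> nat list \<Rightarrow> 'k::field mpoly" where
  "rename \<phi> = (\<lambda>(i, u). Var i (map \<phi> u))"

lemma poly_eval_linear_form: "poly_eval \<nu> (linear_form i t) = (\<Sum>w\<in>keys t. Const (lookup t w) * \<nu> (i, w))"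
  by (simp add: linear_form_def poly_eval_sum poly_eval_mult)

lemma rename_linear_form:
  "poly_eval (rename \<phi>) (linear_form i t) = linear_form i (lext (\<lambda>w. single (map \<phi> w) 1) t)"
  by (induction t rule: poly_mapping_add_induct)
     (simp_all add: linear_form_add lext_add poly_eval_add poly_eval_mult rename_def)

lemma rename_contraction:
  assumes x: "x \<in> group_algebra (length u)"
  shows "poly_eval (rename \<phi>) (contraction i x u) = contraction i x (map \<phi> u)"
proof -
  have "lext (\<lambda>w. single (map \<phi> w) 1) (place_right (single u 1) x) = place_right (single (map \<phi> u) 1) x"
    using x
  proof (induction x rule: group_algebra_induct)
    case (single s a)
    then show ?case by (simp add: permute_list_map)
  qed (simp_all add: place_right_add_right lext_add)
  then show ?thesis by (simp add: contraction_def rename_linear_form)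
qed

text \<open>A retraction of the polynomial ring onto the symmetric algebra; \<open>N i\<close> is the factor in the
  quasi-idempotency of the \<open>i\<close>-th Young symmetrizer.\<close>

definition proj_var :: "nat list list \<Rightarrow> (nat \<Rightarrow> 'k) \<Rightarrow> nat \<times> nat list \<Rightarrow> 'k::field mpoly" where
  "proj_var \<sigma> N = (\<lambda>(i, u). if i < length \<sigma> \<and> length u = sum_list (\<sigma> ! i)
     then Const (inverse (N i)) * contraction i (young_symmetrizer (\<sigma> ! i)) u else 0)"

text \<open>On tensors of the form \<open>t c\<close> the symmetrizer \<open>c\<close> multiplies by
  \<open>N i\<close>, so the normalized substitution fixes every generator of
  \<open>Sym\<close>.\<close>

lemma proj_Sym:
  assumes N: "\<And>i. i < length \<sigma> \<Longrightarrow> N i \<noteq> 0 \<and>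
      young_symmetrizer (\<sigma> ! i) \<star> young_symmetrizer (\<sigma> ! i) = pscale (N i) (young_symmetrizer (\<sigma> ! i))"
    and a: "a \<in> Sym \<sigma>"
  shows "poly_eval (proj_var \<sigma> N) a = a"
  using a
proof (induction a rule: Sym.induct)
  case (gen i s)
  let ?c = "young_symmetrizer (\<sigma> ! i)" and ?d = "sum_list (\<sigma> ! i)"
  obtain t where t: "t \<in> tensors ?d" "s = place_right t ?c" using gen by (auto simp: schur_iff)
  then have s: "s \<in> tensors ?d" by (simp add: place_right_closed)
  have "poly_eval (proj_var \<sigma> N) (linear_form i s) =
      (\<Sum>w\<in>keys s. Const (lookup s w) * (Const (inverse (N i)) * contraction i ?c w))"
    unfolding poly_eval_linear_form
    by (rule sum.cong) (use gen s in \<open>auto simp: proj_var_def tensors_def\<close>)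
  also have "\<dots> = Const (inverse (N i)) * linear_form i (place_right s ?c)"
    unfolding place_right_lext lext_def[of _ s] linear_form_sum linear_form_pscale
    by (simp add: contraction_def place_right_lext sum_distrib_left mult_ac)
  also have "place_right s ?c = pscale (N i) s"
    unfolding t(2) using N[OF gen(1)]
    by (simp add: place_right_mult[OF t(1) young_symmetrizer_closed young_symmetrizer_closed] place_right_pscale_right)
  also have "Const (inverse (N i)) * linear_form i (pscale (N i) s) = Const (inverse (N i) * N i) * linear_form i s"
    by (simp only: linear_form_pscale Const_mult mult.assoc)
  finally show ?case using N[OF gen(1)] by simp
qed (simp_all add: poly_eval_add poly_eval_mult)

text \<open>A polynomial in \<open>K\<close> satisfies \<open>P b = a\<close> with \<open>a\<close>
  and \<open>b\<close> in \<open>Sym\<close>, both fixed by the substitution; cancelling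
  \<open>b\<close> shows that \<open>P\<close> is fixed as well.\<close>

lemma proj_K_field:
  assumes N: "\<And>i. i < length \<sigma> \<Longrightarrow> N i \<noteq> 0 \<and>
      young_symmetrizer (\<sigma> ! i) \<star> young_symmetrizer (\<sigma> ! i) = pscale (N i) (young_symmetrizer (\<sigma> ! i))"
    and P: "emb P \<in> K_field \<sigma>"
  shows "poly_eval (proj_var \<sigma> N) P = P"
proof -
  from P obtain a b where ab: "emb P = Fract a b" "a \<in> Sym \<sigma>" "b \<in> Sym \<sigma>" "b \<noteq> 0" by (auto simp: K_field_def)
  then have e: "P * b = a" by (simp add: eq_fract)
  then have "poly_eval (proj_var \<sigma> N) P * b = a"
    using proj_Sym[OF N ab(2)] proj_Sym[OF N ab(3)] by (metis poly_eval_mult)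
  then show ?thesis using e ab(4) by (metis mult_right_cancel)
qed

lemma nths_eq_imp:
  assumes "length w = n" "length w' = n" "nths w A = nths w' A" "l < n" "l \<in> A"
  shows "w ! l = w' ! l"
proof -
  have "map ((!) w) (filter (\<lambda>i. i \<in> A) [0..<n]) = map ((!) w') (filter (\<lambda>i. i \<in> A) [0..<n])"
    using assms(1-3) by (simp add: nths_map_filter)
  then show ?thesis using assms(4,5) by auto
qed

text \<open>As \<open>R\<close> sees only the letters outside \<open>u\<close>, the sum factors
  through the contraction of \<open>t\<close> at the positions in \<open>u\<close>. Their order in
  \<open>u\<close> need not be increasing; the permutation \<open>a\<close> that sorts them is
  absorbed into \<open>x\<close>, which stays in the left ideal
  \<open>specht (\<sigma> ! i)\<close>.\<close>

lemma contraction_factor_vanishes: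
  fixes t :: "'k::field Ktensor"
  assumes t: "t \<in> T_bracket \<sigma> n" and i: "i < length \<sigma>"
    and u: "distinct u" "set u \<subseteq> {..<n}" "length u = sum_list (\<sigma> ! i)"
    and R: "\<And>w w'. length w = n \<Longrightarrow> length w' = n \<Longrightarrow> (\<And>l. l < n \<Longrightarrow> l \<notin> set u \<Longrightarrow> w ! l = w' ! l) \<Longrightarrow> R w = R w'"
  shows "lext (\<lambda>w. pscale (emb (contraction i (young_symmetrizer (\<sigma> ! i)) (map ((!) w) u))) (R w)) t = 0"
proof -
  let ?c = "young_symmetrizer (\<sigma> ! i) :: 'k galg" and ?S = "set u"
  have S: "?S \<subseteq> {..<n}" "card ?S = sum_list (\<sigma> ! i)" using u distinct_card[OF u(1)] by auto
  have tn: "keys t \<subseteq> {w. length w = n}"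
    using T_power_tensors[OF T_bracket_T_power[OF t]] by (simp add: tensors_def)
  let ?L = "filter (\<lambda>l. l \<in> ?S) [0..<n]"
  have "mset u = mset ?L" using u by (subst set_eq_iff_mset_eq_distinct[symmetric]) auto
  then obtain a where a: "a permutes {..<length ?L}" "permute_list a ?L = u" by (rule mset_eq_permutation)
  have len: "length ?L = sum_list (\<sigma> ! i)" using a u length_permute_list by metis
  define x where "x = single a 1 \<star> ?c"
  have cS: "?c \<in> specht (\<sigma> ! i)"
    unfolding specht_iff by (rule bexI[of _ "single id 1"]) (auto intro: group_algebra_single permutes_id)
  have x: "x \<in> specht (\<sigma> ! i)"
    unfolding x_def using a(1) len by (intro specht_mult[OF cS] group_algebra_single) simp
  have c: "contraction i ?c (map ((!) w) u) = contraction i x (nths w ?S)" if w: "length w = n" for w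
  proof -
    have l: "length (nths w ?S) = sum_list (\<sigma> ! i)" using S w by (simp add: length_nths_subset)
    have "map ((!) w) u = permute_list a (nths w ?S)"
      unfolding nths_map_filter w by (subst permute_list_map[OF a(1)]) (simp add: a(2))
    moreover have "contraction i ?c (permute_list a (nths w ?S)) = contraction i x (nths w ?S)"
      unfolding x_def by (rule contraction_permute) (use a(1) len l young_symmetrizer_closed[of "\<sigma> ! i"] in simp_all)
    ultimately show ?thesis by simp
  qed
  \<comment> \<open>\<open>R\<close> as a function of the remaining word; by hypothesis the chosen
    completion does not affect the value.\<close>
  define R' where "R' y = R (SOME w. length w = n \<and> nths w (- ?S) = y)" for y
  have R': "R' (nths w (- ?S)) = R w" if w: "length w = n" for w
  proof -
    let ?v = "SOME v. length v = n \<and> nths v (- ?S) = nths w (- ?S)"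
    have v: "length ?v = n \<and> nths ?v (- ?S) = nths w (- ?S)"
      by (rule someI[of _ w]) (simp add: w)
    show ?thesis unfolding R'_def
      by (rule R) (use v w nths_eq_imp[of ?v n w "- ?S"] in auto)
  qed
  have "lext (\<lambda>w. pscale (emb (contraction i ?c (map ((!) w) u))) (R w)) t = lext R' (phi_xS i x ?S t)"
    unfolding phi_xS_lext lext_lext
    by (rule lext_cong) (use tn c R' in auto)
  also have "\<dots> = 0" using T_bracketD[OF t i x S] by simp
  finally show ?thesis .
qed

lemma lext_sum_fun: "lext (\<lambda>w. \<Sum>i\<in>I. \<phi> i w) t = (\<Sum>i\<in>I. lext (\<phi> i) t)"
  by (induction I rule: infinite_finite_induct) (simp_all add: lext_add_fun)

text \<open>The letter \<open>k\<close> occurs once in the variables and the output word together,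
  so the shear alters a single factor: one variable of exponent 1, or the word. Expanding that
  factor gives the two summands.\<close>

lemma shear_monomial:
  fixes \<phi> :: "nat \<Rightarrow> nat"
  assumes wt: "letter_weight k \<mu> + count_list v k = 1"
    and let_v: "set v \<subseteq> {..<n}" and let_u: "\<And>i u. (i, u) \<in> keys \<mu> \<Longrightarrow> set u \<subseteq> {..<n}"
    and k: "\<And>l. l < n \<Longrightarrow> \<phi> l = x \<longleftrightarrow> l = k" and xy: "x \<noteq> y"
  shows "Ktensor_act (shear x y 1) (single (map \<phi> v) (emb (mono_eval (rename \<phi>) \<mu>))) =
    single (map \<phi> v) (emb (mono_eval (rename \<phi>) \<mu>)) +
    single (map (\<phi>(k := y)) v) (emb (mono_eval (rename (\<phi>(k := y))) \<mu> :: 'k::field mpoly))"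
proof -
  let ?g = "shear x y 1 :: 'k mat" and ?\<phi> = "\<phi>(k := y)"
  have g: "regular ?g" by (rule GL_regular[OF shear_GL[OF xy]])
  have gw: "count_list u k = 0 \<Longrightarrow> gl_word ?g (map \<phi> u) = single (map \<phi> u) 1"
    "count_list u k = 1 \<Longrightarrow> gl_word ?g (map \<phi> u) = single (map \<phi> u) 1 + single (map ?\<phi> u) 1"
    if "set u \<subseteq> {..<n}" for u
    using gl_word_shear[of u \<phi> x k ?\<phi> y 1] k that by auto
  have m0: "map ?\<phi> u = map \<phi> u" if "count_list u k = 0" for u
    using that by (auto simp: count_list_0_iff)
  let ?\<nu> = "\<lambda>z. poly_act ?g (rename \<phi> z)"
  have act: "poly_act ?g (mono_eval (rename \<phi>) \<mu>) = mono_eval ?\<nu> \<mu>"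
    unfolding poly_act_eval poly_eval_mono_eval ..
  have v0: "?\<nu> z = rename \<phi> z" "rename ?\<phi> z = (rename \<phi> z :: 'k mpoly)" if "z \<in> keys \<mu>" "count_list (snd z) k = 0" for z
  proof -
    obtain i u where z: "z = (i, u)" by (cases z)
    have c: "set u \<subseteq> {..<n}" "count_list u k = 0" using that let_u[of i u] by (simp_all add: z)
    show "?\<nu> z = rename \<phi> z"
      unfolding z rename_def prod.case poly_act_Var gw(1)[OF c] by simp
    show "rename ?\<phi> z = (rename \<phi> z :: 'k mpoly)"
      unfolding z rename_def prod.case m0[OF c(2)] ..
  qed
  show ?thesis
  proof (cases "count_list v k = 0")
    case True
    \<comment> \<open>A sum of naturals equal to 1 has exactly one nonzero term, which singles out
      the variable that contains \<open>k\<close>.\<close>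
    then have "(\<Sum>z\<in>keys \<mu>. lookup \<mu> z * count_list (snd z) k) = 1" using wt by (simp add: letter_weight_def)
    then have "\<exists>z\<in>keys \<mu>. lookup \<mu> z * count_list (snd z) k = 1 \<and>
        (\<forall>z'\<in>keys \<mu>. z \<noteq> z' \<longrightarrow> lookup \<mu> z' * count_list (snd z') k = 0)"
      by (subst (asm) sum_eq_1_iff) auto
    then obtain z where z: "z \<in> keys \<mu>" "lookup \<mu> z * count_list (snd z) k = 1"
      "\<And>z'. z' \<in> keys \<mu> \<Longrightarrow> z \<noteq> z' \<Longrightarrow> lookup \<mu> z' * count_list (snd z') k = 0"
      by blast
    then have z1: "lookup \<mu> z = 1" "count_list (snd z) k = 1" by auto
    have z0: "count_list (snd z') k = 0" if "z' \<in> keys \<mu> - {z}" for z'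
      using z(3)[of z'] that by (auto simp: in_keys_iff)
    have split: "mono_eval \<nu> \<mu> = \<nu> z * (\<Prod>y\<in>keys \<mu> - {z}. \<nu> y ^ lookup \<mu> y)" for \<nu> :: "nat \<times> nat list \<Rightarrow> 'k mpoly"
      using mono_eval_remove[OF z(1)] z1(1) by simp
    have e: "(\<Prod>y\<in>keys \<mu> - {z}. ?\<nu> y ^ lookup \<mu> y) = (\<Prod>y\<in>keys \<mu> - {z}. rename \<phi> y ^ lookup \<mu> y)"
      "(\<Prod>y\<in>keys \<mu> - {z}. rename ?\<phi> y ^ lookup \<mu> y) = (\<Prod>y\<in>keys \<mu> - {z}. rename \<phi> y ^ lookup \<mu> y :: 'k mpoly)"
      by (rule prod.cong; use z0 v0 in auto)+
    have "?\<nu> z = rename \<phi> z + rename ?\<phi> z"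
    proof -
      obtain i u where iu: "z = (i, u)" by (cases z)
      have c: "set u \<subseteq> {..<n}" "count_list u k = 1" using z(1) z1(2) let_u[of i u] by (simp_all add: iu)
      show ?thesis unfolding iu rename_def prod.case poly_act_Var gw(2)[OF c] by (simp add: linear_form_add)
    qed
    then have "mono_eval ?\<nu> \<mu> = mono_eval (rename \<phi>) \<mu> + mono_eval (rename ?\<phi>) \<mu>"
      unfolding split e by (simp add: distrib_right)
    then show ?thesis
      unfolding Ktensor_act_single[OF g] K_act_emb[OF g] act gw(1)[OF let_v True] m0[OF True]
      by (simp add: single_add[symmetric])
  next
    case False
    then have c: "count_list v k = 1" "letter_weight k \<mu> = 0" using wt by auto
    then have "count_list (snd z) k = 0" if "z \<in> keys \<mu>" for z
      using that by (auto simp: letter_weight_def in_keys_iff)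
    then have "mono_eval ?\<nu> \<mu> = mono_eval (rename \<phi>) \<mu>" "mono_eval (rename ?\<phi>) \<mu> = (mono_eval (rename \<phi>) \<mu> :: 'k mpoly)"
      using v0 by (auto intro: mono_eval_cong)
    then show ?thesis
      unfolding Ktensor_act_single[OF g] K_act_emb[OF g] act gw(2)[OF let_v c(1)]
      by (simp add: kmap_add pscale_add)
  qed
qed

section \<open>The multilinear form of an equivariant function and its vanishing\<close>

context word_map
begin

definition P :: "nat list \<Rightarrow> 'k mpoly" where
  "P v = (SOME p. lookup (F [0..<n]) v = emb p)"

lemma P: "lookup (F [0..<n]) v = emb (P v)"
proof -
  have "\<exists>p. lookup (F [0..<n]) v = emb p" using F_polynomial by (auto simp: PolT_def Pol_def)
  then show ?thesis unfolding P_def by (rule someI_ex)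
qed

text \<open>The value at \<open>[0..<n]\<close> read as a formula in the letters:
  \<open>\<phi>\<close> is substituted for them in the coefficients and in the output words.\<close>

definition G :: "(nat \<Rightarrow> nat) \<Rightarrow> 'k Ktensor" where
  "G \<phi> = (\<Sum>v\<in>keys (F [0..<n]). single (map \<phi> v) (emb (poly_eval (rename \<phi>) (P v))))"

lemma G_monomials: "G \<phi> = (\<Sum>v\<in>keys (F [0..<n]). \<Sum>\<mu>\<in>keys (P v).
    pscale (of_k (lookup (P v) \<mu>)) (single (map \<phi> v) (emb (mono_eval (rename \<phi>) \<mu>))))"
proof -
  have "single w (emb (poly_eval (rename \<phi>) p)) =
      (\<Sum>\<mu>\<in>keys p. pscale (of_k (lookup p \<mu>)) (single w (emb (mono_eval (rename \<phi>) \<mu>))))" for w :: "nat list" and p :: "'k mpoly"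
    by (rule poly_mapping_eqI)
       (simp add: poly_eval_def emb_sum emb_mult emb_Const lookup_sum lookup_single when_def del: mult_fract)
  then show ?thesis by (simp add: G_def)
qed

lemma weights:
  assumes "v \<in> keys (F [0..<n])" "\<mu> \<in> keys (P v)"
  shows "letter_weight x \<mu> + count_list v x = (if x < n then 1 else 0)"
  using F_weight[OF P assms(2)] .

lemma letters:
  assumes v: "v \<in> keys (F [0..<n])" and \<mu>: "\<mu> \<in> keys (P v)"
  shows "set v \<subseteq> {..<n}" "(i, u) \<in> keys \<mu> \<Longrightarrow> set u \<subseteq> {..<n}"
proof -
  have 0: "letter_weight x \<mu> = 0" "count_list v x = 0" if "\<not> x < n" for x
    using weights[OF v \<mu>, of x] that by auto
  show "set v \<subseteq> {..<n}" using 0(2) by (auto simp: count_list_0_iff)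
  assume iu: "(i, u) \<in> keys \<mu>"
  have "count_list u x = 0" if "\<not> x < n" for x
  proof -
    have "lookup \<mu> (i, u) * count_list u x = 0"
      using 0(1)[OF that] iu unfolding letter_weight_def by auto
    then show ?thesis using iu by (simp add: in_keys_iff)
  qed
  then show "set u \<subseteq> {..<n}" by (auto simp: count_list_0_iff)
qed

text \<open>Both sides agree at \<open>[0..<n]\<close> and change in the same way under a shear, so
  equality spreads by replacing letters. A given \<open>w\<close> may share letters with
  \<open>[0..<n]\<close>, so the chain passes through the fresh word
  \<open>[M..<M + n]\<close>.\<close>

lemma F_eq_G: assumes "length w = n" shows "F w = G ((!) w)"
proof -
  \<comment> \<open>Only letters below \<open>n\<close> occur in the formula, so the unspecified
    values of \<open>(!) w\<close> beyond the end of the word do no harm.\<close>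
  have G_cong: "G \<phi> = G \<psi>" if e: "\<And>l. l < n \<Longrightarrow> \<phi> l = \<psi> l" for \<phi> \<psi>
  proof -
    have m: "map \<phi> u = map \<psi> u" if "set u \<subseteq> {..<n}" for u using that e by auto
    have "mono_eval (rename \<phi>) \<mu> = (mono_eval (rename \<psi>) \<mu> :: 'k mpoly)"
      if "v \<in> keys (F [0..<n])" "\<mu> \<in> keys (P v)" for v \<mu>
    proof (rule mono_eval_cong)
      fix z assume "z \<in> keys \<mu>"
      moreover obtain i u where z: "z = (i, u)" by (cases z)
      ultimately have "map \<phi> u = map \<psi> u" using m[OF letters(2)[OF that, of i u]] by blast
      then show "rename \<phi> z = (rename \<psi> z :: 'k mpoly)" by (simp only: rename_def z prod.case)
    qed
    moreover have "map \<phi> v = map \<psi> v" if "v \<in> keys (F [0..<n])" "\<mu> \<in> keys (P v)" for v \<mu>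
      using m[OF letters(1)[OF that]] .
    ultimately show ?thesis unfolding G_monomials by (intro sum.cong refl) (simp only:)
  qed
  have step: "F (u[k := y]) = G ((!) (u[k := y]))"
    if u: "length u = n" "k < n" "\<And>l. l < n \<Longrightarrow> u ! l = u ! k \<longleftrightarrow> l = k" "y \<noteq> u ! k" and FG: "F u = G ((!) u)" for u k y
  proof -
    let ?g = "shear (u ! k) y 1 :: 'k mat"
    have xy: "u ! k \<noteq> y" using u(4) by simp
    have g: "regular ?g" by (rule GL_regular[OF shear_GL[OF xy]])
    have "Ktensor_act ?g (G ((!) u)) = G ((!) u) + G (((!) u)(k := y))"
      unfolding G_monomials Ktensor_act_sum[OF g] Ktensor_act_pscale[OF g] K_act_of_k[OF g] sum.distrib[symmetric]
    proof (intro sum.cong refl)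
      fix v \<mu> assume v: "v \<in> keys (F [0..<n])" "\<mu> \<in> keys (P v)"
      have wt: "letter_weight k \<mu> + count_list v k = 1" using weights[OF v, of k] u(2) by simp
      show "pscale (of_k (lookup (P v) \<mu>)) (Ktensor_act ?g (single (map ((!) u) v) (emb (mono_eval (rename ((!) u)) \<mu>)))) =
        pscale (of_k (lookup (P v) \<mu>)) (single (map ((!) u) v) (emb (mono_eval (rename ((!) u)) \<mu>))) +
        pscale (of_k (lookup (P v) \<mu>)) (single (map (((!) u)(k := y)) v) (emb (mono_eval (rename (((!) u)(k := y))) \<mu>)))"
      proof -
        have "Ktensor_act ?g (single (map ((!) u) v) (emb (mono_eval (rename ((!) u)) \<mu>))) =
            single (map ((!) u) v) (emb (mono_eval (rename ((!) u)) \<mu>)) +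
            single (map (((!) u)(k := y)) v) (emb (mono_eval (rename (((!) u)(k := y))) \<mu>))"
          by (rule shear_monomial[OF wt letters(1)[OF v] _ _ xy]) (rule letters(2)[OF v], assumption, rule u(3))
        then show ?thesis by (simp only: pscale_add)
      qed
    qed
    moreover have "Ktensor_act ?g (F u) = F u + F (u[k := y])" using F_shear[OF u, of 1] by simp
    moreover have "G (((!) u)(k := y)) = G ((!) (u[k := y]))"
      by (rule G_cong) (use u in \<open>simp add: nth_list_update\<close>)
    ultimately show ?thesis using FG by simp
  qed
  have base: "F [0..<n] = G ((!) [0..<n])"
  proof -
    have "G ((!) [0..<n]) = G (\<lambda>l. l)" by (rule G_cong) simp
    also have "\<dots> = (\<Sum>v\<in>keys (F [0..<n]). single v (lookup (F [0..<n]) v))"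
    proof -
      have "poly_eval (rename (\<lambda>l. l)) p = p" for p :: "'k mpoly"
        by (rule poly_eval_Var_id) (simp add: rename_def)
      then show ?thesis by (simp add: G_def P)
    qed
    finally show ?thesis by (simp add: poly_mapping_sum_singles)
  qed
  obtain M where M: "\<And>l. l \<in> {..<n} \<union> set w \<Longrightarrow> l < M"
    using finite_nat_set_iff_bounded[of "{..<n} \<union> set w"] by auto
  let ?w = "[M..<M + n]"
  have "F ?w = G ((!) ?w)"
  proof (rule replace_chain[where P = "\<lambda>u. F u = G ((!) u)", OF _ _ _ _ base step])
    show "set [0..<n] \<inter> set ?w = {}" using M[of "n - 1"] by (cases n) auto
  qed simp_all
  then show ?thesis
    by (rule replace_chain[where P = "\<lambda>u. F u = G ((!) u)" and v = ?w and n = n, rotated 4, OF _ step])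
       (use assms M in \<open>force simp: disjoint_iff\<close>)+
qed

text \<open>It suffices to treat one monomial of one coefficient. Some letter is missing from the
  shorter output word, so it occurs in a variable; after the retraction this variable is a
  contraction, and \<open>contraction_factor_vanishes\<close> applies to it.\<close>

theorem F_vanishes:
  assumes t: "t \<in> T_bracket \<sigma> n"
  shows "lext F t = 0"
proof -
  have "\<exists>N. i < length \<sigma> \<longrightarrow> N \<noteq> (0::'k) \<and>
      young_symmetrizer (\<sigma> ! i) \<star> young_symmetrizer (\<sigma> ! i) = pscale N (young_symmetrizer (\<sigma> ! i))" for i
    using young_symmetrizer_quasi_idempotent pure_tuple_pos(2)[OF pure] by metis
  then obtain N :: "nat \<Rightarrow> 'k" where N: "\<And>i. i < length \<sigma> \<Longrightarrow> N i \<noteq> 0 \<and>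
      young_symmetrizer (\<sigma> ! i) \<star> young_symmetrizer (\<sigma> ! i) = pscale (N i) (young_symmetrizer (\<sigma> ! i))"
    by metis
  have tn: "length w = n" if "w \<in> keys t" for w
    using T_power_tensors[OF T_bracket_T_power[OF t]] that by (auto simp: tensors_def)
  \<comment> \<open>The value at \<open>w\<close> of a variable under the retraction and the
    substitution of letters: a scalar times a contraction of a subword of \<open>w\<close>, or
    0.\<close>
  define \<rho> where "\<rho> w z = poly_eval (rename ((!) w)) (proj_var \<sigma> N z)" for w z
  have PK: "emb (P v) \<in> K_field \<sigma>" for v
    using F_closed[of "[0..<n]"] unfolding P[symmetric] by (simp add: T_power_iff)
  have ren: "poly_eval (rename ((!) w)) (P v) = (\<Sum>\<mu>\<in>keys (P v). Const (lookup (P v) \<mu>) * mono_eval (\<rho> w) \<mu>)" for w v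
  proof -
    have "poly_eval (rename ((!) w)) (P v) = poly_eval (rename ((!) w)) (poly_eval (proj_var \<sigma> N) (P v))"
      by (simp add: proj_K_field[OF N PK])
    then show ?thesis
      unfolding poly_eval_poly_eval \<rho>_def[symmetric] poly_eval_def[of "\<lambda>x. \<rho> w x"] .
  qed
  have F: "F w = (\<Sum>v\<in>keys (F [0..<n]). \<Sum>\<mu>\<in>keys (P v).
      pscale (emb (mono_eval (\<rho> w) \<mu>)) (single (map ((!) w) v) (of_k (lookup (P v) \<mu>))))" if "w \<in> keys t" for w
    unfolding F_eq_G[OF tn[OF that]] G_def
  proof (intro sum.cong refl)
    fix v
    show "single (map ((!) w) v) (emb (poly_eval (rename ((!) w)) (P v))) = (\<Sum>\<mu>\<in>keys (P v).
      pscale (emb (mono_eval (\<rho> w) \<mu>)) (single (map ((!) w) v) (of_k (lookup (P v) \<mu>))))"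
      by (rule poly_mapping_eqI)
         (simp add: ren emb_sum emb_mult emb_Const lookup_sum lookup_single when_def mult.commute del: mult_fract)
  qed
  have "lext (\<lambda>w. pscale (emb (mono_eval (\<rho> w) \<mu>)) (single (map ((!) w) v) (of_k (lookup (P v) \<mu>)))) t = 0"
    if v: "v \<in> keys (F [0..<n])" "\<mu> \<in> keys (P v)" for v \<mu>
  proof -
    \<comment> \<open>The output word has fewer than \<open>n\<close> letters, so some letter below
      \<open>n\<close> is left to the monomial.\<close>
    have "length v = m" using T_power_tensors[OF F_closed[of "[0..<n]"]] v(1) by (auto simp: tensors_def)
    then have "card (set v) < card {..<n}" using card_length[of v] less by simp
    then obtain l where l: "l < n" "l \<notin> set v"
      by (metis card_mono finite_set lessThan_iff linorder_not_le subsetI)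
    have "count_list v l = 0" using l by (simp add: count_list_0_iff)
    then have "letter_weight l \<mu> \<noteq> 0" using weights[OF v, of l] l(1) by simp
    then obtain z where z: "z \<in> keys \<mu>" "lookup \<mu> z * count_list (snd z) l \<noteq> 0"
      unfolding letter_weight_def by (meson sum.neutral)
    obtain i u where iu: "z = (i, u)" by (cases z)
    have lu: "l \<in> set u" using z(2) iu by (auto simp: count_list_0_iff intro: ccontr)
    show ?thesis
    proof (cases "i < length \<sigma> \<and> length u = sum_list (\<sigma> ! i)")
      case False
      \<comment> \<open>The retraction sends variables of the wrong shape to 0, and \<open>z\<close>
        has positive exponent.\<close>
      then have "\<rho> w z = 0" for w by (auto simp: \<rho>_def proj_var_def iu)
      then have "mono_eval (\<rho> w) \<mu> = 0" for w
        using mono_eval_remove[OF z(1), of "\<rho> w"] z(1) by (simp add: in_keys_iff)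
      then show ?thesis by simp
    next
      case True
      have wle: "lookup \<mu> z' * count_list (snd z') x \<le> letter_weight x \<mu>" if "z' \<in> keys \<mu>" for z' x
        unfolding letter_weight_def by (rule member_le_sum) (use that in auto)
      have one: "letter_weight x \<mu> \<le> 1" for x using weights[OF v, of x] by (auto split: if_splits)
      \<comment> \<open>Every letter has total weight at most 1, so \<open>z\<close> has exponent 1
        and its word has distinct letters.\<close>
      have z1: "lookup \<mu> z = 1"
      proof -
        have "lookup \<mu> z * count_list (snd z) l \<le> 1" using wle[OF z(1), of l] one[of l] by simp
        then show ?thesis using z(2) by (metis One_nat_def le_SucE le_zero_eq mult_eq_1_iff)
      qed
      have "count_list u x \<le> 1" for x using wle[OF z(1), of x] one[of x] z1 iu by simp
      then have du: "distinct u"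
      proof -
        have "distinct xs" if "\<And>x. count_list xs x \<le> 1" for xs :: "nat list"
          using that
        proof (induction xs)
          case (Cons a xs)
          have "count_list xs x \<le> 1" for x using Cons.prems[of x] by (auto split: if_splits)
          moreover have "a \<notin> set xs" using Cons.prems[of a] by (auto simp: count_list_0_iff[symmetric])
          ultimately show ?case using Cons.IH by simp
        qed simp
        then show ?thesis using \<open>\<And>x. count_list u x \<le> 1\<close> by blast
      qed
      \<comment> \<open>A letter of \<open>u\<close> spends its weight on \<open>z\<close>; it
        occurs neither in \<open>v\<close> nor in another variable. Hence the rest \<open>R\<close>
        is independent of the letters at the positions in \<open>u\<close>.\<close>
      have away_v: "x \<notin> set v" if "x \<in> set u" for x
      proof -
        have "count_list u x = 1" using that du by (simp add: count_list_distinct)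
        then have "1 \<le> letter_weight x \<mu>" using wle[OF z(1), of x] z1 iu by simp
        then have "count_list v x = 0" using weights[OF v, of x] by (auto split: if_splits)
        then show ?thesis by (simp add: count_list_0_iff)
      qed
      have away_z: "x \<notin> set (snd z')" if "x \<in> set u" "z' \<in> keys \<mu> - {z}" for x z'
      proof -
        have "count_list u x = 1" using that du by (simp add: count_list_distinct)
        have "lookup \<mu> z * count_list (snd z) x + lookup \<mu> z' * count_list (snd z') x \<le> letter_weight x \<mu>"
        proof -
          have "(\<Sum>y\<in>{z, z'}. lookup \<mu> y * count_list (snd y) x) \<le> letter_weight x \<mu>"
            unfolding letter_weight_def by (rule sum_mono2) (use that z(1) in auto)
          then show ?thesis using that by auto
        qed
        moreover have "lookup \<mu> z * count_list (snd z) x = 1" using z1 \<open>count_list u x = 1\<close> by (simp add: iu)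
        ultimately have "lookup \<mu> z' * count_list (snd z') x = 0" using one[of x] by linarith
        then show ?thesis using that(2) by (auto simp: in_keys_iff count_list_0_iff)
      qed
      have su: "set u \<subseteq> {..<n}" using letters(2)[OF v] z(1) iu by blast
      define R where "R w = pscale (of_k (inverse (N i)) * emb (\<Prod>y\<in>keys \<mu> - {z}. \<rho> w y ^ lookup \<mu> y))
         (single (map ((!) w) v) (of_k (lookup (P v) \<mu>)))" for w
      let ?c = "young_symmetrizer (\<sigma> ! i)"
      have "\<rho> w z = Const (inverse (N i)) * contraction i ?c (map ((!) w) u)" for w
        using True by (simp add: \<rho>_def proj_var_def iu poly_eval_mult rename_contraction young_symmetrizer_closed)
      then have e: "pscale (emb (mono_eval (\<rho> w) \<mu>)) (single (map ((!) w) v) (of_k (lookup (P v) \<mu>))) =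
          pscale (emb (contraction i ?c (map ((!) w) u))) (R w)" for w
        unfolding R_def mono_eval_remove[OF z(1)] z1
        by (simp add: emb_mult emb_Const mult_ac del: mult_fract)
      show ?thesis unfolding e
      proof (rule contraction_factor_vanishes[OF t _ du su])
        fix w w' :: "nat list"
        assume w: "length w = n" "length w' = n" "\<And>l. l < n \<Longrightarrow> l \<notin> set u \<Longrightarrow> w ! l = w' ! l"
        have mm: "map ((!) w) s = map ((!) w') s" if "set s \<subseteq> {..<n}" "set s \<inter> set u = {}" for s
          using that w(3) by (auto simp: subset_iff disjoint_iff)
        have mv: "map ((!) w) v = map ((!) w') v" using letters(1)[OF v] away_v by (intro mm) auto
        have "\<rho> w z' = \<rho> w' z'" if z': "z' \<in> keys \<mu> - {z}" for z'
        proof -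
          obtain j s where js: "z' = (j, s)" by (cases z')
          have "map ((!) w) s = map ((!) w') s"
            using letters(2)[OF v, of j s] z' js away_z[OF _ z'] by (intro mm) auto
          then show ?thesis
            by (auto simp: \<rho>_def proj_var_def js poly_eval_mult rename_contraction young_symmetrizer_closed simp del: map_eq_conv)
        qed
        then have "(\<Prod>y\<in>keys \<mu> - {z}. \<rho> w y ^ lookup \<mu> y) = (\<Prod>y\<in>keys \<mu> - {z}. \<rho> w' y ^ lookup \<mu> y)"
          by (intro prod.cong refl) (simp only:)
        then show "R w = R w'" unfolding R_def mv by (simp only:)
      qed (use True in auto)
    qed
  qed
  then have "lext (\<lambda>w. \<Sum>v\<in>keys (F [0..<n]). \<Sum>\<mu>\<in>keys (P v).
      pscale (emb (mono_eval (\<rho> w) \<mu>)) (single (map ((!) w) v) (of_k (lookup (P v) \<mu>)))) t = 0"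
    unfolding lext_sum_fun by (intro sum.neutral ballI) auto
  moreover have "lext F t = lext (\<lambda>w. \<Sum>v\<in>keys (F [0..<n]). \<Sum>\<mu>\<in>keys (P v).
      pscale (emb (mono_eval (\<rho> w) \<mu>)) (single (map ((!) w) v) (of_k (lookup (P v) \<mu>)))) t"
    by (rule lext_cong) (rule F)
  ultimately show ?thesis by (rule trans[rotated])
qed

end

section \<open>Modules in terms of images of subspaces\<close>

lemma cring_K_ring: "cring (K_ring \<sigma>)"
proof (rule cringI)
  show "abelian_group (K_ring \<sigma>)"
  proof (rule abelian_groupI)
    fix x assume "x \<in> carrier (K_ring \<sigma>)"
    then show "\<exists>y\<in>carrier (K_ring \<sigma>). y \<oplus>\<^bsub>K_ring \<sigma>\<^esub> x = \<zero>\<^bsub>K_ring \<sigma>\<^esub>"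
      by (intro bexI[of _ "- x"]) (auto intro: K_field_uminus)
  qed (auto simp: add_ac intro: K_field_add)
  show "Group.comm_monoid (K_ring \<sigma>)"
    by (rule comm_monoidI) (auto simp: mult_ac intro: K_field_mult)
qed (auto simp: distrib_right)

lemma k_ring_simps [simp]:
  "carrier k_ring = UNIV" "x \<oplus>\<^bsub>k_ring\<^esub> y = x + y" "x \<otimes>\<^bsub>k_ring\<^esub> y = x * y"
  "\<zero>\<^bsub>k_ring\<^esub> = 0" "\<one>\<^bsub>k_ring\<^esub> = 1"
  by (simp_all add: k_ring_def)

lemma cring_k_ring: "cring (k_ring :: 'k::field ring)"
proof (rule cringI)
  show "abelian_group (k_ring :: 'k ring)"
  proof (rule abelian_groupI)
    fix x :: 'k
    show "\<exists>y\<in>carrier k_ring. y \<oplus>\<^bsub>k_ring\<^esub> x = \<zero>\<^bsub>k_ring\<^esub>" by (intro bexI[of _ "- x"]) auto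
  qed (auto simp: add_ac)
  show "Group.comm_monoid (k_ring :: 'k ring)" by (rule comm_monoidI) (auto simp: mult_ac)
qed (auto simp: distrib_right)

text \<open>Stated for an image \<open>h\<close> with scalars read through \<open>e\<close>, so as
  to cover modules of tensors and of homomorphisms, over \<open>K\<close> and over \<open>k\<close>,
  by one transfer of the axioms.\<close>

lemma module_image:
  fixes L :: "('b \<Rightarrow>\<^sub>0 'f::field) set" and M :: "('a, 'm) module" and R :: "'a ring"
  assumes R: "cring R" and e: "e \<one>\<^bsub>R\<^esub> = 1"
    "\<And>a b. a \<in> carrier R \<Longrightarrow> b \<in> carrier R \<Longrightarrow> e (a \<oplus>\<^bsub>R\<^esub> b) = e a + e b"
    "\<And>a b. a \<in> carrier R \<Longrightarrow> b \<in> carrier R \<Longrightarrow> e (a \<otimes>\<^bsub>R\<^esub> b) = e a * e b"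
    and L: "0 \<in> L" "\<And>x y. x \<in> L \<Longrightarrow> y \<in> L \<Longrightarrow> x + y \<in> L" "\<And>x. x \<in> L \<Longrightarrow> - x \<in> L"
      "\<And>a x. a \<in> carrier R \<Longrightarrow> x \<in> L \<Longrightarrow> pscale (e a) x \<in> L"
    and M: "carrier M = h ` L" "\<zero>\<^bsub>M\<^esub> = h 0"
      "\<And>x y. x \<in> L \<Longrightarrow> y \<in> L \<Longrightarrow> h x \<oplus>\<^bsub>M\<^esub> h y = h (x + y)"
      "\<And>a x. a \<in> carrier R \<Longrightarrow> x \<in> L \<Longrightarrow> a \<odot>\<^bsub>M\<^esub> h x = h (pscale (e a) x)"
  shows "module R M"
proof (rule moduleI[OF R])
  show "abelian_group M"
  proof (rule abelian_groupI)
    fix x assume "x \<in> carrier M"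
    then obtain x' where x: "x' \<in> L" "x = h x'" using M(1) by auto
    then have "h (- x') \<oplus>\<^bsub>M\<^esub> x = \<zero>\<^bsub>M\<^esub>" using M L by simp
    then show "\<exists>y\<in>carrier M. y \<oplus>\<^bsub>M\<^esub> x = \<zero>\<^bsub>M\<^esub>" using M(1) L(3)[OF x(1)] by blast
  next
    fix x y z assume "x \<in> carrier M" "y \<in> carrier M" "z \<in> carrier M"
    then show "x \<oplus>\<^bsub>M\<^esub> y \<oplus>\<^bsub>M\<^esub> z = x \<oplus>\<^bsub>M\<^esub> (y \<oplus>\<^bsub>M\<^esub> z)" using M L by (auto simp: add.assoc)
  next
    fix x y assume "x \<in> carrier M" "y \<in> carrier M"
    then show "x \<oplus>\<^bsub>M\<^esub> y \<in> carrier M" "x \<oplus>\<^bsub>M\<^esub> y = y \<oplus>\<^bsub>M\<^esub> x" using M L by (auto simp: add.commute)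
  next
    show "\<zero>\<^bsub>M\<^esub> \<in> carrier M" using M L by auto
    fix x assume "x \<in> carrier M"
    then show "\<zero>\<^bsub>M\<^esub> \<oplus>\<^bsub>M\<^esub> x = x" using M L by auto
  qed
next
  have Rc: "a \<oplus>\<^bsub>R\<^esub> b \<in> carrier R" "a \<otimes>\<^bsub>R\<^esub> b \<in> carrier R" "\<one>\<^bsub>R\<^esub> \<in> carrier R"
    if "a \<in> carrier R" "b \<in> carrier R" for a b
    using R that by (auto simp: cring_def ring.ring_simprules)
  fix a b x y assume a: "a \<in> carrier R" and x: "x \<in> carrier M"
  show "a \<odot>\<^bsub>M\<^esub> x \<in> carrier M" using a x M L by auto
  show "(a \<oplus>\<^bsub>R\<^esub> b) \<odot>\<^bsub>M\<^esub> x = a \<odot>\<^bsub>M\<^esub> x \<oplus>\<^bsub>M\<^esub> b \<odot>\<^bsub>M\<^esub> x" if "b \<in> carrier R"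
    using a x that M L e Rc by (auto simp: pscale_add_left)
  show "a \<odot>\<^bsub>M\<^esub> (x \<oplus>\<^bsub>M\<^esub> y) = a \<odot>\<^bsub>M\<^esub> x \<oplus>\<^bsub>M\<^esub> a \<odot>\<^bsub>M\<^esub> y" if "y \<in> carrier M"
    using a x that M L by (auto simp: pscale_add)
  show "(a \<otimes>\<^bsub>R\<^esub> b) \<odot>\<^bsub>M\<^esub> x = a \<odot>\<^bsub>M\<^esub> (b \<odot>\<^bsub>M\<^esub> x)" if "b \<in> carrier R"
    using a x that M L e Rc by auto
next
  have "\<one>\<^bsub>R\<^esub> \<in> carrier R" using R by (simp add: cring_def ring.ring_simprules)
  then show "\<one>\<^bsub>R\<^esub> \<odot>\<^bsub>M\<^esub> x = x" if "x \<in> carrier M" for x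
    using that M L e by auto
qed

section \<open>Polynomial vectors\<close>

text \<open>The pairs (index, length) in the list tell how to cut off the words of the variables;
  the rest of \<open>w\<close> is the word of the tensor. For a fixed list this is an equivariant
  map on a tensor power, by \<open>mono_tensor_gl\<close>.\<close>

fun mono_tensor :: "(nat \<times> nat) list \<Rightarrow> nat list \<Rightarrow> 'k::field Ktensor" where
  "mono_tensor [] w = single w 1"
| "mono_tensor ((i, l) # js) w = pscale (emb (Var i (take l w))) (mono_tensor js (drop l w))"

fun word_length :: "nat \<Rightarrow> (nat \<times> nat) list \<Rightarrow> nat" where
  "word_length n [] = n"
| "word_length n ((i, l) # js) = l + word_length n js"

lemma gl_word_append:
  assumes g: "col_finite g"
  shows "gl_word g (a @ b) = lext (\<lambda>x. lext (\<lambda>y. single (x @ y) 1) (gl_word g b)) (gl_word g a)"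
  by (induction a) (simp_all add: gl_word_Nil gl_word_Cons[OF g] lext_lext)

lemma mono_tensor_gl:
  assumes g: "regular g"
  shows "length w = word_length n js \<Longrightarrow>
    Ktensor_act g (mono_tensor js w) = lext (mono_tensor js) (kmap (gl_word g w))"
proof (induction js arbitrary: w)
  case Nil
  have "mono_tensor [] = (\<lambda>w. single w (1 :: 'a ratfun))" by (simp add: fun_eq_iff)
  then show ?case by (simp add: Ktensor_act_single g)
next
  case (Cons j js)
  obtain i l where j: "j = (i, l)" by (cases j)
  have cg: "col_finite g" using g by (rule regular_col_finite)
  let ?a = "take l w" and ?b = "drop l w"
  have len: "length ?a = l" "length ?b = word_length n js" using Cons.prems by (simp_all add: j)
  have "lext (mono_tensor (j # js)) (kmap (gl_word g w)) =
      lext (\<lambda>x. lext (\<lambda>y. mono_tensor (j # js) (x @ y)) (kmap (gl_word g ?b))) (kmap (gl_word g ?a))"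
    using gl_word_append[OF cg, of ?a ?b] by (simp add: kmap_lext lext_lext)
  also have "\<dots> = lext (\<lambda>x. pscale (emb (Var i x)) (lext (mono_tensor js) (kmap (gl_word g ?b)))) (kmap (gl_word g ?a))"
  proof (rule lext_cong)
    fix x assume "x \<in> keys (kmap (gl_word g ?a))"
    then have "length x = l" using gl_word_tensors[OF cg, of ?a] len by (auto simp: tensors_def)
    then show "lext (\<lambda>y. mono_tensor (j # js) (x @ y)) (kmap (gl_word g ?b)) =
        pscale (emb (Var i x)) (lext (mono_tensor js) (kmap (gl_word g ?b)))"
      by (simp add: j lext_pscale_fun)
  qed
  also have "\<dots> = pscale (emb (linear_form i (gl_word g ?a))) (lext (mono_tensor js) (kmap (gl_word g ?b)))"
    unfolding lext_pscale_const linear_form_def by (simp add: emb_sum emb_mult emb_Const del: mult_fract)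
  also have "\<dots> = Ktensor_act g (mono_tensor (j # js) w)"
    by (simp add: j Ktensor_act_pscale[OF g] K_act_emb[OF g] poly_act_Var Cons.IH[OF len(2)])
  finally show ?case ..
qed

lemma monomial_is_mono_tensor:
  "length v = n \<Longrightarrow> \<exists>js w. length w = word_length n js \<and> mono_tensor js w = single v (emb (single \<mu> 1 :: 'k::field mpoly))"
proof -
  assume v: "length v = n"
  let ?Q = "\<lambda>\<mu>. \<exists>js w. length w = word_length n js \<and> mono_tensor js w = single v (emb (single \<mu> 1 :: 'k mpoly))"
  have step: "?Q (single x 1 + \<mu>)" if "?Q \<mu>" for x \<mu>
  proof -
    obtain i u where x: "x = (i, u)" by (cases x)
    from that obtain js w where jw: "length w = word_length n js" "mono_tensor js w = single v (emb (single \<mu> 1 :: 'k mpoly))"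
      by blast
    have "mono_tensor ((i, length u) # js) (u @ w) = single v (emb (Var i u * single \<mu> 1 :: 'k mpoly))"
      by (simp add: jw)
    also have "Var i u * single \<mu> 1 = (single (single x 1 + \<mu>) 1 :: 'k mpoly)"
      by (simp add: Var_def mult_single x)
    finally have "mono_tensor ((i, length u) # js) (u @ w) = single v (emb (single (single x 1 + \<mu>) 1 :: 'k mpoly))" .
    moreover have "length (u @ w) = word_length n ((i, length u) # js)" using jw by simp
    ultimately show ?thesis by blast
  qed
  \<comment> \<open>Quantified over the second summand, so that the case of a sum is two successive
    applications.\<close>
  have "\<forall>\<mu>'. ?Q \<mu>' \<longrightarrow> ?Q (\<mu> + \<mu>')"
  proof (induction \<mu> rule: poly_mapping_add_induct)
    case (single x k)
    show ?case
    proof (induction k)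
      case (Suc k)
      have "single x (Suc k) + \<mu>' = single x 1 + (single x k + \<mu>')" for \<mu>'
        by (simp add: add.assoc[symmetric] single_add[symmetric])
      then show ?case using Suc step by metis
    qed simp
  next
    case (add s t)
    then show ?case by (simp add: add.assoc)
  qed simp
  moreover have "?Q 0"
    by (rule exI[of _ "[]"], rule exI[of _ v]) (simp add: v)
  ultimately show ?thesis by fastforce
qed

text \<open>An index \<open>(u, c)\<close> of the direct sum codes by \<open>c\<close> the list of pairs (index, word length) of the variables
  of a monomial; \<open>u\<close> is ignored and only matches the index type in \<open>polynomial_rep\<close>.\<close>

definition realize :: "(('u \<times> nat) \<times> nat list \<Rightarrow>\<^sub>0 'k::field) \<Rightarrow> 'k Ktensor" where
  "realize t = lext (\<lambda>((u, c), w). mono_tensor (from_nat c) w) (kmap t)"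

definition degrees :: "nat \<Rightarrow> 'u \<times> nat \<Rightarrow> nat" where
  "degrees n = (\<lambda>(u, c). word_length n (from_nat c))"

lemma realize_add: "realize (s + t) = realize s + realize t"
  and realize_zero [simp]: "realize 0 = 0"
  and realize_pscale: "realize (pscale a t) = pscale (of_k a) (realize t)"
  by (simp_all add: realize_def kmap_add kmap_pscale lext_add lext_pscale)

lemma realize_single: "realize (single ((u, c), w) a) = pscale (of_k a) (mono_tensor (from_nat c) w)"
  by (simp add: realize_def)

definition sum_carrier :: "nat \<Rightarrow> (('u \<times> nat) \<times> nat list \<Rightarrow>\<^sub>0 'k::field) set" where
  "sum_carrier n = {t. keys t \<subseteq> {(j, w). length w = degrees n j}}"

lemma tensor_sum_carrier: "tensor_sum (degrees n) = mk_module (sum_carrier n) (+) 0 (\<lambda>c. pscale c)"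
  unfolding tensor_sum_def sum_carrier_def by (rule arg_cong[where f = "\<lambda>C. mk_module C (+) 0 (\<lambda>c. pscale c)"]) auto

lemma sum_carrier_closed: "0 \<in> sum_carrier n" "s \<in> sum_carrier n \<Longrightarrow> t \<in> sum_carrier n \<Longrightarrow> s + t \<in> sum_carrier n"
  "t \<in> sum_carrier n \<Longrightarrow> pscale a t \<in> sum_carrier n"
  using keys_add[of s t] keys_pscale[of a t] by (auto simp: sum_carrier_def)

lemma sum_carrier_induct [consumes 1, case_names zero single add]:
  assumes "t \<in> sum_carrier n" and "P 0"
    and "\<And>u c w a. length w = word_length n (from_nat c) \<Longrightarrow> P (single ((u, c), w) a)"
    and "\<And>s t. s \<in> sum_carrier n \<Longrightarrow> t \<in> sum_carrier n \<Longrightarrow> P s \<Longrightarrow> P t \<Longrightarrow> P (s + t)"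
  shows "P t"
proof -
  have "keys t \<subseteq> {(j, w). length w = degrees n j}" using assms(1) by (simp add: sum_carrier_def)
  then show ?thesis
  proof (induction t rule: poly_mapping_induct_on)
    case (single x a)
    then show ?case using assms(3) by (auto simp: degrees_def split: prod.splits)
  qed (use assms in \<open>auto simp: sum_carrier_def\<close>)
qed

lemma tensor_sum_act_lext:
  "tensor_sum_act g t = lext (\<lambda>(j, w). lext (\<lambda>v. single (j, v) 1) (gl_word g w)) t"
  unfolding tensor_sum_act_def lext_def
  by (rule sum.cong) (auto simp: pscale_sum)

lemma tensor_sum_act_single:
  "tensor_sum_act g (single (j, w) a) = pscale a (lext (\<lambda>v. single (j, v) 1) (gl_word g w))"
  by (simp add: tensor_sum_act_lext)

lemma tensor_sum_act_add: "tensor_sum_act g (s + t) = tensor_sum_act g s + tensor_sum_act g t"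
  and tensor_sum_act_zero [simp]: "tensor_sum_act g 0 = 0"
  by (simp_all add: tensor_sum_act_lext lext_add)

lemma sum_carrier_act:
  assumes g: "col_finite g" and t: "t \<in> sum_carrier n" shows "tensor_sum_act g t \<in> sum_carrier n"
  using t
proof (induction t rule: sum_carrier_induct)
  case (single u c w a)
  have "keys (lext (\<lambda>v. single ((u, c), v) 1) (gl_word g w)) \<subseteq> {((u, c), v) | v. length v = length w}"
    using keys_lext[of "\<lambda>v. single ((u, c), v) 1" "gl_word g w"] gl_word_tensors[OF g, of w] by (fastforce simp: tensors_def)
  then have "lext (\<lambda>v. single ((u, c), v) 1) (gl_word g w) \<in> sum_carrier n"
    using single by (auto simp: sum_carrier_def degrees_def)
  then show ?case by (simp add: tensor_sum_act_single sum_carrier_closed)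
qed (simp_all add: tensor_sum_act_add sum_carrier_closed)

lemma realize_gl:
  assumes g: "regular g" and t: "t \<in> sum_carrier n"
  shows "realize (tensor_sum_act g t) = Ktensor_act g (realize t)"
  using t
proof (induction t rule: sum_carrier_induct)
  case (single u c w a)
  have "realize (lext (\<lambda>v. single ((u, c), v) 1) (gl_word g w)) = lext (mono_tensor (from_nat c)) (kmap (gl_word g w))"
    by (simp add: realize_def kmap_lext lext_lext)
  then show ?case
    by (simp add: tensor_sum_act_single realize_pscale realize_single Ktensor_act_pscale[OF g] g mono_tensor_gl[OF g single])
qed (simp_all add: tensor_sum_act_add realize_add Ktensor_act_add g)

text \<open>Every monomial times a word is a value of \<open>mono_tensor\<close>, so the tensors
  with polynomial coefficients form a quotient of a sum of tensor powers; this is the source of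
  polynomial representations here.\<close>

lemma realize_surj:
  fixes s :: "'k::field Ktensor"
  assumes s: "s \<in> tensors n" "s \<in> PolT"
  obtains t :: "('u \<times> nat) \<times> nat list \<Rightarrow>\<^sub>0 'k" where "t \<in> sum_carrier n" "realize t = s"
proof -
  let ?I = "realize ` (sum_carrier n :: (('u \<times> nat) \<times> nat list \<Rightarrow>\<^sub>0 'k) set)"
  have I_add: "x + y \<in> ?I" if x: "x \<in> ?I" "y \<in> ?I" for x y
  proof -
    from x obtain a b :: "('u \<times> nat) \<times> nat list \<Rightarrow>\<^sub>0 'k" where "a \<in> sum_carrier n" "x = realize a" "b \<in> sum_carrier n" "y = realize b" by blast
    then show ?thesis by (intro image_eqI[of _ _ "a + b"]) (simp_all add: realize_add sum_carrier_closed)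
  qed
  have I_sum: "sum f J \<in> ?I" if "\<And>j. j \<in> J \<Longrightarrow> f j \<in> ?I" for f and J :: "nat list set"
    using that by (induction J rule: infinite_finite_induct) (auto intro: I_add image_eqI[of _ _ 0] simp: sum_carrier_closed)
  have mono: "single v (emb p) \<in> ?I" if v: "length v = n" for v and p :: "'k mpoly"
  proof (induction p rule: poly_mapping_add_induct)
    case zero
    have "single v (emb 0) = (0 :: 'k Ktensor)" by (simp add: emb_zero[unfolded Zero_fract_def] fract_collapse)
    then show ?case by (intro image_eqI[of _ _ 0]) (simp_all add: sum_carrier_closed fract_collapse)
  next
    case (single \<mu> a)
    obtain js w where jw: "length w = word_length n js" "mono_tensor js w = single v (emb (single \<mu> 1 :: 'k mpoly))"
      using monomial_is_mono_tensor[OF v] by blast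
    let ?t = "single ((undefined, to_nat js), w) a :: ('u \<times> nat) \<times> nat list \<Rightarrow>\<^sub>0 'k"
    have "realize ?t = single v (of_k a * emb (single \<mu> 1))" by (simp add: realize_single jw(2) del: mult_fract)
    also have "of_k a * emb (single \<mu> 1) = emb (single \<mu> a)"
      unfolding emb_Const[symmetric] emb_mult[symmetric] by (simp add: Const_mult_pscale)
    finally show ?case using jw(1) by (intro image_eqI[of _ _ ?t]) (simp_all add: sum_carrier_def degrees_def)
  next
    case (add p q)
    then show ?case using I_add[OF add] unfolding emb_add single_add by blast
  qed
  have "(\<Sum>v\<in>keys s. single v (lookup s v)) \<in> ?I"
  proof (rule I_sum)
    fix v assume "v \<in> keys s"
    then have "length v = n" using s(1) by (auto simp: tensors_def)
    moreover obtain p where "lookup s v = emb p" using s(2) by (auto simp: PolT_def Pol_def)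
    ultimately show "single v (lookup s v) \<in> ?I" using mono by simp
  qed
  then show ?thesis using that by (auto simp: poly_mapping_sum_singles)
qed

lemma mk_module_simps [simp]:
  "carrier (mk_module C pl z sm) = C" "x \<oplus>\<^bsub>mk_module C pl z sm\<^esub> y = pl x y" "\<zero>\<^bsub>mk_module C pl z sm\<^esub> = z"
  "a \<odot>\<^bsub>mk_module C pl z sm\<^esub> x = sm a x" "(mk_module C pl z sm)\<lparr>carrier := H\<rparr> = mk_module H pl z sm"
  by (simp_all add: mk_module_def)

lemma module_tensors:
  fixes C :: "('a \<Rightarrow>\<^sub>0 'k::field) set"
  assumes "0 \<in> C" "\<And>x y. x \<in> C \<Longrightarrow> y \<in> C \<Longrightarrow> x + y \<in> C" "\<And>a x. x \<in> C \<Longrightarrow> pscale a x \<in> C"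
  shows "module k_ring (mk_module C (+) 0 (\<lambda>c. pscale c))"
proof (rule module_image[where L = C and h = "\<lambda>x. x" and e = "\<lambda>x. x", OF cring_k_ring])
  show "- x \<in> C" if "x \<in> C" for x using assms(3)[OF that, of "-1"] by simp
qed (use assms in auto)

text \<open>The substance is the last axiom of a \<open>K\<close>-module: clearing denominators
  turns a given element into one with coefficients in \<open>Sym\<close>, and such elements lie in
  the polynomial part.\<close>

lemma K_module_image:
  fixes L :: "'k::field_char_0 Ktensor set" and M :: "('k ratfun, 'm) module"
  assumes L: "L \<subseteq> T_power \<sigma> n" "0 \<in> L" "\<And>x y. x \<in> L \<Longrightarrow> y \<in> L \<Longrightarrow> x + y \<in> L"
      "\<And>a x. a \<in> K_field \<sigma> \<Longrightarrow> x \<in> L \<Longrightarrow> pscale a x \<in> L" "\<And>g x. regular g \<Longrightarrow> x \<in> L \<Longrightarrow> Ktensor_act g x \<in> L"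
    and M: "carrier M = h ` L" "\<zero>\<^bsub>M\<^esub> = h 0"
      "\<And>x y. x \<in> L \<Longrightarrow> y \<in> L \<Longrightarrow> h x \<oplus>\<^bsub>M\<^esub> h y = h (x + y)"
      "\<And>a x. a \<in> K_field \<sigma> \<Longrightarrow> x \<in> L \<Longrightarrow> a \<odot>\<^bsub>M\<^esub> h x = h (pscale a x)"
    and act: "\<And>g x. regular g \<Longrightarrow> x \<in> L \<Longrightarrow> \<rho> g (h x) = h (Ktensor_act g x)"
  shows "K_module \<sigma> M \<rho>"
  unfolding K_module_def
proof (intro conjI ballI)
  have neg: "- x \<in> L" if "x \<in> L" for x
    using L(4)[OF K_field_of_k[of "-1"] that] by (simp add: of_k_uminus)
  show "module (K_ring \<sigma>) M"
    by (rule module_image[where L = L and h = h and e = "\<lambda>x. x", OF cring_K_ring]) (use L M neg in auto)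
  have id_act: "\<rho> mat_one (h x) = h x" if "x \<in> L" for x
    using act[OF regular_mat_one that] by (simp add: Ktensor_act_mat_one)
  have mult_act: "\<rho> (mat_mult g g') (h x) = \<rho> g (\<rho> g' (h x))" if g: "regular g" "regular g'" and x: "x \<in> L" for g g' x
    using act[OF regular_mat_mult[OF g] x] act[OF g(1) L(5)[OF g(2) x]] act[OF g(2) x] Ktensor_act_mat_mult[OF g, of x]
    by simp
  have add_act: "\<rho> g (h x \<oplus>\<^bsub>M\<^esub> h y) = \<rho> g (h x) \<oplus>\<^bsub>M\<^esub> \<rho> g (h y)" if g: "regular g" and x: "x \<in> L" "y \<in> L" for g x y
    using act[OF g L(3)[OF x]] act[OF g x(1)] act[OF g x(2)] M(3)[OF x] M(3)[OF L(5)[OF g x(1)] L(5)[OF g x(2)]]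
      Ktensor_act_add[OF g, of x y] by simp
  show "GL_action M \<rho>" unfolding GL_action_def M(1)
    using act L(5) id_act mult_act add_act by (auto simp: GL_regular)
  show "\<rho> g (a \<odot>\<^bsub>M\<^esub> x) = K_act g a \<odot>\<^bsub>M\<^esub> \<rho> g x" if "g \<in> GL" "a \<in> K_field \<sigma>" "x \<in> carrier M" for g a x
    using that M L act by (auto simp: Ktensor_act_pscale GL_regular K_field_act)
  fix y assume "y \<in> carrier M"
  then obtain t where t: "t \<in> L" "y = h t" using M(1) by auto
  \<comment> \<open>These tensors are stable under \<open>GL\<close> and lie in the range of
    \<open>realize\<close>, and each element of \<open>L\<close> becomes one of them after
    multiplication by a common denominator.\<close>
  define Q where "Q = {x \<in> L. \<forall>v. \<exists>a\<in>Sym \<sigma>. lookup x v = emb a}"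
  have Q0: "0 \<in> Q" using L(2) by (auto simp: Q_def intro!: bexI[of _ 0])
  have Qadd: "x + x' \<in> Q" if x: "x \<in> Q" "x' \<in> Q" for x x'
  proof -
    have "\<exists>a\<in>Sym \<sigma>. lookup (x + x') v = emb a" for v
    proof -
      obtain a b where "a \<in> Sym \<sigma>" "b \<in> Sym \<sigma>" "lookup x v = emb a" "lookup x' v = emb b" using x by (auto simp: Q_def) blast
      then have "lookup (x + x') v = emb (a + b)" "a + b \<in> Sym \<sigma>"
        by (simp_all only: lookup_add emb_add Sym.add)
      then show ?thesis by blast
    qed
    then show ?thesis using x L(3) by (auto simp: Q_def)
  qed
  have Qscale: "pscale (of_k c) x \<in> Q" if x: "x \<in> Q" for c x
  proof -
    have "\<exists>a\<in>Sym \<sigma>. lookup (pscale (of_k c) x) v = emb a" for v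
    proof -
      obtain a where "a \<in> Sym \<sigma>" "lookup x v = emb a" using x by (auto simp: Q_def)
      then have "lookup (pscale (of_k c) x) v = emb (Const c * a)" "Const c * a \<in> Sym \<sigma>"
        by (simp_all only: lookup_pscale emb_mult emb_Const Sym.mult Sym.const)
      then show ?thesis by blast
    qed
    then show ?thesis using x L(4) by (auto simp: Q_def)
  qed
  have Qact: "Ktensor_act g x \<in> Q" if g: "g \<in> GL" and x: "x \<in> Q" for g x
  proof -
    have rg: "regular g" by (rule GL_regular[OF g])
    have k: "keys (Poly_Mapping.map (K_act g) x) = keys x"
      using rg by (auto simp: in_keys_iff lookup_map_hom)
    have "\<exists>a\<in>Sym \<sigma>. lookup (Ktensor_act g x) v = emb a" for v
    proof -
      have "\<forall>w. \<exists>a. a \<in> Sym \<sigma> \<and> lookup x w = emb a" using x by (auto simp: Q_def)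
      then obtain a where a: "\<And>w. a w \<in> Sym \<sigma>" "\<And>w. lookup x w = emb (a w)" by metis
      have "lookup (Ktensor_act g x) v = (\<Sum>w\<in>keys x. emb (poly_act g (a w) * Const (lookup (gl_word g w) v)))"
        unfolding Ktensor_act_lext[OF rg] lookup_lext k
        by (rule sum.cong) (simp_all add: lookup_map_hom rg a K_act_emb emb_mult emb_Const del: mult_fract)
      also have "\<dots> = emb (\<Sum>w\<in>keys x. poly_act g (a w) * Const (lookup (gl_word g w) v))" by (simp only: emb_sum)
      finally have "lookup (Ktensor_act g x) v = emb (\<Sum>w\<in>keys x. poly_act g (a w) * Const (lookup (gl_word g w) v))" .
      moreover have "(\<Sum>w\<in>I. poly_act g (a w) * Const (lookup (gl_word g w) v)) \<in> Sym \<sigma>" for I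
        by (induction I rule: infinite_finite_induct)
           (auto intro: Sym.intros Sym_gl[OF regular_col_finite[OF rg]] a)
      ultimately show ?thesis by blast
    qed
    then show ?thesis using x L(5)[OF rg] by (auto simp: Q_def)
  qed
  obtain D where D: "D \<in> Sym \<sigma>" "D \<noteq> 0" "\<And>v. \<exists>P\<in>Sym \<sigma>. emb D * lookup t v = emb P"
    using T_power_denominator[of t \<sigma> n] t(1) L(1) by blast
  let ?t = "pscale (emb D) t"
  have tQ: "?t \<in> Q" using D L(4)[OF K_field_emb[OF D(1)] t(1)] by (simp add: Q_def del: mult_fract)
  have inv: "inverse (emb D) \<in> K_field \<sigma>" by (rule K_field_inverse[OF K_field_emb[OF D(1)]])
  have QL: "Q \<subseteq> L" by (auto simp: Q_def)
  have "y = inverse (emb D) \<odot>\<^bsub>M\<^esub> h ?t"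
  proof -
    have "inverse (emb D) * emb D = 1" using D(2) by (intro left_inverse) simp
    then have "pscale (inverse (emb D)) ?t = t" unfolding pscale_pscale by (simp only: pscale_one)
    then show ?thesis using M(4)[OF inv, of ?t] QL tQ t(2) by auto
  qed
  moreover have "h ?t \<in> pol_part (restrict_scalars M) \<rho>"
  proof -
    let ?M = "restrict_scalars M" and ?P = "h ` Q"
    have Qneg: "- x \<in> Q" if "x \<in> Q" for x using Qscale[OF that, of "-1"] by (simp add: of_k_uminus)
    have rs: "?M = mk_module (h ` L) (\<oplus>\<^bsub>M\<^esub>) (h 0) (\<lambda>c x. of_k c \<odot>\<^bsub>M\<^esub> x)"
      by (simp add: restrict_scalars_def M)
    have m1: "module k_ring ?M" unfolding rs
      by (rule module_image[where L = L and h = h and e = of_k, OF cring_k_ring])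
         (use L M neg in \<open>auto simp: of_k_add of_k_mult\<close>)
    have m2: "module k_ring (?M\<lparr>carrier := ?P\<rparr>)" unfolding rs mk_module_simps
      by (rule module_image[where L = Q and h = h and e = of_k, OF cring_k_ring])
         (use Q0 Qadd Qneg Qscale QL M in \<open>auto simp: of_k_add of_k_mult subset_iff\<close>)
    have sub: "subrep ?M \<rho> ?P" unfolding subrep_def
    proof (intro conjI ballI)
      show "submodule ?P k_ring ?M"
        by (rule module.module_incl_imp_submodule[OF m1 _ m2]) (use QL in \<open>auto simp: rs\<close>)
      show "\<rho> g x \<in> ?P" if "g \<in> GL" "x \<in> ?P" for g x
        using that act[OF GL_regular] Qact QL by (auto simp: subset_iff)
    qed
    \<comment> \<open>The preimage of \<open>Q\<close> under \<open>realize\<close>, which is the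
      subrepresentation that \<open>polynomial_rep\<close> asks for.\<close>
    let ?A = "{s \<in> sum_carrier n. realize s \<in> Q} :: (('m \<times> nat) \<times> nat list \<Rightarrow>\<^sub>0 'k) set"
    have A0: "0 \<in> ?A" using Q0 by (simp add: sum_carrier_closed)
    have Aadd: "x + y \<in> ?A" if "x \<in> ?A" "y \<in> ?A" for x y
      using that Qadd by (simp add: sum_carrier_closed realize_add)
    have Ascale: "pscale a x \<in> ?A" if "x \<in> ?A" for a x
      using that Qscale by (simp add: sum_carrier_closed realize_pscale)
    have subA: "subrep (tensor_sum (degrees n)) tensor_sum_act ?A"
      unfolding subrep_def tensor_sum_carrier
    proof (intro conjI ballI)
      show "submodule ?A k_ring (mk_module (sum_carrier n) (+) 0 (\<lambda>c. pscale c))"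
      proof (rule module.module_incl_imp_submodule)
        show "module k_ring (mk_module (sum_carrier n) (+) 0 (\<lambda>c. pscale c) :: ('k, ('m \<times> nat) \<times> nat list \<Rightarrow>\<^sub>0 'k) module)"
          by (rule module_tensors) (simp_all add: sum_carrier_closed)
        show "module k_ring ((mk_module (sum_carrier n) (+) 0 (\<lambda>c. pscale c))\<lparr>carrier := ?A\<rparr>)"
          unfolding mk_module_simps by (rule module_tensors) (use A0 Aadd Ascale in blast)+
      qed auto
      show "tensor_sum_act g x \<in> ?A" if "g \<in> GL" "x \<in> ?A" for g x
        using that Qact realize_gl[OF GL_regular[OF that(1)], of x n]
          sum_carrier_act[OF regular_col_finite[OF GL_regular[OF that(1)]], of x n] by simp
    qed
    let ?f = "\<lambda>s. h (realize s)"
    have lin: "linear_map k_ring ((tensor_sum (degrees n))\<lparr>carrier := ?A\<rparr>) (?M\<lparr>carrier := ?P\<rparr>) ?f"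
      unfolding linear_map_def tensor_sum_carrier rs mk_module_simps
      using QL M(3) M(4)[OF K_field_of_k] by (auto simp: realize_add realize_pscale subset_iff)
    have equ: "equivariant ((tensor_sum (degrees n))\<lparr>carrier := ?A\<rparr>) tensor_sum_act \<rho> ?f"
      unfolding equivariant_def tensor_sum_carrier mk_module_simps
      using QL act by (auto simp: realize_gl GL_regular subset_iff)
    have onto: "?f ` ?A = carrier (?M\<lparr>carrier := ?P\<rparr>)"
    proof -
      have "realize ` ?A = Q"
      proof (intro equalityI subsetI)
        fix x assume x: "x \<in> Q"
        then have "x \<in> tensors n" using QL L(1) T_power_tensors by blast
        moreover have "x \<in> PolT" using x by (auto simp: Q_def PolT_def) (metis Pol_emb)
        ultimately obtain s :: "('m \<times> nat) \<times> nat list \<Rightarrow>\<^sub>0 'k" where "s \<in> sum_carrier n" "realize s = x"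
          by (rule realize_surj)
        then show "x \<in> realize ` ?A" using x by blast
      qed auto
      then show ?thesis by (simp add: image_image[symmetric])
    qed
    have "polynomial_rep (?M\<lparr>carrier := ?P\<rparr>) \<rho>"
      unfolding polynomial_rep_def using subA lin equ onto by blast
    then show ?thesis unfolding pol_part_def using sub tQ by blast
  qed
  ultimately show "\<exists>a\<in>K_field \<sigma>. \<exists>x\<in>pol_part (restrict_scalars M) \<rho>. y = a \<odot>\<^bsub>M\<^esub> x" using inv by blast
qed

section \<open>The simple module and the isotypic piece\<close>

lemma K_schur_quasi_idempotent:
  assumes t: "t \<in> K_schur \<sigma> p"
    and N: "young_symmetrizer p \<star> young_symmetrizer p = pscale N (young_symmetrizer p)"
  shows "ract t (young_symmetrizer p) = pscale (of_k N) t"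
proof -
  from t obtain u where u: "u \<in> T_power \<sigma> (sum_list p)" "t = ract u (young_symmetrizer p)" by (auto simp: K_schur_iff)
  show ?thesis
    unfolding u(2) ract_mult[OF T_power_tensors[OF u(1)] young_symmetrizer_closed young_symmetrizer_closed] N
    by (rule ract_pscale_right)
qed

text \<open>Composing \<open>f\<close> with right multiplication by \<open>c\<close> gives an
  equivariant function on words, to which \<open>F_vanishes\<close> applies. On
  \<open>K_schur \<sigma> p\<close> this multiplication is the nonzero scalar \<open>N\<close>, so
  \<open>f t\<close> itself vanishes.\<close>

lemma T_bracket_K_schur_killed:
  fixes t :: "'k::field_char_0 Ktensor"
  assumes \<sigma>: "pure_tuple \<sigma>" and p: "is_partition p" and t: "t \<in> T_bracket \<sigma> (sum_list p)" "t \<in> K_schur \<sigma> p"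
    and q: "sum_list q < sum_list p"
    and f: "K_module_hom \<sigma> (Ktensor_module (K_schur \<sigma> p)) Ktensor_act (Ktensor_module (K_schur \<sigma> q)) Ktensor_act f"
  shows "f t = 0"
proof -
  let ?n = "sum_list p" and ?c = "young_symmetrizer p :: 'k galg"
  obtain N :: 'k where N: "N \<noteq> 0" "?c \<star> ?c = pscale N ?c" using young_symmetrizer_quasi_idempotent[OF p] by metis
  have f_into: "f x \<in> K_schur \<sigma> q" if "x \<in> K_schur \<sigma> p" for x using f that by (simp add: K_module_hom_Ktensor_iff)
  have f_add: "f (x + y) = f x + f y" if "x \<in> K_schur \<sigma> p" "y \<in> K_schur \<sigma> p" for x y
    using f that by (simp add: K_module_hom_Ktensor_iff)
  have f_scale: "f (pscale a x) = pscale a (f x)" if "a \<in> K_field \<sigma>" "x \<in> K_schur \<sigma> p" for a x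
    using f that by (simp add: K_module_hom_Ktensor_iff)
  have f_gl: "f (Ktensor_act g x) = Ktensor_act g (f x)" if "g \<in> GL" "x \<in> K_schur \<sigma> p" for g x
    using f that by (simp add: K_module_hom_Ktensor_iff)
  have f0: "f 0 = 0" using f_scale[of 0 0] by simp
  define F where "F w = f (ract (single w 1) ?c)" for w
  have e: "ract (single w 1) ?c \<in> K_schur \<sigma> p" if "length w = ?n" for w
    using that by (intro K_schur_ract T_power_single) auto
  have lin: "f (ract u ?c) = lext F u" if "u \<in> T_power \<sigma> ?n" for u
    using that
  proof (induction u rule: T_power_induct)
    case zero
    then show ?case by (simp add: f0)
  next
    case (single w x)
    have "ract (single w x) ?c = pscale x (ract (single w 1) ?c)"
      using ract_pscale_left[of x "single w 1" ?c] by simp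
    then show ?case using f_scale[OF single(2) e[OF single(1)]] by (simp add: F_def)
  next
    case (add a b)
    then show ?case using f_add[OF K_schur_ract[OF add(1)] K_schur_ract[OF add(2)]]
      by (simp add: ract_add_left lext_add)
  qed
  interpret word_map \<sigma> ?n "sum_list q" F
  proof
    show "F w \<in> T_power \<sigma> (sum_list q)" if "length w = ?n" for w
      unfolding F_def using K_schur_T_power[OF f_into[OF e[OF that]]] .
    show "Ktensor_act g (F w) = lext F (kmap (gl_word g w))" if g: "g \<in> GL" and w: "length w = ?n" for g w
    proof -
      have rg: "regular g" by (rule GL_regular[OF g])
      have "Ktensor_act g (F w) = f (ract (Ktensor_act g (single w 1)) ?c)"
        unfolding F_def f_gl[OF g e[OF w], symmetric]
        by (simp add: Ktensor_act_ract[OF tensors_single[OF w] young_symmetrizer_closed rg])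
      also have "Ktensor_act g (single w 1) = kmap (gl_word g w)" by (simp add: Ktensor_act_single rg)
      also have "f (ract (kmap (gl_word g w)) ?c) = lext F (kmap (gl_word g w))"
        by (intro lin T_power_kmap gl_word_closed regular_col_finite rg w)
      finally show ?thesis .
    qed
  qed (use \<sigma> q in auto)
  have "pscale (of_k N) (f t) = f (pscale (of_k N) t)" using f_scale[OF K_field_of_k t(2)] by simp
  also have "pscale (of_k N) t = ract t ?c" by (rule K_schur_quasi_idempotent[OF t(2) N(2), symmetric])
  also have "f (ract t ?c) = 0" using lin[OF T_bracket_T_power[OF t(1)]] F_vanishes[OF t(1)] by simp
  finally show ?thesis using N(1) by simp
qed

theorem L_simple_eq:
  fixes \<sigma> :: "nat list list"
  assumes "pure_tuple \<sigma>" "is_partition p"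
  shows "L_simple \<sigma> p = (T_bracket \<sigma> (sum_list p) \<inter> K_schur \<sigma> p :: 'k::field_char_0 Ktensor set)"
proof (intro equalityI subsetI)
  fix t :: "'k Ktensor" assume "t \<in> L_simple \<sigma> p"
  then show "t \<in> T_bracket \<sigma> (sum_list p) \<inter> K_schur \<sigma> p"
    using L_simple_subset_T_bracket[OF assms(1)] by (auto simp: L_simple_def)
next
  fix t :: "'k Ktensor" assume t: "t \<in> T_bracket \<sigma> (sum_list p) \<inter> K_schur \<sigma> p"
  show "t \<in> L_simple \<sigma> p" unfolding L_simple_def
  proof (intro CollectI conjI allI impI)
    fix q and f :: "'k Ktensor \<Rightarrow> 'k Ktensor" assume h: "is_partition q \<and> sum_list q < sum_list p \<and>
      K_module_hom \<sigma> (Ktensor_module (K_schur \<sigma> p)) Ktensor_act (Ktensor_module (K_schur \<sigma> q)) Ktensor_act f"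
    show "f t = 0" by (rule T_bracket_K_schur_killed[OF assms]) (use t h in auto)
  qed (use t in simp)
qed

section \<open>Passage between tensors and homomorphisms from the Specht module\<close>

lemma specht_add: assumes "x \<in> specht p" "y \<in> specht p" shows "x + y \<in> specht p"
proof -
  obtain a b where "a \<in> group_algebra (sum_list p)" "x = a \<star> young_symmetrizer p"
    "b \<in> group_algebra (sum_list p)" "y = b \<star> young_symmetrizer p" using assms by (auto simp: specht_iff)
  then show ?thesis unfolding specht_iff
    by (intro bexI[of _ "a + b"]) (auto simp: galg_mult_add_left intro: group_algebra_add)
qed

lemma specht_pscale: assumes "x \<in> specht p" shows "pscale a x \<in> specht p"
proof -
  obtain b where "b \<in> group_algebra (sum_list p)" "x = b \<star> young_symmetrizer p" using assms by (auto simp: specht_iff)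
  then show ?thesis unfolding specht_iff
    by (intro bexI[of _ "pscale a b"]) (auto simp: galg_mult_pscale_left intro: group_algebra_pscale)
qed

lemma young_symmetrizer_specht: "young_symmetrizer p \<in> specht p"
  unfolding specht_iff by (rule bexI[of _ "single id 1"]) (auto intro: group_algebra_single permutes_id)

text \<open>Right multiplication by \<open>C\<close> and \<open>R\<close> exchanges \<open>T c\<close> and \<open>T c\<^sup>*\<close>.  The antipode enters because the left
  action on tensors is the right action twisted by it.\<close>

definition to_hom :: "nat list \<Rightarrow> 'k::field Ktensor \<Rightarrow> ('k galg \<Rightarrow> 'k Ktensor)" where
  "to_hom p t = (\<lambda>x. if x \<in> specht p then ract t (signed_column_sum p \<star> star x) else 0)"

text \<open>Composed with \<open>to_hom\<close>, evaluation at \<open>c\<close> followed by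
  \<open>R\<close> is right multiplication by
  \<open>C \<star> star c \<star> R = c \<star> c\<close>, which acts on
  \<open>K_schur \<sigma> p\<close> as \<open>N * N\<close>; the constant undoes this.\<close>

definition from_hom :: "nat list \<Rightarrow> 'k \<Rightarrow> ('k::field galg \<Rightarrow> 'k Ktensor) \<Rightarrow> 'k Ktensor" where
  "from_hom p N f = pscale (of_k (inverse (N * N))) (ract (f (young_symmetrizer p)) (row_sum p))"

lemma to_hom_isotypic:
  assumes t: "t \<in> T_bracket \<sigma> (sum_list p)"
  shows "to_hom p t \<in> isotypic_hom \<sigma> (sum_list p) p"
proof -
  let ?n = "sum_list p" and ?C = "signed_column_sum p"
  have tn: "t \<in> tensors ?n" using T_power_tensors[OF T_bracket_T_power[OF t]] .
  have cl: "?C \<star> star x \<in> group_algebra ?n" if "x \<in> specht p" for x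
    by (intro group_algebra_mult column_sum_closed star_closed specht_closed that)
  have lin: "linear_map k_ring (specht_module p) (restrict_scalars (Ktensor_module (T_bracket \<sigma> ?n))) (to_hom p t)"
    unfolding linear_map_def specht_module_def restrict_scalars_def
    by (auto simp: to_hom_def specht_add specht_pscale star_add star_pscale galg_mult_add_right
        galg_mult_pscale_right ract_add_right ract_pscale_right intro!: T_bracket_ract[OF t] cl)
  have equ: "to_hom p t (galg_act s x) = place_act s (to_hom p t x)" if s: "s permutes {..<?n}" and x: "x \<in> specht p" for s x
  proof -
    have sg: "single s 1 \<in> group_algebra ?n" "single (inv_into UNIV s) 1 \<in> group_algebra ?n"
      using s by (auto intro: group_algebra_single permutes_inv)
    have "galg_act s x \<in> specht p" unfolding galg_act_def by (rule specht_mult[OF x sg(1)])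
    then have "to_hom p t (galg_act s x) = ract t (?C \<star> (star x \<star> single (inv_into UNIV s) 1))"
      by (simp add: to_hom_def galg_act_def star_mult[OF sg(1) specht_closed[OF x]])
    also have "\<dots> = ract (ract t (?C \<star> star x)) (single (inv_into UNIV s) 1)"
      by (simp add: ract_mult[OF tn cl[OF x] sg(2)] galg_mult_assoc)
    finally show ?thesis using x by (simp add: to_hom_def place_act_ract)
  qed
  show ?thesis unfolding isotypic_hom_def using lin equ by (auto simp: to_hom_def)
qed

lemma isotypic_homD:
  assumes f: "f \<in> isotypic_hom \<sigma> (sum_list p) p"
  shows "x \<in> specht p \<Longrightarrow> f x \<in> T_bracket \<sigma> (sum_list p)"
    "x \<in> specht p \<Longrightarrow> y \<in> specht p \<Longrightarrow> f (x + y) = f x + f y"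
    "x \<in> specht p \<Longrightarrow> f (pscale a x) = pscale (of_k a) (f x)"
    "s permutes {..<sum_list p} \<Longrightarrow> x \<in> specht p \<Longrightarrow> f (single s 1 \<star> x) = ract (f x) (single (inv_into UNIV s) 1)"
    "x \<notin> specht p \<Longrightarrow> f x = 0"
  using f unfolding isotypic_hom_def linear_map_def specht_module_def restrict_scalars_def
  by (auto simp: galg_act_def place_act_ract)

text \<open>The inverse in the left action on tensors becomes \<open>star\<close> after linear
  extension. With \<open>x\<close> the Young symmetrizer, a homomorphism is determined by its value
  there.\<close>

lemma isotypic_hom_star:
  assumes f: "f \<in> isotypic_hom \<sigma> (sum_list p) p" and a: "a \<in> group_algebra (sum_list p)" and x: "x \<in> specht p"
  shows "f (a \<star> x) = ract (f x) (star a)"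
  using a
proof (induction a rule: group_algebra_induct)
  case zero
  have "f 0 = 0" using isotypic_homD(3)[OF f x, of 0] by simp
  then show ?case by simp
next
  case (single s c)
  have "f (pscale c (single s 1 \<star> x)) = pscale (of_k c) (ract (f x) (single (inv_into UNIV s) 1))"
    using isotypic_homD(3)[OF f specht_mult[OF x group_algebra_single[OF single, of 1]], of c]
      isotypic_homD(4)[OF f single x] by simp
  then show ?case
    using galg_mult_pscale_left[of c "single s 1" x] ract_pscale_right[of "f x" c "single (inv_into UNIV s) 1"] by simp
next
  case (add a b)
  then show ?case
    using isotypic_homD(2)[OF f specht_mult[OF x add(1)] specht_mult[OF x add(2)]]
    by (simp add: galg_mult_add_left star_add ract_add_right)
qed

context
  fixes \<sigma> :: "nat list list" and p :: "nat list" and N :: "'k::field_char_0"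
  assumes \<sigma>: "pure_tuple \<sigma>" and p: "is_partition p" and N0: "N \<noteq> 0"
    and N: "young_symmetrizer p \<star> young_symmetrizer p = pscale N (young_symmetrizer p)"
begin

abbreviation (input) "L \<equiv> (T_bracket \<sigma> (sum_list p) \<inter> K_schur \<sigma> p :: 'k Ktensor set)"

lemma rescale: "pscale (of_k (inverse (N * N))) (pscale (of_k N) (pscale (of_k N) x)) = (x :: 'k Ktensor)"
proof -
  have "of_k (inverse (N * N)) * (of_k N * of_k N) = (of_k (inverse (N * N) * (N * N)) :: 'k ratfun)"
    by (simp only: of_k_mult)
  also have "inverse (N * N) * (N * N) = 1" using N0 by (intro left_inverse) simp
  finally show ?thesis by (simp only: pscale_pscale pscale_one of_k_one)
qed

lemma from_hom_to_hom:
  assumes t: "t \<in> L" shows "from_hom p N (to_hom p t) = t"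
proof -
  let ?n = "sum_list p" and ?c = "young_symmetrizer p :: 'k galg" and ?C = "signed_column_sum p :: 'k galg" and ?R = "row_sum p :: 'k galg"
  have tn: "t \<in> tensors ?n" using t T_power_tensors[OF T_bracket_T_power] by blast
  note cl = column_sum_closed[of p] row_sum_closed[of p] young_symmetrizer_closed[of p]
  have "ract (to_hom p t ?c) ?R = ract t (?C \<star> star ?c \<star> ?R)"
    by (simp add: to_hom_def young_symmetrizer_specht ract_mult[OF tn group_algebra_mult[OF cl(1) star_closed[OF cl(3)]] cl(2)])
  also have "?C \<star> star ?c \<star> ?R = ?c \<star> ?c"
    unfolding star_young_symmetrizer by (simp add: young_symmetrizer_def galg_mult_assoc)
  also have "ract t (?c \<star> ?c) = pscale (of_k N) (pscale (of_k N) t)"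
  proof -
    have "ract t ?c = pscale (of_k N) t" by (rule K_schur_quasi_idempotent[OF _ N]) (use t in blast)
    then show ?thesis unfolding N ract_pscale_right by simp
  qed
  finally show ?thesis by (simp only: from_hom_def rescale)
qed

text \<open>For \<open>u = f c\<close>, the relation \<open>c \<star> c = pscale N c\<close> makes
  \<open>u\<close> an eigenvector of \<open>star c = R \<star> C\<close> with eigenvalue
  \<open>N\<close>. Hence \<open>u R c = u (R C) R\<close> is \<open>N\<close> times
  \<open>u R\<close>, which places \<open>u R\<close> in \<open>K_schur \<sigma> p\<close>; applying
  \<open>star c\<close> twice yields the factor removed by \<open>from_hom\<close>.\<close>

lemma from_hom_L:
  assumes f: "f \<in> isotypic_hom \<sigma> (sum_list p) p"
  shows "from_hom p N f \<in> L" "to_hom p (from_hom p N f) = f"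
proof -
  let ?n = "sum_list p" and ?c = "young_symmetrizer p :: 'k galg" and ?C = "signed_column_sum p :: 'k galg" and ?R = "row_sum p :: 'k galg"
  note cl = column_sum_closed[of p, where 'a = 'k] row_sum_closed[of p, where 'a = 'k] young_symmetrizer_closed[of p, where 'a = 'k]
  let ?u = "f ?c"
  have uB: "?u \<in> T_bracket \<sigma> ?n" by (rule isotypic_homD(1)[OF f young_symmetrizer_specht])
  have uT: "?u \<in> T_power \<sigma> ?n" and un: "?u \<in> tensors ?n"
    using T_bracket_T_power[OF uB] T_power_tensors by blast+
  have sc: "star ?c = ?R \<star> ?C" by (rule star_young_symmetrizer)
  have u: "ract ?u (star ?c) = pscale (of_k N) ?u"
    using isotypic_hom_star[OF f cl(3) young_symmetrizer_specht] isotypic_homD(3)[OF f young_symmetrizer_specht, of N]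
    unfolding N by simp
  have "ract ?u ?R = pscale (of_k (inverse N)) (ract (ract ?u ?R) ?c)"
  proof -
    have "ract (ract ?u ?R) ?c = ract (ract ?u (star ?c)) ?R"
      unfolding sc ract_mult[OF un cl(2) cl(3)] ract_mult[OF un group_algebra_mult[OF cl(2,1)] cl(2)]
      by (simp add: young_symmetrizer_def galg_mult_assoc)
    also have "\<dots> = pscale (of_k N) (ract ?u ?R)" unfolding u by (rule ract_pscale_left)
    finally show ?thesis using N0 by (simp add: of_k_mult[symmetric])
  qed
  moreover have "ract (ract ?u ?R) ?c \<in> K_schur \<sigma> p" by (intro K_schur_ract ract_T_power uT cl)
  ultimately have "ract ?u ?R \<in> K_schur \<sigma> p" using K_schur_pscale[OF K_field_of_k] by metis
  then show "from_hom p N f \<in> L"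
    unfolding from_hom_def using K_schur_pscale[OF K_field_of_k] T_bracket_pscale[OF K_field_of_k T_bracket_ract[OF uB cl(2)]] by blast
  show "to_hom p (from_hom p N f) = f"
  proof
    fix x
    show "to_hom p (from_hom p N f) x = f x"
    proof (cases "x \<in> specht p")
      case True
      then obtain a where a: "a \<in> group_algebra ?n" "x = a \<star> ?c" by (auto simp: specht_iff)
      have sa: "star a \<in> group_algebra ?n" "star ?c \<in> group_algebra ?n" using a(1) cl(3) by (auto intro: star_closed)
      have "?C \<star> star x = ?C \<star> star ?c \<star> star a"
        using star_mult[OF a(1) cl(3)] a(2) by (simp add: galg_mult_assoc)
      then have "ract (ract ?u ?R) (?C \<star> star x) = ract ?u (?R \<star> (?C \<star> star ?c \<star> star a))"
        by (simp add: ract_mult[OF un cl(2) group_algebra_mult[OF group_algebra_mult[OF cl(1) sa(2)] sa(1)]])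
      also have "?R \<star> (?C \<star> star ?c \<star> star a) = star ?c \<star> star ?c \<star> star a"
        by (simp add: sc galg_mult_assoc)
      also have "ract ?u (star ?c \<star> star ?c \<star> star a) = ract (ract (ract ?u (star ?c)) (star ?c)) (star a)"
        by (simp add: ract_mult[OF un sa(2) sa(2)] ract_mult[OF un group_algebra_mult[OF sa(2) sa(2)] sa(1)])
      also have "\<dots> = pscale (of_k N) (pscale (of_k N) (ract ?u (star a)))"
        by (simp add: u ract_pscale_left)
      also have "ract ?u (star a) = f x"
        using isotypic_hom_star[OF f a(1) young_symmetrizer_specht] a(2) by simp
      finally have "ract (ract ?u ?R) (?C \<star> star x) = pscale (of_k N) (pscale (of_k N) (f x))" .
      then show ?thesis using True by (simp only: to_hom_def from_hom_def ract_pscale_left rescale if_True)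
    next
      case False
      then show ?thesis using isotypic_homD(5)[OF f] by (simp add: to_hom_def)
    qed
  qed
qed

lemma to_hom_image: "to_hom p ` L = isotypic_hom \<sigma> (sum_list p) p"
  using to_hom_isotypic from_hom_L by (auto intro!: image_eqI[where x = "from_hom p N _"]) 

lemma to_hom_act:
  assumes g: "regular g" and t: "t \<in> L" shows "isotypic_act g (to_hom p t) = to_hom p (Ktensor_act g t)"
proof
  fix x
  have tn: "t \<in> tensors (sum_list p)" using t T_power_tensors[OF T_bracket_T_power] by blast
  show "isotypic_act g (to_hom p t) x = to_hom p (Ktensor_act g t) x"
  proof (cases "x \<in> specht p")
    case True
    have "signed_column_sum p \<star> star x \<in> group_algebra (sum_list p)"
      by (intro group_algebra_mult column_sum_closed star_closed specht_closed True)
    then show ?thesis using True by (simp add: isotypic_act_def to_hom_def Ktensor_act_ract[OF tn _ g])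
  qed (simp add: isotypic_act_def to_hom_def)
qed

lemma L_closed:
  "L \<subseteq> T_power \<sigma> (sum_list p)" "0 \<in> L" "x \<in> L \<Longrightarrow> y \<in> L \<Longrightarrow> x + y \<in> L"
  "a \<in> K_field \<sigma> \<Longrightarrow> x \<in> L \<Longrightarrow> pscale a x \<in> L" "regular g \<Longrightarrow> x \<in> L \<Longrightarrow> Ktensor_act g x \<in> L"
  by (auto intro: T_bracket_T_power T_bracket_add K_schur_add T_bracket_pscale K_schur_pscale T_bracket_gl K_schur_gl)

lemma isotypic_isomorphic:
  "K_module_isomorphic \<sigma> (isotypic_module \<sigma> (sum_list p) p) isotypic_act (Ktensor_module L) Ktensor_act"
proof -
  let ?M = "isotypic_module \<sigma> (sum_list p) p :: ('k ratfun, 'k galg \<Rightarrow> 'k Ktensor) module"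
  have M: "carrier ?M = isotypic_hom \<sigma> (sum_list p) p" "f \<oplus>\<^bsub>?M\<^esub> f' = (\<lambda>x. f x + f' x)" "\<zero>\<^bsub>?M\<^esub> = (\<lambda>x. 0)"
    "a \<odot>\<^bsub>?M\<^esub> f = (\<lambda>x. pscale a (f x))" for f f' a
    by (simp_all add: isotypic_module_def)
  have 1: "K_module \<sigma> (Ktensor_module L) Ktensor_act"
    by (rule K_module_image[where h = "\<lambda>x. x", OF L_closed]) simp_all
  \<comment> \<open>The module structure on homomorphisms is transported along
    \<open>to_hom p\<close>, which reaches all of them by \<open>to_hom_image\<close>.\<close>
  have 2: "K_module \<sigma> ?M isotypic_act"
    by (rule K_module_image[where h = "to_hom p", OF L_closed])
       (simp_all add: M to_hom_image to_hom_act, auto simp: to_hom_def ract_add_left ract_pscale_left fun_eq_iff)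
  have hom: "K_module_hom \<sigma> ?M isotypic_act (Ktensor_module L) Ktensor_act (from_hom p N)"
    unfolding K_module_hom_def linear_map_def equivariant_def M
  proof (intro conjI ballI)
    fix f f' :: "'k galg \<Rightarrow> 'k Ktensor" and a :: "'k ratfun" and g :: "'k mat"
    assume f: "f \<in> isotypic_hom \<sigma> (sum_list p) p"
    show "from_hom p N f \<in> carrier (Ktensor_module L)" using from_hom_L(1)[OF f] by simp
    show "from_hom p N (\<lambda>x. f x + f' x) = from_hom p N f \<oplus>\<^bsub>Ktensor_module L\<^esub> from_hom p N f'"
      by (simp add: from_hom_def ract_add_left pscale_add)
    show "from_hom p N (\<lambda>x. pscale a (f x)) = a \<odot>\<^bsub>Ktensor_module L\<^esub> from_hom p N f"
      by (simp add: from_hom_def ract_pscale_left mult.commute)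
    show "from_hom p N (isotypic_act g f) = Ktensor_act g (from_hom p N f)" if "g \<in> GL"
    proof -
      have g: "regular g" using that by (rule GL_regular)
      have "f (young_symmetrizer p) \<in> tensors (sum_list p)"
        using T_power_tensors[OF T_bracket_T_power[OF isotypic_homD(1)[OF f young_symmetrizer_specht]]] .
      then show ?thesis
        by (simp add: from_hom_def isotypic_act_def Ktensor_act_pscale[OF g] Ktensor_act_ract[OF _ row_sum_closed g] g)
    qed
  qed
  have "bij_betw (from_hom p N) (isotypic_hom \<sigma> (sum_list p) p) L"
    by (rule bij_betwI[where g = "to_hom p"])
       (use from_hom_L from_hom_to_hom to_hom_isotypic in auto)
  then show ?thesis unfolding K_module_isomorphic_def using 1 2 hom by (auto simp: M)
qed

end

theorem proposition5p11:
  fixes \<sigma> :: "nat list list" and p :: "nat list" and n :: nat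
  assumes "pure_tuple \<sigma>"
    and "is_partition p" and "sum_list p = n"
  shows "K_module_isomorphic \<sigma>
    (isotypic_module \<sigma> n p :: ('k::field_char_0 ratfun, 'k galg \<Rightarrow> 'k Ktensor) module) isotypic_act
    (Ktensor_module (L_simple \<sigma> p)) Ktensor_act"
proof -
  obtain N :: 'k where "N \<noteq> 0" "young_symmetrizer p \<star> young_symmetrizer p = pscale N (young_symmetrizer p)"
    using young_symmetrizer_quasi_idempotent[OF assms(2)] by metis
  then show ?thesis
    using isotypic_isomorphic[OF assms(1,2)] L_simple_eq[OF assms(1,2), where ?'k = 'k] assms(3) by simp
qed

end
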